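(* For each $\varepsilon\in[0,\varepsilon^*]$ there is a unique minimizer $(\bar u_\varepsilon,\bar v_\varepsilon)$ of $\mathbf{E}_\varepsilon$ on $[\mathcal{P}_2^r(\mathbb{R}^d)]^2$. The densities $\bar u_\varepsilon$ and $\bar v_\varepsilon$ have compact supports that are sublevel sets of $\Phi$ and $\Psi$, respectively. Further, if $(F,G,h)$ is $k$-degenerate for some $k\in\mathbb{N}$, then the restrictions of $F'(\bar u_\varepsilon)$ and $G'(\bar v_\varepsilon)$ to the respective supports of $\bar u_\varepsilon$ and $\bar v_\varepsilon$ are bounded in $C^k$, uniformly with respect to $\varepsilon\in[0,\varepsilon^*]$.
   Context: $\mathbb{R}_{>0}=(0,\infty)$, $\mathbb{R}_{\ge0}=[0,\infty)$, $\mathbf 1$ is the $d\times d$ identity matrix. $\mathcal{P}_2^r(\mathbb{R}^d)$ is the set of probability densities $u:\mathbb{R}^d\to\mathbb{R}_{\ge0}$ (with respect to Lebesgue measure) of finite second moment. Standing assumptions. (Potentials) $\Phi,\Psi\in C^\infty(\mathbb{R}^d)$; there are constants $\Lambda,M>0$ with $\Lambda\mathbf 1\le\nabla^2\Phi\le M\mathbf 1$ and $\Lambda\mathbf 1\le\nabla^2\Psi\le M\mathbf 1$; and $0=\inf\Phi=\Phi(\underline x_\Phi)$, $0=\inf\Psi=\Psi(\underline x_\Psi)$ for some points $\underline x_\Phi,\underline x_\Psi\in\mathbb{R}^d$. (Nonlinearities) $F,G\in C^\infty(\mathbb{R}_{>0})\cap C^1(\mathbb{R}_{\ge0})$ with $F''(r)>0$,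 $G''(r)>0$ for all $r>0$; $\liminf_{r\to\infty}F''(r)>0$, $\liminf_{r\to\infty}G''(r)>0$; $F(0)=G(0)=0$, $F'(0)=G'(0)=0$; there are exponents $m,n\ge2$ with $\lim_{r\downarrow0}r^{-(m-2)}F''(r)\in(0,\infty)$ and $\lim_{r\downarrow0}r^{-(n-2)}G''(r)\in(0,\infty)$; McCann's condition $rF'(r)\le F(r)+r^2F''(r)$, $rG'(r)\le G(r)+r^2G''(r)$ for all $r>0$; and the doubling condition: for some constant $D$, $F(r+s)\le D(1+F(r)+F(s))$ and $G(r+s)\le D(1+G(r)+G(s))$ for all $r,s>0$. (Coupling) $h\in C^\infty(\mathbb{R}_{>0}^2)\cap C^1(\mathbb{R}_{\ge0}^2)$ with $h=\partial_uh=\partial_vh\equiv0$ on $\partial\mathbb{R}_{\ge0}^2$; there is $\varepsilon^*>0$ such that $(u,v)\mapsto F(u)+G(v)+2\varepsilon^*h(u,v)$ is convex and $2\varepsilon^*|h(u,v)|\le F(u)+G(v)$ for all $u,v>0$. Energy: $\mathbf{E}_\varepsilon(u,v)=\int_{\mathbb{R}^d}\big[F(u)+G(v)+u\Phi+v\Psi+\varepsilon h(u,v)\big]\,\mathrm{d}x$. Define $\theta_u,\theta_v:\mathbb{R}_{\ge0}^2\to\mathbb{R}$ by $\theta_u(\rho,\eta)=\partial_uh\big((F')^{-1}(\rho),(G')^{-1}(\eta)\big)$ and $\theta_v(\rho,\eta)=\partial_vh\big((F')^{-1}(\rho),(G')^{-1}(\eta)\big)$. The triple $(F,G,h)$ is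 called $k$-degenerate if $\theta_u,\theta_v\in C^k(\mathbb{R}_{\ge0}^2)$ and all their partial derivatives of order at most $k$ vanish on $\partial\mathbb{R}_{\ge0}^2$. *)

theory Defs
  imports "HOL-Analysis.Analysis"
begin

section \<open>Partial derivatives and the classes C^k\<close>

text \<open>
  \<open>has_partials k S f D\<close>: the function \<open>f\<close> is of class C^k on \<open>S\<close>, and \<open>D bs\<close> is its iterated
  partial derivative in the coordinate directions listed in \<open>bs\<close> (head outermost).
  For open \<open>S\<close> this is the usual notion. For a general set it is that of class C^k
  up to the boundary: the partial derivatives exist in the interior and extend continuously to \<open>S\<close>,
  and the values of \<open>D bs\<close> at boundary points are those of the extension. If \<open>S\<close> is contained in the
  closure of its interior, then the values \<open>D bs x\<close> with \<open>length bs \<le> k\<close> and \<open>x \<in> S\<close> are unique.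
\<close>

definition has_partials ::
  "nat \<Rightarrow> 'a::euclidean_space set \<Rightarrow> ('a \<Rightarrow> real) \<Rightarrow> ('a list \<Rightarrow> 'a \<Rightarrow> real) \<Rightarrow> bool" where
  "has_partials k S f D \<longleftrightarrow>
     (\<forall>x\<in>S. D [] x = f x) \<and>
     (\<forall>bs. set bs \<subseteq> Basis \<and> length bs \<le> k \<longrightarrow> continuous_on S (D bs)) \<and>
     (\<forall>bs. \<forall>b\<in>Basis. set bs \<subseteq> Basis \<and> length bs < k \<longrightarrow>
        (\<forall>x\<in>interior S. ((\<lambda>t. D bs (x + t *\<^sub>R b)) has_real_derivative D (b # bs) x) (at 0)))"

definition Ck_on :: "nat \<Rightarrow> 'a::euclidean_space set \<Rightarrow> ('a \<Rightarrow> real) \<Rightarrow> bool" where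
  "Ck_on k S f \<longleftrightarrow> (\<exists>D. has_partials k S f D)"

definition smooth_on :: "'a::euclidean_space set \<Rightarrow> ('a \<Rightarrow> real) \<Rightarrow> bool" where
  "smooth_on S f \<longleftrightarrow> (\<forall>k. Ck_on k S f)"

definition Ck_vanishing_on_frontier :: "nat \<Rightarrow> 'a::euclidean_space set \<Rightarrow> ('a \<Rightarrow> real) \<Rightarrow> bool" where
  "Ck_vanishing_on_frontier k S f \<longleftrightarrow>
     (\<exists>D. has_partials k S f D \<and>
        (\<forall>bs. set bs \<subseteq> Basis \<and> length bs \<le> k \<longrightarrow> (\<forall>x\<in>frontier S. D bs x = 0)))"

definition Ck_bounded_on :: "nat \<Rightarrow> 'a::euclidean_space set \<Rightarrow> ('a \<Rightarrow> real) \<Rightarrow> real \<Rightarrow> bool" where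
  "Ck_bounded_on k S f C \<longleftrightarrow>
     (\<exists>D. has_partials k S f D \<and>
        (\<forall>bs. set bs \<subseteq> Basis \<and> length bs \<le> k \<longrightarrow> (\<forall>x\<in>S. \<bar>D bs x\<bar> \<le> C)))"

definition partial :: "'n::finite \<Rightarrow> (real^'n \<Rightarrow> real) \<Rightarrow> real^'n \<Rightarrow> real" where
  "partial i f x = deriv (\<lambda>t. f (x + t *\<^sub>R axis i 1)) 0"

definition hessian :: "(real^'n \<Rightarrow> real) \<Rightarrow> real^'n \<Rightarrow> real^'n^'n" where
  "hessian f x = (\<chi> i j. partial i (partial j f) x)"

text \<open>The Loewner order; the order that the library puts on matrices is the componentwise one.\<close>

definition loewner_le :: "real^'n^'n \<Rightarrow> real^'n^'n \<Rightarrow> bool" where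
  "loewner_le A B \<longleftrightarrow> (\<forall>\<xi>. \<xi> \<bullet> (A *v \<xi>) \<le> \<xi> \<bullet> (B *v \<xi>))"

section \<open>Potentials, nonlinearities and coupling\<close>

definition potential :: "real \<Rightarrow> real \<Rightarrow> (real^'n \<Rightarrow> real) \<Rightarrow> bool" where
  "potential \<Lambda> M \<Phi> \<longleftrightarrow>
     smooth_on UNIV \<Phi> \<and>
     (\<forall>x. loewner_le (mat \<Lambda>) (hessian \<Phi> x) \<and> loewner_le (hessian \<Phi> x) (mat M)) \<and>
     (\<exists>x0. \<Phi> x0 = 0 \<and> (\<forall>x. \<Phi> x0 \<le> \<Phi> x))"

text \<open>
  The derivative of a function on \<open>{0..}\<close>; one-sided at 0, equal to \<open>deriv\<close> at positive points
  of differentiability.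
\<close>

definition deriv_nn :: "(real \<Rightarrow> real) \<Rightarrow> real \<Rightarrow> real" where
  "deriv_nn f x = vector_derivative f (at x within {0..})"

definition nonlinearity :: "(real \<Rightarrow> real) \<Rightarrow> bool" where
  "nonlinearity F \<longleftrightarrow>
     smooth_on {0<..} F \<and> Ck_on 1 {0..} F \<and>
     (\<forall>r>0. deriv (deriv F) r > 0) \<and>
     Liminf at_top (\<lambda>r. ereal (deriv (deriv F) r)) > 0 \<and>
     F 0 = 0 \<and> deriv_nn F 0 = 0 \<and>
     (\<exists>m\<ge>2. \<exists>a>0. ((\<lambda>r. r powr (-(m - 2)) * deriv (deriv F) r) \<longlongrightarrow> a) (at_right 0)) \<and>
     (\<forall>r>0. r * deriv F r \<le> F r + r\<^sup>2 * deriv (deriv F) r) \<and>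
     (\<exists>D. \<forall>r>0. \<forall>s>0. F (r + s) \<le> D * (1 + F r + F s))"

abbreviation quadrant :: "(real \<times> real) set" where
  "quadrant \<equiv> {0..} \<times> {0..}"

abbreviation open_quadrant :: "(real \<times> real) set" where
  "open_quadrant \<equiv> {0<..} \<times> {0<..}"

text \<open>The partial derivatives on the closed quadrant, one-sided at its boundary.\<close>

definition partial_u :: "(real \<times> real \<Rightarrow> real) \<Rightarrow> real \<times> real \<Rightarrow> real" where
  "partial_u h = (\<lambda>(u, v). deriv_nn (\<lambda>s. h (s, v)) u)"

definition partial_v :: "(real \<times> real \<Rightarrow> real) \<Rightarrow> real \<times> real \<Rightarrow> real" where
  "partial_v h = (\<lambda>(u, v). deriv_nn (\<lambda>s. h (u, s)) v)"

definition coupling ::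
  "(real \<Rightarrow> real) \<Rightarrow> (real \<Rightarrow> real) \<Rightarrow> (real \<times> real \<Rightarrow> real) \<Rightarrow> real \<Rightarrow> bool" where
  "coupling F G h \<epsilon>s \<longleftrightarrow>
     smooth_on open_quadrant h \<and> Ck_on 1 quadrant h \<and>
     (\<forall>p\<in>frontier quadrant. h p = 0 \<and> partial_u h p = 0 \<and> partial_v h p = 0) \<and>
     \<epsilon>s > 0 \<and>
     convex_on open_quadrant (\<lambda>(u, v). F u + G v + 2 * \<epsilon>s * h (u, v)) \<and>
     (\<forall>u>0. \<forall>v>0. 2 * \<epsilon>s * \<bar>h (u, v)\<bar> \<le> F u + G v)"

text \<open>\<open>deriv_nn F\<close> maps \<open>{0..}\<close> bijectively onto \<open>{0..}\<close> for every \<open>nonlinearity F\<close>.\<close>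

definition theta_u ::
  "(real \<Rightarrow> real) \<Rightarrow> (real \<Rightarrow> real) \<Rightarrow> (real \<times> real \<Rightarrow> real) \<Rightarrow> real \<times> real \<Rightarrow> real" where
  "theta_u F G h = (\<lambda>(\<rho>, \<eta>).
     partial_u h (the_inv_into {0..} (deriv_nn F) \<rho>, the_inv_into {0..} (deriv_nn G) \<eta>))"

definition theta_v ::
  "(real \<Rightarrow> real) \<Rightarrow> (real \<Rightarrow> real) \<Rightarrow> (real \<times> real \<Rightarrow> real) \<Rightarrow> real \<times> real \<Rightarrow> real" where
  "theta_v F G h = (\<lambda>(\<rho>, \<eta>).
     partial_v h (the_inv_into {0..} (deriv_nn F) \<rho>, the_inv_into {0..} (deriv_nn G) \<eta>))"

definition degenerate ::
  "nat \<Rightarrow> (real \<Rightarrow> real) \<Rightarrow> (real \<Rightarrow> real) \<Rightarrow> (real \<times> real \<Rightarrow> real) \<Rightarrow> bool" where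
  "degenerate k F G h \<longleftrightarrow>
     Ck_vanishing_on_frontier k quadrant (theta_u F G h) \<and>
     Ck_vanishing_on_frontier k quadrant (theta_v F G h)"

section \<open>Densities, energy and minimizers\<close>

definition P2r :: "(real^'n \<Rightarrow> real) set" where
  "P2r = {u. u \<in> borel_measurable lborel \<and> (\<forall>x. 0 \<le> u x) \<and>
             has_bochner_integral lborel u 1 \<and> integrable lborel (\<lambda>x. (norm x)\<^sup>2 * u x)}"

text \<open>
  The energy takes values in \<open>[0, \<infinity>]\<close>. The truncation of negative values by \<open>ennreal\<close> has no effect:
  the integrand is nonnegative for nonnegative \<open>u\<close>, \<open>v\<close> and \<open>0 \<le> \<epsilon> \<le> \<epsilon>s\<close>, by the bound on \<open>h\<close>
  in \<open>coupling\<close> and since \<open>F\<close>, \<open>G\<close>, \<open>\<Phi>\<close>, \<open>\<Psi>\<close> are nonnegative.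
\<close>

definition energy ::
  "(real \<Rightarrow> real) \<Rightarrow> (real \<Rightarrow> real) \<Rightarrow> (real^'n \<Rightarrow> real) \<Rightarrow> (real^'n \<Rightarrow> real) \<Rightarrow>
   (real \<times> real \<Rightarrow> real) \<Rightarrow> real \<Rightarrow> (real^'n \<Rightarrow> real) \<Rightarrow> (real^'n \<Rightarrow> real) \<Rightarrow> ennreal" where
  "energy F G \<Phi> \<Psi> h \<epsilon> u v =
     (\<integral>\<^sup>+ x. ennreal (F (u x) + G (v x) + u x * \<Phi> x + v x * \<Psi> x + \<epsilon> * h (u x, v x)) \<partial>lborel)"

definition is_minimizer ::
  "((real^'n \<Rightarrow> real) \<Rightarrow> (real^'n \<Rightarrow> real) \<Rightarrow> ennreal) \<Rightarrow>
   (real^'n \<Rightarrow> real) \<Rightarrow> (real^'n \<Rightarrow> real) \<Rightarrow> bool" where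
  "is_minimizer E u v \<longleftrightarrow>
     u \<in> P2r \<and> v \<in> P2r \<and> (\<forall>u'\<in>P2r. \<forall>v'\<in>P2r. E u v \<le> E u' v')"

text \<open>
  Densities are only determined up to null sets, so their support is the complement of
  the largest open set on which they vanish almost everywhere.
\<close>

definition ess_support :: "(real^'n \<Rightarrow> real) \<Rightarrow> (real^'n) set" where
  "ess_support u =
     {x. \<forall>U. open U \<and> x \<in> U \<longrightarrow> \<not> (AE y in lborel. y \<in> U \<longrightarrow> u y = 0)}"

text \<open>
  The restriction to \<open>S\<close> of a function determined up to null sets is bounded in C^k by \<open>C\<close>
  if it has a representative that is.
\<close>

definition AE_Ck_bounded_on :: "nat \<Rightarrow> (real^'n) set \<Rightarrow> (real^'n \<Rightarrow> real) \<Rightarrow> real \<Rightarrow> bool" where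
  "AE_Ck_bounded_on k S f C \<longleftrightarrow>
     (\<exists>g. (AE x in lborel. x \<in> S \<longrightarrow> g x = f x) \<and> Ck_bounded_on k S g C)"

end

theory Submission
  imports Defs
begin

text \<open>
  The minimizer is obtained by duality. For multipliers \<open>C = (C\<^sub>u, C\<^sub>v)\<close> let \<open>(u, v)(x)\<close> minimize
  the strictly convex integrand \<open>F u + G v + \<epsilon> h(u, v) - (C\<^sub>u - \<Phi> x) u - (C\<^sub>v - \<Psi> x) v\<close> over the
  quadrant. If both functions of \<open>x\<close> have mass 1, integrating this pointwise minimality shows that
  they minimize the energy, and that every other minimizer agrees with them almost everywhere. Such
  multipliers are the maximum points of a concave function on the plane, which is coercive uniformly
  in \<open>\<epsilon>\<close>, so they lie in a fixed compact set.

  Since \<open>h\<close> vanishes to first order on the boundary, \<open>u x > 0\<close> if and only if \<open>\<Phi> x < C\<^sub>u\<close>,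
  which gives the supports. On the supports \<open>(F' u, G' v)\<close> is the image of \<open>(C\<^sub>u - \<Phi>, C\<^sub>v - \<Psi>)\<close>
  under the inverse of \<open>id + \<epsilon> (\<theta>\<^sub>u, \<theta>\<^sub>v)\<close>. By the convexity of \<open>F + G + 2 \<epsilon>s h\<close> the Jacobian of
  this map is at least 1/4, and differentiating the identity repeatedly bounds all derivatives.
\<close>

section \<open>Derivatives from partial derivatives\<close>

text \<open>The factor 2 in the convexity assumption makes the estimates uniform. With
  \<open>\<sigma> = \<epsilon> / (2 * \<epsilon>s)\<close> the integrand is a mixture of the
  uncoupled one, of weight \<open>1 - \<sigma> \<ge> 1/2\<close>, and a convex one. The first part
  supplies strictness, and the Jacobian bound 1/4 is the square of its least weight.

  Duality replaces compactness in a space of densities by a maximum over a ball in the plane, and it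
  comes with a pointwise formula from which supports and regularity can be read off.

  The obstacle to regularity is that the free boundary of one density may run through the support of
  the other, where C^k bounds are claimed, and different equations hold on its two sides. Degeneracy
  unites them into one equation, because \<open>\<theta>\<^sub>u\<close> and
  \<open>\<theta>\<^sub>v\<close> extended by zero remain of class C^k. The unknowns are
  \<open>F' u\<close> and \<open>G' v\<close> rather than the densities, because F'' and G'' may
  degenerate at 0, so that \<open>u\<close> and \<open>v\<close> need not be smooth at the edge of
  their supports.\<close>

lemma real_mvt_open_derivative:
  fixes f g :: "real \<Rightarrow> real"
  assumes "a \<noteq> b" and cont: "continuous_on (closed_segment a b) f"
    and deriv: "\<And>t. t \<in> open_segment a b \<Longrightarrow> (f has_real_derivative g t) (at t)"
  obtains \<xi> where "\<xi> \<in> open_segment a b" "f b - f a = (b - a) * g \<xi>"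
proof -
  have less: "\<exists>\<xi>\<in>{c<..<d}. f d - f c = (d - c) * g \<xi>"
    if "c < d" "continuous_on {c..d} f"
      "\<And>t. t \<in> {c<..<d} \<Longrightarrow> (f has_real_derivative g t) (at t)" for c d
    by (rule mvt[OF that(1,2), of "\<lambda>t y. y * g t"])
       (use that(3) in \<open>auto simp: has_field_derivative_def mult_commute_abs\<close>)
  show thesis
  proof (cases "a < b")
    case True
    then show thesis
      using less[of a b] assms that by (auto simp: closed_segment_eq_real_ivl open_segment_eq_real_ivl)
  next
    case False
    then have "\<exists>\<xi>\<in>{b<..<a}. f a - f b = (a - b) * g \<xi>"
      using less[of b a] assms by (auto simp: closed_segment_eq_real_ivl open_segment_eq_real_ivl)
    then show thesis
      using False \<open>a \<noteq> b\<close> that by (force simp: open_segment_eq_real_ivl algebra_simps)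
  qed
qed

text \<open>By the mean value theorem each difference quotient at \<open>a\<close> is a value of
  \<open>g\<close> at a nearby point. This turns a continuous extension of derivatives, which is all
  that \<open>has_partials\<close> asserts at a boundary, into one-sided derivatives. It also glues
  the zero extension across the axes later on.\<close>

lemma has_real_derivative_limit:
  fixes f g :: "real \<Rightarrow> real"
  assumes "convex T" "a \<in> T" "continuous_on T f" "continuous (at a within T) g"
    and deriv: "\<And>t. t \<in> T - {a} \<Longrightarrow> (f has_real_derivative g t) (at t)"
  shows "(f has_real_derivative g a) (at a within T)"
  unfolding has_field_derivative_iff tendsto_iff eventually_at
proof (intro allI impI)
  fix e :: real assume "e > 0"
  then obtain d where d: "d > 0" "\<And>t. t \<in> T \<Longrightarrow> dist t a < d \<Longrightarrow> dist (g t) (g a) < e"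
    using assms(4) unfolding continuous_within_eps_delta by blast
  have "dist ((f y - f a) / (y - a)) (g a) < e" if y: "y \<in> T" "y \<noteq> a" "dist y a < d" for y
  proof -
    have seg: "closed_segment a y \<subseteq> T"
      using assms(1,2) y(1) by (rule closed_segment_subset[rotated 2])
    have op: "t \<in> T - {a}" "dist t a < d" if "t \<in> open_segment a y" for t
      using that seg y by (auto simp: open_segment_def dist_real_def closed_segment_eq_real_ivl split: if_splits)
    obtain \<xi> where \<xi>: "\<xi> \<in> open_segment a y" "f y - f a = (y - a) * g \<xi>"
      using real_mvt_open_derivative[of a y f g] y(2) continuous_on_subset[OF assms(3) seg] deriv op(1)
      by metis
    have "(f y - f a) / (y - a) = g \<xi>"
      using \<xi>(2) y(2) by simp
    then show ?thesis
      using d(2)[of \<xi>] op[OF \<xi>(1)] by auto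
  qed
  then show "\<exists>d>0. \<forall>y\<in>T. y \<noteq> a \<and> dist y a < d \<longrightarrow> dist ((f y - f a) / (y - a)) (g a) < e"
    using d(1) by blast
qed

lemma has_real_derivative_line:
  fixes f :: "'a::real_normed_vector \<Rightarrow> real"
  assumes "((\<lambda>t. f ((x + s *\<^sub>R b) + t *\<^sub>R b)) has_real_derivative d) (at 0)"
  shows "((\<lambda>t. f (x + t *\<^sub>R b)) has_real_derivative d) (at s)"
proof -
  have "((\<lambda>t. f (x + (s + t) *\<^sub>R b)) has_real_derivative d) (at 0)"
    using assms by (simp add: algebra_simps)
  then show ?thesis
    using DERIV_shift[of "\<lambda>t. f (x + t *\<^sub>R b)" d 0 s] by (simp add: add.commute)
qed

text \<open>A cube instead of a ball: exchanging coordinates between two of its points does not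
  leave it.\<close>

definition box_nbhd :: "'a::euclidean_space \<Rightarrow> real \<Rightarrow> 'a set" where
  "box_nbhd x d = {y. \<forall>c\<in>Basis. \<bar>(y - x) \<bullet> c\<bar> < d}"

text \<open>The coordinates of \<open>y\<close> are exchanged for those of \<open>z\<close> one at a
  time, each at the cost of one mean value step, so the error is measured in the l1 norm. The set
  \<open>B\<close> collects the directions still to be exchanged.\<close>

lemma box_nbhd_increment:
  fixes f :: "'a::euclidean_space \<Rightarrow> real"
  assumes "finite B" "B \<subseteq> Basis"
    and deriv: "\<And>y b. y \<in> box_nbhd x d \<Longrightarrow> b \<in> B \<Longrightarrow>
      ((\<lambda>t. f (y + t *\<^sub>R b)) has_real_derivative g b y) (at 0)"
    and close: "\<And>y b. y \<in> box_nbhd x d \<Longrightarrow> b \<in> B \<Longrightarrow> \<bar>g b y - g b x\<bar> \<le> e"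
    and "y \<in> box_nbhd x d" "z \<in> box_nbhd x d"
    and "\<And>c. c \<in> Basis - B \<Longrightarrow> (y - z) \<bullet> c = 0"
  shows "\<bar>f y - f z - (\<Sum>b\<in>B. ((y - z) \<bullet> b) * g b x)\<bar> \<le> e * (\<Sum>b\<in>B. \<bar>(y - z) \<bullet> b\<bar>)"
  using assms
proof (induction B arbitrary: y rule: finite_induct)
  case empty
  then have "y = z"
    by (metis Diff_empty euclidean_eqI right_minus_eq inner_diff_left)
  then show ?case by simp
next
  case (insert b B)
  define \<tau> where "\<tau> = (y - z) \<bullet> b"
  \<comment> \<open>\<open>y\<close> with its coordinate \<open>b\<close> replaced by that of
    \<open>z\<close>.\<close>
  define y' where "y' = y - \<tau> *\<^sub>R b"
  have b: "b \<in> Basis" using insert.prems(1) by simp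
  have y'b: "(y' - w) \<bullet> c = (if c = b then (z - w) \<bullet> b else (y - w) \<bullet> c)" if "c \<in> Basis" for c w
    using that b by (auto simp: y'_def \<tau>_def inner_diff_left inner_Basis)
  have y'_box: "y' \<in> box_nbhd x d"
    using insert.prems(4,5) b unfolding box_nbhd_def by (auto simp: y'b)
  have seg_box: "y' + t *\<^sub>R b \<in> box_nbhd x d" if "t \<in> closed_segment 0 \<tau>" for t
    unfolding box_nbhd_def
  proof (safe)
    fix c :: 'a assume c: "c \<in> Basis"
    show "\<bar>(y' + t *\<^sub>R b - x) \<bullet> c\<bar> < d"
    proof (cases "c = b")
      case True
      have "(y' + t *\<^sub>R b - x) \<bullet> c = (z - x) \<bullet> b + t"
        using y'b[OF c, of x] True b by (simp add: inner_diff_left inner_add_left algebra_simps)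
      moreover have "\<bar>(z - x) \<bullet> b\<bar> < d" "\<bar>(y - x) \<bullet> b\<bar> < d"
        using insert.prems(4,5) b by (auto simp: box_nbhd_def)
      moreover have "(y - x) \<bullet> b = (z - x) \<bullet> b + \<tau>"
        by (simp add: \<tau>_def inner_diff_left)
      ultimately show ?thesis
        using that by (auto simp: closed_segment_eq_real_ivl split: if_splits)
    next
      case False
      then have "(y' + t *\<^sub>R b - x) \<bullet> c = (y - x) \<bullet> c"
        using y'b[OF c, of x] c b by (simp add: inner_diff_left inner_add_left inner_Basis algebra_simps)
      then show ?thesis
        using insert.prems(4) c by (auto simp: box_nbhd_def)
    qed
  qed
  have IH: "\<bar>f y' - f z - (\<Sum>c\<in>B. ((y' - z) \<bullet> c) * g c x)\<bar> \<le> e * (\<Sum>c\<in>B. \<bar>(y' - z) \<bullet> c\<bar>)"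
  proof (rule insert.IH)
    show "(y' - z) \<bullet> c = 0" if "c \<in> Basis - B" for c
      using that insert.prems(6)[of c] by (auto simp: y'b)
  qed (use insert.prems y'_box in auto)
  have step: "\<bar>f y - f y' - \<tau> * g b x\<bar> \<le> e * \<bar>\<tau>\<bar>"
  proof (cases "\<tau> = 0")
    case True
    then show ?thesis by (simp add: y'_def)
  next
    case False
    have der: "((\<lambda>t. f (y' + t *\<^sub>R b)) has_real_derivative g b (y' + t *\<^sub>R b)) (at t)"
      if "t \<in> closed_segment 0 \<tau>" for t
      by (rule has_real_derivative_line, rule insert.prems(2)[OF seg_box[OF that]]) simp
    obtain \<xi> where \<xi>: "\<xi> \<in> open_segment 0 \<tau>"
        "f (y' + \<tau> *\<^sub>R b) - f (y' + 0 *\<^sub>R b) = (\<tau> - 0) * g b (y' + \<xi> *\<^sub>R b)"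
    proof (rule real_mvt_open_derivative[of 0 \<tau> "\<lambda>t. f (y' + t *\<^sub>R b)" "\<lambda>t. g b (y' + t *\<^sub>R b)"])
      show "continuous_on (closed_segment 0 \<tau>) (\<lambda>t. f (y' + t *\<^sub>R b))"
        by (rule DERIV_continuous_on[OF has_field_derivative_at_within]) (rule der)
    qed (use False der in \<open>auto simp: open_segment_def\<close>)
    have "f y - f y' - \<tau> * g b x = \<tau> * (g b (y' + \<xi> *\<^sub>R b) - g b x)"
      using \<xi>(2) by (simp add: y'_def algebra_simps)
    moreover have "\<bar>g b (y' + \<xi> *\<^sub>R b) - g b x\<bar> \<le> e"
      using \<xi>(1) by (intro insert.prems(3) seg_box) (auto simp: open_segment_def)
    ultimately show ?thesis
      by (simp add: abs_mult mult.commute[of e] mult_left_mono)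
  qed
  have eqs: "(y' - z) \<bullet> c = (y - z) \<bullet> c" if "c \<in> B" for c
    using that insert.hyps insert.prems(1) by (auto simp: y'b)
  have "f y - f z - (\<Sum>c\<in>insert b B. ((y - z) \<bullet> c) * g c x) =
      (f y - f y' - \<tau> * g b x) + (f y' - f z - (\<Sum>c\<in>B. ((y' - z) \<bullet> c) * g c x))"
    using insert.hyps by (simp add: eqs \<tau>_def)
  also have "\<bar>\<dots>\<bar> \<le> e * \<bar>\<tau>\<bar> + e * (\<Sum>c\<in>B. \<bar>(y' - z) \<bullet> c\<bar>)"
    using step IH by linarith
  also have "\<dots> = e * (\<Sum>c\<in>insert b B. \<bar>(y - z) \<bullet> c\<bar>)"
    using insert.hyps by (simp add: eqs \<tau>_def distrib_left)
  finally show ?case .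
qed

lemma has_derivative_continuous_partials:
  fixes f :: "'a::euclidean_space \<Rightarrow> real"
  assumes "open S" "x \<in> S"
    and deriv: "\<And>y b. y \<in> S \<Longrightarrow> b \<in> Basis \<Longrightarrow>
      ((\<lambda>t. f (y + t *\<^sub>R b)) has_real_derivative g b y) (at 0)"
    and cont: "\<And>b. b \<in> Basis \<Longrightarrow> continuous_on S (g b)"
  shows "(f has_derivative (\<lambda>\<xi>. \<Sum>b\<in>Basis. (\<xi> \<bullet> b) * g b x)) (at x)"
  unfolding has_derivative_at_alt
proof (intro conjI allI impI)
  show "bounded_linear (\<lambda>\<xi>. \<Sum>b\<in>Basis. (\<xi> \<bullet> b) * g b x)"
    by (intro bounded_linear_sum bounded_linear_compose[OF bounded_linear_mult_left bounded_linear_inner_left])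
next
  fix e :: real assume "0 < e"
  \<comment> \<open>The increment lemma yields an l1 norm, which is at most \<open>DIM('a)\<close>
    times the Euclidean one.\<close>
  define e' where "e' = e / DIM('a)"
  have e': "e' > 0" using \<open>0 < e\<close> by (simp add: e'_def)
  have "\<exists>d>0. \<forall>y. dist y x < d \<longrightarrow> \<bar>g b y - g b x\<bar> \<le> e'" if "b \<in> Basis" for b
  proof -
    have "continuous (at x) (g b)"
      using cont[OF that] assms(1,2) continuous_on_eq_continuous_at by blast
    then show ?thesis
      using e' unfolding continuous_at_eps_delta dist_real_def by (meson less_imp_le)
  qed
  then obtain \<delta> where \<delta>: "\<And>b. b \<in> Basis \<Longrightarrow> \<delta> b > 0"
      "\<And>b y. b \<in> Basis \<Longrightarrow> dist y x < \<delta> b \<Longrightarrow> \<bar>g b y - g b x\<bar> \<le> e'"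
    by metis
  obtain r where r: "r > 0" "ball x r \<subseteq> S"
    using assms(1,2) openE by blast
  define d0 where "d0 = Min (insert r (\<delta> ` Basis))"
  have d0: "d0 > 0" "d0 \<le> r" "\<And>b. b \<in> Basis \<Longrightarrow> d0 \<le> \<delta> b"
    unfolding d0_def using \<delta>(1) r(1) by (auto simp del: Min_insert intro!: Min_le simp: Min_gr_iff)
  \<comment> \<open>The same comparison of norms puts the cube of half-width \<open>d\<close> inside
    the ball of radius \<open>d0\<close>.\<close>
  define d where "d = d0 / DIM('a)"
  have "d > 0" using d0 by (simp add: d_def)
  have box: "dist y x < d0" if "y \<in> box_nbhd x d" for y
  proof -
    have "norm (y - x) \<le> (\<Sum>c\<in>Basis. \<bar>(y - x) \<bullet> c\<bar>)" by (rule norm_le_l1)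
    also have "\<dots> < (\<Sum>c\<in>(Basis::'a set). d)"
      using that by (intro sum_strict_mono) (auto simp: box_nbhd_def)
    also have "\<dots> = d0" by (simp add: d_def)
    finally show ?thesis by (simp add: dist_norm)
  qed
  have "norm (f y - f x - (\<Sum>b\<in>Basis. ((y - x) \<bullet> b) * g b x)) \<le> e * norm (y - x)"
    if y: "norm (y - x) < d" for y
  proof -
    have yb: "y \<in> box_nbhd x d" and xb: "x \<in> box_nbhd x d"
      using y \<open>d > 0\<close> by (auto simp: box_nbhd_def intro: order.strict_trans1[OF Basis_le_norm])
    have inS: "z \<in> S" if "z \<in> box_nbhd x d" for z
      using box[OF that] d0(2) r(2) by (auto simp: dist_commute subset_iff)
    have "\<bar>f y - f x - (\<Sum>b\<in>Basis. ((y - x) \<bullet> b) * g b x)\<bar> \<le> e' * (\<Sum>b\<in>Basis. \<bar>(y - x) \<bullet> b\<bar>)"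
      using yb xb
      by (intro box_nbhd_increment[of Basis x d f g]) (use deriv inS \<delta>(2) box d0(3) in \<open>force intro: less_le_trans\<close>)+
    also have "\<dots> \<le> e' * (\<Sum>b\<in>(Basis::'a set). norm (y - x))"
      using e' by (intro mult_left_mono sum_mono Basis_le_norm) auto
    also have "\<dots> = e * norm (y - x)" by (simp add: e'_def)
    finally show ?thesis by simp
  qed
  then show "\<exists>d>0. \<forall>y. norm (y - x) < d \<longrightarrow>
      norm (f y - f x - (\<Sum>b\<in>Basis. (y - x) \<bullet> b * g b x)) \<le> e * norm (y - x)"
    using \<open>d > 0\<close> by blast
qed

section \<open>Uniformly bounded families of class C^k\<close>

text \<open>Smoothness is required on the whole space, the bound only on \<open>K\<close> but uniformly in the
  index. Only first derivatives appear in the recursion, so that closure under products,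
  compositions and inverses follows by induction from the first-order rules.\<close>

primrec Ck_family :: "nat \<Rightarrow> 'a::euclidean_space set \<Rightarrow> 'i set \<Rightarrow> ('i \<Rightarrow> 'a \<Rightarrow> real) \<Rightarrow> bool" where
  "Ck_family 0 K I f \<longleftrightarrow>
     (\<forall>i\<in>I. continuous_on UNIV (f i)) \<and> (\<exists>C. \<forall>i\<in>I. \<forall>x\<in>K. \<bar>f i x\<bar> \<le> C)"
| "Ck_family (Suc k) K I f \<longleftrightarrow>
     ((\<forall>i\<in>I. continuous_on UNIV (f i)) \<and> (\<exists>C. \<forall>i\<in>I. \<forall>x\<in>K. \<bar>f i x\<bar> \<le> C)) \<and>
     (\<exists>g. \<forall>b\<in>Basis. Ck_family k K I (g b) \<and>
        (\<forall>i\<in>I. \<forall>x. ((\<lambda>t. f i (x + t *\<^sub>R b)) has_real_derivative g b i x) (at 0)))"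

lemma Ck_family_0: "Ck_family k K I f \<Longrightarrow> Ck_family 0 K I f"
  by (cases k) auto

lemma Ck_family_SucD: "Ck_family (Suc k) K I f \<Longrightarrow> Ck_family k K I f"
proof (induction k arbitrary: f)
  case 0
  then show ?case by simp
next
  case (Suc k)
  obtain g where "\<forall>b\<in>Basis. Ck_family (Suc k) K I (g b) \<and>
      (\<forall>i\<in>I. \<forall>x. ((\<lambda>t. f i (x + t *\<^sub>R b)) has_real_derivative g b i x) (at 0))"
    using Suc.prems by (subst (asm) Ck_family.simps(2)) blast
  then have "\<forall>b\<in>Basis. Ck_family k K I (g b) \<and>
      (\<forall>i\<in>I. \<forall>x. ((\<lambda>t. f i (x + t *\<^sub>R b)) has_real_derivative g b i x) (at 0))"
    using Suc.IH by blast
  then show ?case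
    using Ck_family_0[OF Suc.prems] by auto
qed

lemma Ck_family_SucI:
  assumes "Ck_family 0 K I f" "\<And>b. b \<in> Basis \<Longrightarrow> Ck_family k K I (g b)"
    and "\<And>b i x. b \<in> Basis \<Longrightarrow> i \<in> I \<Longrightarrow>
      ((\<lambda>t. f i (x + t *\<^sub>R b)) has_real_derivative g b i x) (at 0)"
  shows "Ck_family (Suc k) K I f"
  using assms unfolding Ck_family.simps by blast

lemma Ck_family_SucE:
  assumes "Ck_family (Suc k) K I f"
  obtains g where "Ck_family 0 K I f" "\<And>b. b \<in> Basis \<Longrightarrow> Ck_family k K I (g b)"
    "\<And>b i x. b \<in> Basis \<Longrightarrow> i \<in> I \<Longrightarrow>
      ((\<lambda>t. f i (x + t *\<^sub>R b)) has_real_derivative g b i x) (at 0)"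
  using assms unfolding Ck_family.simps by blast

lemma Ck_family_const:
  assumes "\<And>i. i \<in> I \<Longrightarrow> \<bar>c i\<bar> \<le> C"
  shows "Ck_family k K I (\<lambda>i x. c i)"
  using assms
proof (induction k arbitrary: c C)
  case (Suc k)
  show ?case
    by (rule Ck_family_SucI[where g="\<lambda>_ _ _. 0"])
       (use Suc.prems Suc.IH[of "\<lambda>_. 0" 0] in auto)
qed auto

lemma Ck_family_0_add:
  assumes "Ck_family 0 K I f" "Ck_family 0 K I g"
  shows "Ck_family 0 K I (\<lambda>i x. f i x + g i x)"
proof -
  obtain C D where "\<forall>i\<in>I. \<forall>x\<in>K. \<bar>f i x\<bar> \<le> C" "\<forall>i\<in>I. \<forall>x\<in>K. \<bar>g i x\<bar> \<le> D"
    using assms by auto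
  then have "\<forall>i\<in>I. \<forall>x\<in>K. \<bar>f i x + g i x\<bar> \<le> C + D"
    by (meson abs_triangle_ineq add_mono order_trans)
  then show ?thesis
    using assms by (auto intro!: continuous_intros)
qed

lemma Ck_family_0_mult:
  assumes "Ck_family 0 K I f" "Ck_family 0 K I g"
  shows "Ck_family 0 K I (\<lambda>i x. f i x * g i x)"
proof -
  obtain C D where "\<forall>i\<in>I. \<forall>x\<in>K. \<bar>f i x\<bar> \<le> C" "\<forall>i\<in>I. \<forall>x\<in>K. \<bar>g i x\<bar> \<le> D"
    using assms by auto
  then have "\<forall>i\<in>I. \<forall>x\<in>K. \<bar>f i x * g i x\<bar> \<le> C * D"
    by (auto simp: abs_mult intro!: mult_mono intro: order_trans[OF abs_ge_zero])
  then show ?thesis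
    using assms by (auto intro!: continuous_intros)
qed

lemma Ck_family_add:
  "Ck_family k K I f \<Longrightarrow> Ck_family k K I g \<Longrightarrow> Ck_family k K I (\<lambda>i x. f i x + g i x)"
proof (induction k arbitrary: f g)
  case 0
  then show ?case by (rule Ck_family_0_add)
next
  case (Suc k)
  obtain f' where f': "\<And>b. b \<in> Basis \<Longrightarrow> Ck_family k K I (f' b)"
    "\<And>b i x. b \<in> Basis \<Longrightarrow> i \<in> I \<Longrightarrow> ((\<lambda>t. f i (x + t *\<^sub>R b)) has_real_derivative f' b i x) (at 0)"
    using Suc.prems(1) by (rule Ck_family_SucE) blast
  obtain g' where g': "\<And>b. b \<in> Basis \<Longrightarrow> Ck_family k K I (g' b)"
    "\<And>b i x. b \<in> Basis \<Longrightarrow> i \<in> I \<Longrightarrow> ((\<lambda>t. g i (x + t *\<^sub>R b)) has_real_derivative g' b i x) (at 0)"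
    using Suc.prems(2) by (rule Ck_family_SucE) blast
  show ?case
  proof (rule Ck_family_SucI)
    show "Ck_family 0 K I (\<lambda>i x. f i x + g i x)"
      by (intro Ck_family_0_add Ck_family_0[OF Suc.prems(1)] Ck_family_0[OF Suc.prems(2)])
    show "Ck_family k K I (\<lambda>i x. f' b i x + g' b i x)" if "b \<in> Basis" for b
      using that by (intro Suc.IH f'(1) g'(1))
    show "((\<lambda>t. f i (x + t *\<^sub>R b) + g i (x + t *\<^sub>R b)) has_real_derivative f' b i x + g' b i x) (at 0)"
      if "b \<in> Basis" "i \<in> I" for b i x
      by (rule DERIV_add[OF f'(2)[OF that] g'(2)[OF that]])
  qed
qed

lemma Ck_family_mult:
  "Ck_family k K I f \<Longrightarrow> Ck_family k K I g \<Longrightarrow> Ck_family k K I (\<lambda>i x. f i x * g i x)"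
proof (induction k arbitrary: f g)
  case 0
  then show ?case by (rule Ck_family_0_mult)
next
  case (Suc k)
  obtain f' where f': "\<And>b. b \<in> Basis \<Longrightarrow> Ck_family k K I (f' b)"
    "\<And>b i x. b \<in> Basis \<Longrightarrow> i \<in> I \<Longrightarrow> ((\<lambda>t. f i (x + t *\<^sub>R b)) has_real_derivative f' b i x) (at 0)"
    using Suc.prems(1) by (rule Ck_family_SucE) blast
  obtain g' where g': "\<And>b. b \<in> Basis \<Longrightarrow> Ck_family k K I (g' b)"
    "\<And>b i x. b \<in> Basis \<Longrightarrow> i \<in> I \<Longrightarrow> ((\<lambda>t. g i (x + t *\<^sub>R b)) has_real_derivative g' b i x) (at 0)"
    using Suc.prems(2) by (rule Ck_family_SucE) blast
  show ?case
  proof (rule Ck_family_SucI)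
    show "Ck_family 0 K I (\<lambda>i x. f i x * g i x)"
      by (intro Ck_family_0_mult Ck_family_0[OF Suc.prems(1)] Ck_family_0[OF Suc.prems(2)])
    show "Ck_family k K I (\<lambda>i x. f' b i x * g i x + g' b i x * f i x)" if "b \<in> Basis" for b
      using that
      by (intro Suc.IH Ck_family_add f'(1) g'(1) Ck_family_SucD[OF Suc.prems(1)] Ck_family_SucD[OF Suc.prems(2)])
    show "((\<lambda>t. f i (x + t *\<^sub>R b) * g i (x + t *\<^sub>R b)) has_real_derivative
        f' b i x * g i x + g' b i x * f i x) (at 0)" if "b \<in> Basis" "i \<in> I" for b i x
      using DERIV_mult[OF f'(2)[OF that] g'(2)[OF that]] by simp
  qed
qed

lemma Ck_family_minus:
  assumes "Ck_family k K I f"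
  shows "Ck_family k K I (\<lambda>i x. - f i x)"
  using Ck_family_mult[OF Ck_family_const[of I "\<lambda>_. -1" 1] assms] by simp

lemma Ck_family_diff:
  assumes "Ck_family k K I f" "Ck_family k K I g"
  shows "Ck_family k K I (\<lambda>i x. f i x - g i x)"
  using Ck_family_add[OF assms(1) Ck_family_minus[OF assms(2)]] by simp

text \<open>The induction closes because the derivative of an inverse is a polynomial in that
  inverse and the first derivative of \<open>f\<close>. The lower bound is required on the whole
  space, since smoothness is, and with one \<open>\<delta>\<close> for all indices, which bounds all
  inverses by \<open>inverse \<delta>\<close>.\<close>

lemma Ck_family_inverse:
  assumes "\<And>i x. i \<in> I \<Longrightarrow> \<delta> \<le> f i x" "\<delta> > 0" "Ck_family k K I f"
  shows "Ck_family k K I (\<lambda>i x. inverse (f i x))"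
proof -
  have zero: "Ck_family 0 K I (\<lambda>i x. inverse (f i x))"
  proof -
    have "\<bar>inverse (f i x)\<bar> \<le> inverse \<delta>" if "i \<in> I" for i x
      using assms(1)[OF that, of x] assms(2) by (simp add: le_imp_inverse_le)
    moreover have "continuous_on UNIV (\<lambda>x. inverse (f i x))" if "i \<in> I" for i
    proof (rule continuous_on_inverse)
      show "continuous_on UNIV (f i)"
        using Ck_family_0[OF assms(3)] that by simp
      show "\<forall>x\<in>UNIV. f i x \<noteq> 0"
        using assms(1)[OF that] assms(2) by (metis not_le)
    qed
    ultimately show ?thesis by auto
  qed
  show ?thesis
    using assms(3)
  proof (induction k)
    case 0
    then show ?case using zero by simp
  next
    case (Suc k)
    obtain f' where f': "\<And>b. b \<in> Basis \<Longrightarrow> Ck_family k K I (f' b)"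
      "\<And>b i x. b \<in> Basis \<Longrightarrow> i \<in> I \<Longrightarrow> ((\<lambda>t. f i (x + t *\<^sub>R b)) has_real_derivative f' b i x) (at 0)"
      using Suc.prems(1) by (rule Ck_family_SucE) blast
    note inv = Suc.IH[OF Ck_family_SucD[OF Suc.prems]]
    show ?case
    proof (rule Ck_family_SucI)
      show "Ck_family 0 K I (\<lambda>i x. inverse (f i x))" by (rule zero)
      show "Ck_family k K I (\<lambda>i x. - (inverse (f i x) * f' b i x * inverse (f i x)))"
        if "b \<in> Basis" for b
        using that by (intro Ck_family_minus Ck_family_mult inv f'(1))
      show "((\<lambda>t. inverse (f i (x + t *\<^sub>R b))) has_real_derivative
          - (inverse (f i x) * f' b i x * inverse (f i x))) (at 0)" if "b \<in> Basis" "i \<in> I" for b i x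
      proof -
        have "f i (x + 0 *\<^sub>R b) \<noteq> 0"
          using assms(1)[OF that(2), of x] assms(2) by simp
        from DERIV_inverse'[OF f'(2)[OF that] this] show ?thesis by simp
      qed
    qed
  qed
qed

section \<open>Families and iterated partial derivatives\<close>

lemma has_partials_UNIV_deriv:
  assumes "has_partials k UNIV f D" "set bs \<subseteq> Basis" "length bs < k" "b \<in> Basis"
  shows "((\<lambda>t. D bs (x + t *\<^sub>R b)) has_real_derivative D (b # bs) x) (at 0)"
  using assms unfolding has_partials_def by simp

text \<open>A single function is a family independent of its index, and compactness of
  \<open>K\<close> supplies the bound. The form with arbitrary \<open>bs\<close> is what the
  induction on the remaining order \<open>j\<close> requires.\<close>

lemma has_partials_Ck_family:
  assumes "has_partials k UNIV f D" "compact K" "set bs \<subseteq> Basis" "length bs + j \<le> k"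
  shows "Ck_family j K I (\<lambda>_. D bs)"
  using assms(3,4)
proof (induction j arbitrary: bs)
  case 0
  then have cont: "continuous_on UNIV (D bs)"
    using assms(1) unfolding has_partials_def by simp
  then have "bounded (D bs ` K)"
    using assms(2) by (meson compact_continuous_image compact_imp_bounded continuous_on_subset subset_UNIV)
  then show ?case
    using cont by (auto simp: bounded_iff)
next
  case (Suc j)
  show ?case
  proof (rule Ck_family_SucI)
    show "Ck_family 0 K I (\<lambda>_. D bs)"
      using Suc.IH[of bs] Suc.prems Ck_family_0 by force
    show "Ck_family j K I (\<lambda>_. D (b # bs))" if "b \<in> Basis" for b
      using that Suc.prems by (intro Suc.IH) auto
    show "((\<lambda>t. D bs (x + t *\<^sub>R b)) has_real_derivative D (b # bs) x) (at 0)"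
      if "b \<in> Basis" for b x
      using that Suc.prems by (intro has_partials_UNIV_deriv[OF assms(1)]) auto
  qed
qed

lemma has_derivative_partials_prod:
  assumes D: "has_partials k UNIV f D" "set bs \<subseteq> Basis" "length bs < k"
  shows "(D bs has_derivative (\<lambda>(s, t). s * D ((1, 0) # bs) p + t * D ((0, 1) # bs) p))
    (at (p::real \<times> real))"
proof -
  have "(D bs has_derivative (\<lambda>\<xi>. \<Sum>b\<in>Basis. (\<xi> \<bullet> b) * D (b # bs) p)) (at p)"
    by (rule has_derivative_continuous_partials[of UNIV p "D bs" "\<lambda>b. D (b # bs)"])
       (use D has_partials_UNIV_deriv[OF D] in \<open>auto simp: has_partials_def\<close>)
  moreover have "(\<lambda>\<xi>. \<Sum>b\<in>Basis. (\<xi> \<bullet> b) * D (b # bs) p) =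
      (\<lambda>(s, t). s * D ((1, 0) # bs) p + t * D ((0, 1) # bs) p)"
    by (simp add: Basis_prod_def sum.union_disjoint fun_eq_iff)
  ultimately show ?thesis by simp
qed

lemma has_real_derivative_compose_pair:
  fixes \<phi> \<psi> :: "real \<Rightarrow> real"
  assumes "(f has_derivative (\<lambda>(s, t). s * c + t * d)) (at (\<phi> x, \<psi> x))"
    and "(\<phi> has_real_derivative \<phi>') (at x)" "(\<psi> has_real_derivative \<psi>') (at x)"
  shows "((\<lambda>t. f (\<phi> t, \<psi> t)) has_real_derivative \<phi>' * c + \<psi>' * d) (at x)"
proof -
  have "((\<lambda>t. (\<phi> t, \<psi> t)) has_derivative (\<lambda>h. (\<phi>' * h, \<psi>' * h))) (at x)"
    using assms(2,3) by (auto simp: has_field_derivative_def intro: has_derivative_Pair)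
  moreover have "(\<lambda>x. x * (\<phi>' * c) + x * (\<psi>' * d)) = (*) (\<phi>' * c + \<psi>' * d)"
    by (simp add: algebra_simps fun_eq_iff)
  ultimately show ?thesis
    using has_derivative_compose[of "\<lambda>t. (\<phi> t, \<psi> t)" _ x UNIV, OF _ assms(1)]
    by (fastforce simp: has_field_derivative_def mult.assoc mult.left_commute)
qed

text \<open>Only the inner functions vary with the index. The chain rule lowers the order
  \<open>j\<close> while lengthening \<open>bs\<close>, so the claim is made for all derivatives of
  the outer function at once.\<close>

lemma Ck_family_compose_pair:
  fixes f g :: "'i \<Rightarrow> 'a::euclidean_space \<Rightarrow> real"
  assumes D: "has_partials k UNIV \<psi> D" and "set bs \<subseteq> Basis" "length bs + j \<le> k"
    and "Ck_family j K I f" "Ck_family j K I g"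
  shows "Ck_family j K I (\<lambda>i x. D bs (f i x, g i x))"
  using assms(2-)
proof (induction j arbitrary: bs)
  case 0
  then have cont: "continuous_on UNIV (D bs)"
    using D unfolding has_partials_def by simp
  obtain B C where BC: "\<forall>i\<in>I. \<forall>x\<in>K. \<bar>f i x\<bar> \<le> B" "\<forall>i\<in>I. \<forall>x\<in>K. \<bar>g i x\<bar> \<le> C"
    using 0 by auto
  \<comment> \<open>Here uniformity arises: for \<open>x\<close> in \<open>K\<close> all pairs
    \<open>(f i x, g i x)\<close> lie in one box, on which the continuous function
    \<open>D bs\<close> is bounded.\<close>
  have "bounded (D bs ` cbox (- B, - C) (B, C))"
    using cont by (meson compact_continuous_image compact_imp_bounded continuous_on_subset subset_UNIV compact_cbox)
  then obtain E where "\<forall>p\<in>cbox (- B, - C) (B, C). \<bar>D bs p\<bar> \<le> E"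
    by (auto simp: bounded_iff)
  then have "\<forall>i\<in>I. \<forall>x\<in>K. \<bar>D bs (f i x, g i x)\<bar> \<le> E"
    using BC by (fastforce simp: cbox_Pair_eq abs_le_iff)
  moreover have "continuous_on UNIV (\<lambda>x. D bs (f i x, g i x))" if "i \<in> I" for i
    using 0 that by (intro continuous_on_compose2[OF cont] continuous_on_Pair) auto
  ultimately show ?case by auto
next
  case (Suc j)
  obtain f' where f': "\<And>b. b \<in> Basis \<Longrightarrow> Ck_family j K I (f' b)"
    "\<And>b i x. b \<in> Basis \<Longrightarrow> i \<in> I \<Longrightarrow> ((\<lambda>t. f i (x + t *\<^sub>R b)) has_real_derivative f' b i x) (at 0)"
    using Suc.prems(3) by (rule Ck_family_SucE) blast
  obtain g' where g': "\<And>b. b \<in> Basis \<Longrightarrow> Ck_family j K I (g' b)"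
    "\<And>b i x. b \<in> Basis \<Longrightarrow> i \<in> I \<Longrightarrow> ((\<lambda>t. g i (x + t *\<^sub>R b)) has_real_derivative g' b i x) (at 0)"
    using Suc.prems(4) by (rule Ck_family_SucE) blast
  have IH: "Ck_family j K I (\<lambda>i x. D cs (f i x, g i x))" if "set cs \<subseteq> Basis" "length cs + j \<le> k" for cs
    by (rule Suc.IH[OF that Ck_family_SucD[OF Suc.prems(3)] Ck_family_SucD[OF Suc.prems(4)]])
  show ?case
  proof (rule Ck_family_SucI)
    show "Ck_family 0 K I (\<lambda>i x. D bs (f i x, g i x))"
      using Suc.prems by (intro Ck_family_0[OF IH]) auto
    show "Ck_family j K I (\<lambda>i x. f' b i x * D ((1, 0) # bs) (f i x, g i x) +
        g' b i x * D ((0, 1) # bs) (f i x, g i x))" if "b \<in> Basis" for b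
      using that Suc.prems by (intro Ck_family_add Ck_family_mult f'(1) g'(1) IH) (auto simp: Basis_prod_def)
    show "((\<lambda>t. D bs (f i (x + t *\<^sub>R b), g i (x + t *\<^sub>R b))) has_real_derivative
        f' b i x * D ((1, 0) # bs) (f i x, g i x) + g' b i x * D ((0, 1) # bs) (f i x, g i x)) (at 0)"
      if "b \<in> Basis" "i \<in> I" for b i x
      using Suc.prems has_derivative_partials_prod[OF D, of bs "(f i x, g i x)"]
      by (intro has_real_derivative_compose_pair f'(2)[OF that] g'(2)[OF that]) auto
  qed
qed

lemma Ck_family_has_partials:
  assumes "Ck_family k K I f"
  shows "\<exists>C. \<forall>i\<in>I. \<exists>D. has_partials k UNIV (f i) D \<and>
    (\<forall>bs. set bs \<subseteq> Basis \<and> length bs \<le> k \<longrightarrow> (\<forall>x\<in>K. \<bar>D bs x\<bar> \<le> C))"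
  using assms
proof (induction k arbitrary: f)
  case 0
  then obtain C where "\<forall>i\<in>I. \<forall>x\<in>K. \<bar>f i x\<bar> \<le> C" by auto
  then show ?case
    using 0 by (intro exI[of _ C] ballI exI[of _ "\<lambda>_. f _"]) (auto simp: has_partials_def)
next
  case (Suc k)
  obtain g where g: "Ck_family 0 K I f" "\<And>b. b \<in> Basis \<Longrightarrow> Ck_family k K I (g b)"
    "\<And>b i x. b \<in> Basis \<Longrightarrow> i \<in> I \<Longrightarrow> ((\<lambda>t. f i (x + t *\<^sub>R b)) has_real_derivative g b i x) (at 0)"
    using Suc.prems by (rule Ck_family_SucE) blast
  obtain C0 where C0: "\<forall>i\<in>I. \<forall>x\<in>K. \<bar>f i x\<bar> \<le> C0" using g(1) by auto
  have "\<forall>b\<in>Basis. \<exists>C. \<forall>i\<in>I. \<exists>D. has_partials k UNIV (g b i) D \<and>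
      (\<forall>bs. set bs \<subseteq> Basis \<and> length bs \<le> k \<longrightarrow> (\<forall>x\<in>K. \<bar>D bs x\<bar> \<le> C))"
    using Suc.IH[OF g(2)] by blast
  then obtain C where "\<forall>b\<in>Basis. \<forall>i\<in>I. \<exists>D. has_partials k UNIV (g b i) D \<and>
      (\<forall>bs. set bs \<subseteq> Basis \<and> length bs \<le> k \<longrightarrow> (\<forall>x\<in>K. \<bar>D bs x\<bar> \<le> C b))"
    by metis
  then obtain D where D: "\<And>b i. b \<in> Basis \<Longrightarrow> i \<in> I \<Longrightarrow> has_partials k UNIV (g b i) (D b i)"
      "\<And>b i bs x. b \<in> Basis \<Longrightarrow> i \<in> I \<Longrightarrow> set bs \<subseteq> Basis \<Longrightarrow> length bs \<le> k \<Longrightarrow> x \<in> K \<Longrightarrow> \<bar>D b i bs x\<bar> \<le> C b"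
    by metis
  define C' where "C' = Max (insert C0 (C ` Basis))"
  have C': "C0 \<le> C'" "\<And>b. b \<in> Basis \<Longrightarrow> C b \<le> C'"
    by (auto simp: C'_def simp del: Max_insert intro!: Max_ge)
  show ?case
  proof (intro exI[of _ C'] ballI)
    fix i assume i: "i \<in> I"
    \<comment> \<open>The head of a direction list is the outermost derivative, so the derivative
      that acts on \<open>f i\<close> first is the last entry, and the remaining ones act on
      \<open>g (last bs) i\<close>.\<close>
    define E where "E bs = (if bs = [] then f i else D (last bs) i (butlast bs))" for bs
    have split: "set (butlast bs) \<subseteq> Basis \<and> last bs \<in> Basis \<and> Suc (length (butlast bs)) = length bs"
      if "set bs \<subseteq> Basis" "bs \<noteq> []" for bs :: "'a list"
      using that last_in_set[of bs] by (auto dest: in_set_butlastD)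
    have "has_partials (Suc k) UNIV (f i) E"
      unfolding has_partials_def
    proof (intro conjI allI ballI impI)
      show "E [] x = f i x" for x by (simp add: E_def)
    next
      fix bs :: "'a list" assume bs: "set bs \<subseteq> Basis \<and> length bs \<le> Suc k"
      show "continuous_on UNIV (E bs)"
      proof (cases "bs = []")
        case True
        then show ?thesis using g(1) i by (simp add: E_def)
      next
        case False
        show ?thesis
        proof -
          have "set (butlast bs) \<subseteq> Basis" "length (butlast bs) \<le> k" "last bs \<in> Basis"
            using split[of bs] bs False by auto
          then have "continuous_on UNIV (D (last bs) i (butlast bs))"
            using D(1)[of "last bs" i] i unfolding has_partials_def by blast
          then show ?thesis using False by (simp add: E_def)
        qed
      qed
    next
      fix bs :: "'a list" and b x :: 'a
      assume b: "b \<in> Basis" and bs: "set bs \<subseteq> Basis \<and> length bs < Suc k"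
      show "((\<lambda>t. E bs (x + t *\<^sub>R b)) has_real_derivative E (b # bs) x) (at 0)"
      proof (cases "bs = []")
        case True
        then show ?thesis
          using g(3)[OF b i] D(1)[OF b i] by (simp add: E_def has_partials_def)
      next
        case False
        then have "set (butlast bs) \<subseteq> Basis \<and> last bs \<in> Basis \<and> Suc (length (butlast bs)) = length bs"
          using split[of bs] bs by blast
        then have "set (butlast bs) \<subseteq> Basis" "length (butlast bs) < k" "last bs \<in> Basis"
          using bs by linarith+
        then have "((\<lambda>t. D (last bs) i (butlast bs) (x + t *\<^sub>R b)) has_real_derivative
            D (last bs) i (b # butlast bs) x) (at 0)"
          using i b by (intro has_partials_UNIV_deriv[OF D(1)])
        then show ?thesis using False by (simp add: E_def)
      qed
    qed
    moreover have "\<bar>E bs x\<bar> \<le> C'" if "set bs \<subseteq> Basis \<and> length bs \<le> Suc k" "x \<in> K" for bs x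
    proof (cases "bs = []")
      case True
      then show ?thesis using C0 C'(1) i that by (force simp: E_def)
    next
      case False
      then have "set (butlast bs) \<subseteq> Basis \<and> last bs \<in> Basis \<and> Suc (length (butlast bs)) = length bs"
        using split[of bs] that by blast
      then have "set (butlast bs) \<subseteq> Basis" "length (butlast bs) \<le> k" "last bs \<in> Basis"
        using that by linarith+
      then have "\<bar>D (last bs) i (butlast bs) x\<bar> \<le> C (last bs)" "C (last bs) \<le> C'"
        using D(2) i that C'(2) by auto
      then show ?thesis using False by (simp add: E_def)
    qed
    ultimately show "\<exists>D. has_partials (Suc k) UNIV (f i) D \<and>
        (\<forall>bs. set bs \<subseteq> Basis \<and> length bs \<le> Suc k \<longrightarrow> (\<forall>x\<in>K. \<bar>D bs x\<bar> \<le> C'))"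
      by blast
  qed
qed

section \<open>Potentials and nonlinearities\<close>

lemma sum_Basis_vec:
  "(\<Sum>b\<in>(Basis::(real^'n) set). f b) = (\<Sum>i\<in>UNIV. f (axis i 1))"
proof -
  have eq: "(Basis::(real^'n) set) = range (\<lambda>i. axis i 1)"
    by (auto simp: Basis_vec_def)
  have inj: "inj (\<lambda>i::'n. axis i (1::real))"
    by (auto simp: inj_on_def axis_eq_axis)
  show ?thesis
    unfolding eq by (subst sum.reindex[OF inj]) simp
qed

lemma has_real_derivative_along_line:
  fixes f :: "'a::euclidean_space \<Rightarrow> real"
  assumes "\<And>y b. b \<in> Basis \<Longrightarrow> ((\<lambda>t. f (y + t *\<^sub>R b)) has_real_derivative g b y) (at 0)"
    and "\<And>b. b \<in> Basis \<Longrightarrow> continuous_on UNIV (g b)"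
  shows "((\<lambda>t. f (x + t *\<^sub>R \<xi>)) has_real_derivative (\<Sum>b\<in>Basis. (\<xi> \<bullet> b) * g b (x + s *\<^sub>R \<xi>))) (at s)"
proof -
  have f: "(f has_derivative (\<lambda>\<zeta>. \<Sum>b\<in>Basis. (\<zeta> \<bullet> b) * g b (x + s *\<^sub>R \<xi>))) (at (x + s *\<^sub>R \<xi>))"
    by (rule has_derivative_continuous_partials[of UNIV]) (use assms in auto)
  have l: "((\<lambda>t. x + t *\<^sub>R \<xi>) has_derivative (\<lambda>t. t *\<^sub>R \<xi>)) (at s)"
    by (auto intro!: derivative_eq_intros)
  have "((\<lambda>t. f (x + t *\<^sub>R \<xi>)) has_derivative
      (\<lambda>t. \<Sum>b\<in>Basis. ((t *\<^sub>R \<xi>) \<bullet> b) * g b (x + s *\<^sub>R \<xi>))) (at s)"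
    by (rule has_derivative_compose[OF l f])
  moreover have "(\<lambda>t. \<Sum>b\<in>Basis. ((t *\<^sub>R \<xi>) \<bullet> b) * g b (x + s *\<^sub>R \<xi>)) =
      (*) (\<Sum>b\<in>Basis. (\<xi> \<bullet> b) * g b (x + s *\<^sub>R \<xi>))"
    by (simp add: fun_eq_iff sum_distrib_left sum_distrib_right mult_ac)
  ultimately show ?thesis
    by (simp add: has_field_derivative_def)
qed

text \<open>Only the behaviour along rays from the minimum point is needed of the convexity.\<close>

lemma potential_radial:
  fixes \<Phi> :: "real^'n \<Rightarrow> real"
  assumes "potential \<Lambda> M \<Phi>" "\<Lambda> > 0"
  obtains x0 where "continuous_on UNIV \<Phi>" "\<Phi> x0 = 0" "\<And>x. 0 \<le> \<Phi> x"
    "\<And>x. \<Lambda> / 2 * (norm (x - x0))\<^sup>2 \<le> \<Phi> x"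
    "\<And>x s. x \<noteq> x0 \<Longrightarrow> 0 \<le> s \<Longrightarrow> s < 1 \<Longrightarrow> \<Phi> (x0 + s *\<^sub>R (x - x0)) < \<Phi> x"
proof -
  obtain x0 where x0: "\<Phi> x0 = 0" "\<And>x. \<Phi> x0 \<le> \<Phi> x"
    using assms(1) by (auto simp: potential_def)
  obtain D where "has_partials 2 UNIV \<Phi> D"
    using assms(1) unfolding potential_def smooth_on_def Ck_on_def by blast
  then have D0: "D [] = \<Phi>" and cont: "\<And>bs. set bs \<subseteq> Basis \<Longrightarrow> length bs \<le> 2 \<Longrightarrow> continuous_on UNIV (D bs)"
    and der: "\<And>bs b x. set bs \<subseteq> Basis \<Longrightarrow> length bs < 2 \<Longrightarrow> b \<in> Basis \<Longrightarrow>
      ((\<lambda>t. D bs (x + t *\<^sub>R b)) has_real_derivative D (b # bs) x) (at 0)"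
    unfolding has_partials_def by auto
  have partial1: "partial j \<Phi> = D [axis j 1]" for j
    using der[of "[]" "axis j 1"] by (auto simp: partial_def D0 fun_eq_iff intro!: DERIV_imp_deriv)
  have partial2: "partial i (partial j \<Phi>) x = D [axis i 1, axis j 1] x" for i j x
    using der[of "[axis j 1]" "axis i 1" x] unfolding partial1 by (auto simp: partial_def intro!: DERIV_imp_deriv)
  define \<phi> where "\<phi> \<xi> t = \<Phi> (x0 + t *\<^sub>R \<xi>)" for \<xi> t
  define \<phi>1 where "\<phi>1 \<xi> t = (\<Sum>b\<in>Basis. (\<xi> \<bullet> b) * D [b] (x0 + t *\<^sub>R \<xi>))" for \<xi> t
  define \<phi>2 where "\<phi>2 \<xi> t = (\<Sum>b\<in>Basis. (\<xi> \<bullet> b) * (\<Sum>c\<in>Basis. (\<xi> \<bullet> c) * D [c, b] (x0 + t *\<^sub>R \<xi>)))" for \<xi> t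
  have d1: "(\<phi> \<xi> has_real_derivative \<phi>1 \<xi> t) (at t)" for \<xi> t
    unfolding \<phi>_def \<phi>1_def D0[symmetric]
    by (rule has_real_derivative_along_line) (use der[of "[]"] cont in auto)
  have d2: "(\<phi>1 \<xi> has_real_derivative \<phi>2 \<xi> t) (at t)" for \<xi> t
    unfolding \<phi>1_def \<phi>2_def
  proof (intro DERIV_sum DERIV_cmult)
    fix b :: "real^'n" assume "b \<in> Basis"
    then show "((\<lambda>t. D [b] (x0 + t *\<^sub>R \<xi>)) has_real_derivative
        (\<Sum>c\<in>Basis. \<xi> \<bullet> c * D [c, b] (x0 + t *\<^sub>R \<xi>))) (at t)"
      by (intro has_real_derivative_along_line) (use der[of "[b]"] cont in auto)
  qed
  \<comment> \<open>Along the line the second derivative is the quadratic form of the Hessian, to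
    which the Loewner bound applies.\<close>
  have low: "\<Lambda> * (norm \<xi>)\<^sup>2 \<le> \<phi>2 \<xi> t" for \<xi> t
  proof -
    let ?x = "x0 + t *\<^sub>R \<xi>"
    have "\<phi>2 \<xi> t = (\<Sum>j\<in>UNIV. \<xi> $ j * (\<Sum>i\<in>UNIV. \<xi> $ i * hessian \<Phi> ?x $ i $ j))"
      by (simp add: \<phi>2_def sum_Basis_vec inner_axis hessian_def partial2)
    also have "\<dots> = (\<Sum>j\<in>UNIV. \<Sum>i\<in>UNIV. \<xi> $ i * (hessian \<Phi> ?x $ i $ j * \<xi> $ j))"
      by (simp add: sum_distrib_left mult_ac)
    also have "\<dots> = \<xi> \<bullet> (hessian \<Phi> ?x *v \<xi>)"
      by (subst sum.swap) (simp add: inner_vec_def matrix_vector_mult_def sum_distrib_left)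
    also have "\<dots> \<ge> \<xi> \<bullet> (mat \<Lambda> *v \<xi>)"
      using assms(1) by (auto simp: potential_def loewner_le_def)
    also have "\<xi> \<bullet> (mat \<Lambda> *v \<xi>) = \<Lambda> * (norm \<xi>)\<^sup>2"
      by (simp add: inner_vec_def matrix_vector_mult_def mat_def if_distrib[of "\<lambda>x. x * _"] cong: if_cong)
        (simp add: power2_norm_eq_inner inner_vec_def sum_distrib_left mult_ac)
    finally show ?thesis .
  qed
  have start: "\<phi>1 \<xi> 0 = 0" for \<xi>
    using DERIV_local_min[OF d1[of \<xi> 0], of 1] x0(2) by (simp add: \<phi>_def)
  have slope: "\<Lambda> * (norm \<xi>)\<^sup>2 * t \<le> \<phi>1 \<xi> t" if "t \<ge> 0" for \<xi> t
  proof (cases "t = 0")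
    case False
    then obtain z where "\<phi>1 \<xi> t - \<phi>1 \<xi> 0 = (t - 0) * \<phi>2 \<xi> z"
      using MVT2[of 0 t "\<phi>1 \<xi>" "\<phi>2 \<xi>"] d2 \<open>t \<ge> 0\<close> by (metis order_le_less)
    then show ?thesis
      using low[of \<xi> z] start[of \<xi>] mult_right_mono[OF low \<open>t \<ge> 0\<close>, of \<xi> z] by (simp add: mult.commute)
  qed (simp add: start)
  show thesis
  proof (rule that[of x0])
    show "continuous_on UNIV \<Phi>" using cont[of "[]"] by (simp add: D0)
    show "\<Phi> x0 = 0" "0 \<le> \<Phi> x" for x using x0(1) x0(2)[of x] by auto
    show "\<Lambda> / 2 * (norm (x - x0))\<^sup>2 \<le> \<Phi> x" for x
    proof -
      let ?\<xi> = "x - x0"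
      \<comment> \<open>Once the parabola of curvature
        \<open>\<Lambda> * (norm ?\<xi>)\<^sup>2\<close> is subtracted, the derivative is still
        nonnegative by \<open>slope\<close>; comparing the ends 0 and 1 gives the growth.\<close>
      have "\<phi> ?\<xi> 0 - \<Lambda> * (norm ?\<xi>)\<^sup>2 * 0\<^sup>2 / 2 \<le> \<phi> ?\<xi> 1 - \<Lambda> * (norm ?\<xi>)\<^sup>2 * 1\<^sup>2 / 2"
      proof (rule DERIV_nonneg_imp_nondecreasing[where f="\<lambda>t. \<phi> ?\<xi> t - \<Lambda> * (norm ?\<xi>)\<^sup>2 * t\<^sup>2 / 2"])
        fix t :: real assume "0 \<le> t"
        have "((\<lambda>t. \<phi> ?\<xi> t - \<Lambda> * (norm ?\<xi>)\<^sup>2 * t\<^sup>2 / 2) has_real_derivative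
            \<phi>1 ?\<xi> t - \<Lambda> * (norm ?\<xi>)\<^sup>2 * t) (at t)"
          by (auto intro!: derivative_eq_intros d1)
        then show "\<exists>y. ((\<lambda>t. \<phi> ?\<xi> t - \<Lambda> * (norm ?\<xi>)\<^sup>2 * t\<^sup>2 / 2) has_real_derivative y) (at t) \<and> 0 \<le> y"
          using slope[OF \<open>0 \<le> t\<close>, of ?\<xi>] by (meson diff_ge_0_iff_ge)
      qed auto
      then show ?thesis by (simp add: \<phi>_def x0)
    qed
    show "\<Phi> (x0 + s *\<^sub>R (x - x0)) < \<Phi> x" if "x \<noteq> x0" "0 \<le> s" "s < 1" for x s
    proof -
      let ?\<xi> = "x - x0"
      obtain z where z: "s < z" "\<phi> ?\<xi> 1 - \<phi> ?\<xi> s = (1 - s) * \<phi>1 ?\<xi> z"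
        using MVT2[of s 1 "\<phi> ?\<xi>" "\<phi>1 ?\<xi>"] d1 \<open>s < 1\<close> by metis
      have "0 < \<Lambda> * (norm ?\<xi>)\<^sup>2 * z"
        using assms(2) that z(1) by simp
      also have "\<dots> \<le> \<phi>1 ?\<xi> z" using slope[of z ?\<xi>] that z(1) by simp
      finally have "0 < (1 - s) * \<phi>1 ?\<xi> z" using that by simp
      then show ?thesis using z(2) by (simp add: \<phi>_def)
    qed
  qed
qed

section \<open>One-sided derivatives on the half-line\<close>

lemma at_within_nonneg_nontrivial:
  fixes u :: real
  assumes "u \<ge> 0"
  shows "at u within {0..} \<noteq> bot"
proof -
  have "\<exists>y\<in>{0..}. y \<noteq> u \<and> dist y u < e" if "e > 0" for e
    using that assms by (intro bexI[of _ "u + e / 2"]) (auto simp: dist_real_def)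
  then show ?thesis
    by (simp add: trivial_limit_within islimpt_approachable)
qed

lemma deriv_nn_eqI:
  assumes "(f has_real_derivative d) (at u within {0..})" "u \<ge> 0"
  shows "deriv_nn f u = d"
  using assms(1) vector_derivative_within[OF at_within_nonneg_nontrivial[OF assms(2)]]
  by (auto simp: deriv_nn_def has_real_derivative_iff_has_vector_derivative)

lemma has_partials_1_within:
  assumes "has_partials 1 {0..} f D" "u \<ge> 0"
  shows "(f has_real_derivative D [1] u) (at u within {0..})"
proof -
  have c0: "continuous_on {0..} (D [])" and c2: "continuous_on {0..} (D [1])"
    using assms(1) by (auto simp: has_partials_def)
  from c0 have c1: "continuous_on {0..} f"
    by (rule continuous_on_eq) (use assms(1) in \<open>auto simp: has_partials_def\<close>)
  have pos: "(f has_real_derivative D [1] t) (at t)" if "t > 0" for t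
  proof -
    have "((\<lambda>s. D [] (t + s *\<^sub>R 1)) has_real_derivative D [1] t) (at 0)"
      using assms(1) that unfolding has_partials_def by (force simp: interior_real_atLeast)
    then have "(D [] has_real_derivative D [1] t) (at t)"
      using DERIV_shift[of "D []" "D [1] t" 0 t] by (simp add: add.commute)
    then show ?thesis
      by (rule DERIV_cong_ev[THEN iffD1, rotated -1])
         (use assms(1) that in \<open>auto simp: has_partials_def eventually_nhds intro!: exI[of _ "{0<..}"]\<close>)
  qed
  show ?thesis
  proof (cases "u = 0")
    case True
    have "(f has_real_derivative D [1] 0) (at 0 within {0..})"
      by (rule has_real_derivative_limit[where g="D [1]"])
         (use c1 c2 pos in \<open>auto simp: continuous_on_eq_continuous_within\<close>)
    then show ?thesis by (simp add: True)
  next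
    case False
    then show ?thesis
      using pos[of u] assms(2) by (auto intro: has_field_derivative_at_within)
  qed
qed

section \<open>Convexity and growth of a single nonlinearity\<close>

context
  fixes F :: "real \<Rightarrow> real"
  assumes F: "nonlinearity F"
begin

lemma nonlinearity_deriv:
  shows "u \<ge> 0 \<Longrightarrow> (F has_real_derivative deriv_nn F u) (at u within {0..})"
    and "continuous_on {0..} (deriv_nn F)"
proof -
  obtain D where D: "has_partials 1 {0..} F D"
    using F by (auto simp: nonlinearity_def Ck_on_def)
  note d = has_partials_1_within[OF D]
  note eq = deriv_nn_eqI[OF d]
  show "(F has_real_derivative deriv_nn F u) (at u within {0..})" if "u \<ge> 0"
    using d[OF that] eq[OF that that] by simp
  have "continuous_on {0..} (D [1])"
    using D by (simp add: has_partials_def)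
  then show "continuous_on {0..} (deriv_nn F)"
    by (rule continuous_on_cong[THEN iffD1, rotated -1]) (auto simp: eq)
qed

lemma nonlinearity_continuous: "continuous_on {0..} F"
  by (rule DERIV_continuous_on) (use nonlinearity_deriv(1) in auto)

lemma nonlinearity_deriv_pos: "u > 0 \<Longrightarrow> (F has_real_derivative deriv_nn F u) (at u)"
  using nonlinearity_deriv(1)[of u] at_within_interior[of u "{0..}"]
  by (simp add: interior_real_atLeast)

lemma nonlinearity_zero: "F 0 = 0" "deriv_nn F 0 = 0"
  using F by (auto simp: nonlinearity_def)

text \<open>Three derivatives are identified on the positive half-line: \<open>deriv\<close>, the
  one-sided \<open>deriv_nn\<close>, and the witness of \<open>smooth_on\<close>. The hypotheses on
  \<open>deriv (deriv F)\<close> thereby become statements about \<open>deriv_nn F\<close>, which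
  also makes sense at 0.\<close>

lemma nonlinearity_deriv2:
  assumes "u > 0"
  shows "(deriv_nn F has_real_derivative deriv (deriv F) u) (at u)" "deriv (deriv F) u > 0"
proof -
  show "deriv (deriv F) u > 0" using F assms by (simp add: nonlinearity_def)
  have "Ck_on 2 {0<..} F" using F by (simp add: nonlinearity_def smooth_on_def)
  then obtain D where D: "has_partials 2 {0<..} F D" by (auto simp: Ck_on_def)
  have der: "((\<lambda>s. D bs (t + s *\<^sub>R 1)) has_real_derivative D (1 # bs) t) (at 0)"
    if "set bs \<subseteq> Basis" "length bs < 2" "t > 0" for bs t
    using D that unfolding has_partials_def by (force simp: interior_open)
  have d: "(D bs has_real_derivative D (1 # bs) t) (at t)"
    if "set bs \<subseteq> Basis" "length bs < 2" "t > 0" for bs t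
    using der[OF that] DERIV_shift[of "D bs" "D (1 # bs) t" 0 t] by (simp add: add.commute)
  have "(F has_real_derivative D [1] t) (at t)" if "t > 0" for t
    by (rule DERIV_cong_ev[THEN iffD1, rotated -1, OF d[of "[]" t]])
       (use D that in \<open>auto simp: has_partials_def eventually_nhds intro!: exI[of _ "{0<..}"]\<close>)
  then have eq: "deriv F t = D [1] t" "deriv_nn F t = D [1] t" if "t > 0" for t
    using that DERIV_unique[OF nonlinearity_deriv_pos] by (auto intro: DERIV_imp_deriv)
  have ev: "eventually (\<lambda>t. D [1] t = deriv F t) (nhds u)" "eventually (\<lambda>t. D [1] t = deriv_nn F t) (nhds u)"
    using assms by (auto simp: eq eventually_nhds intro!: exI[of _ "{0<..}"])
  have d1: "(D [1] has_real_derivative D [1, 1] u) (at u)"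
    using d[of "[1]" u] assms by simp
  then have "(deriv F has_real_derivative D [1, 1] u) (at u)"
    using DERIV_cong_ev[OF refl ev(1) refl] by simp
  moreover have "(deriv_nn F has_real_derivative D [1, 1] u) (at u)"
    using d1 DERIV_cong_ev[OF refl ev(2) refl] by simp
  ultimately show "(deriv_nn F has_real_derivative deriv (deriv F) u) (at u)"
    by (simp add: DERIV_imp_deriv)
qed

lemma nonlinearity_deriv_strict_mono:
  assumes "0 \<le> s" "s < t"
  shows "deriv_nn F s < deriv_nn F t"
proof -
  obtain \<xi> where "\<xi> \<in> open_segment s t" "deriv_nn F t - deriv_nn F s = (t - s) * deriv (deriv F) \<xi>"
    by (rule real_mvt_open_derivative[of s t "deriv_nn F" "deriv (deriv F)"])
       (use assms continuous_on_subset[OF nonlinearity_deriv(2)] nonlinearity_deriv2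
         in \<open>auto simp: closed_segment_eq_real_ivl open_segment_eq_real_ivl\<close>)
  moreover from this have "0 < (t - s) * deriv (deriv F) \<xi>"
    using assms nonlinearity_deriv2(2)[of \<xi>] by (simp add: open_segment_eq_real_ivl)
  ultimately show ?thesis by linarith
qed

lemma nonlinearity_deriv_nonneg: "0 \<le> s \<Longrightarrow> 0 \<le> deriv_nn F s"
  using nonlinearity_deriv_strict_mono[of 0 s] nonlinearity_zero by (cases "s = 0") auto

lemma nonlinearity_increment:
  assumes "0 \<le> s" "s < t"
  obtains \<xi> where "s < \<xi>" "\<xi> < t" "F t - F s = (t - s) * deriv_nn F \<xi>"
  by (rule real_mvt_open_derivative[of s t F "deriv_nn F"])
     (use assms continuous_on_subset[OF nonlinearity_continuous] nonlinearity_deriv_pos that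
       in \<open>auto simp: closed_segment_eq_real_ivl open_segment_eq_real_ivl\<close>)

lemma nonlinearity_nonneg: "0 \<le> s \<Longrightarrow> 0 \<le> F s"
  using nonlinearity_increment[of 0 s] nonlinearity_zero nonlinearity_deriv_nonneg
  by (metis diff_zero less_eq_real_def mult_nonneg_nonneg)

text \<open>The mean slopes on the two halves are compared through the strictly increasing first
  derivative. This gives strict convexity up to 0, where the second derivative may
  degenerate.\<close>

lemma nonlinearity_midpoint:
  assumes "0 \<le> s" "s < t"
  shows "F ((s + t) / 2) < (F s + F t) / 2"
proof -
  obtain \<xi> where \<xi>: "s < \<xi>" "\<xi> < (s + t) / 2" "F ((s + t) / 2) - F s = ((s + t) / 2 - s) * deriv_nn F \<xi>"
    using nonlinearity_increment[of s "(s + t) / 2"] assms by auto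
  obtain \<zeta> where \<zeta>: "(s + t) / 2 < \<zeta>" "F t - F ((s + t) / 2) = (t - (s + t) / 2) * deriv_nn F \<zeta>"
    using nonlinearity_increment[of "(s + t) / 2" t] assms by auto
  have "deriv_nn F \<xi> < deriv_nn F \<zeta>"
    using \<xi> \<zeta> assms by (intro nonlinearity_deriv_strict_mono) auto
  then have "(t - s) / 2 * deriv_nn F \<xi> < (t - s) / 2 * deriv_nn F \<zeta>"
    using assms by simp
  then show ?thesis
    using \<xi>(3) \<zeta>(2) by (simp add: field_simps)
qed

lemma nonlinearity_midpoint_le:
  assumes "0 \<le> s" "0 \<le> t"
  shows "F ((s + t) / 2) \<le> (F s + F t) / 2" "s \<noteq> t \<Longrightarrow> F ((s + t) / 2) < (F s + F t) / 2"
  using nonlinearity_midpoint[of s t] nonlinearity_midpoint[of t s] assms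
  by (cases s t rule: linorder_cases; simp add: add.commute)+

text \<open>The liminf condition keeps F'' above some \<open>c > 0\<close> from a point on; two
  integrations give a parabola there, and \<open>K\<close> absorbs the bounded range before it.
  Quadratic growth later beats the linear tilt.\<close>

lemma nonlinearity_quadratic_growth:
  obtains \<kappa> K where "\<kappa> > 0" "\<And>u. u \<ge> 0 \<Longrightarrow> \<kappa> * u\<^sup>2 - K \<le> F u"
proof -
  obtain c where c: "0 < ereal c" "ereal c < Liminf at_top (\<lambda>r. ereal (deriv (deriv F) r))"
    using F unfolding nonlinearity_def by (metis ereal_dense2)
  have "eventually (\<lambda>r. ereal c < ereal (deriv (deriv F) r)) at_top"
    by (rule less_LiminfD[OF c(2)])
  then obtain r1 where r1: "\<And>r. r \<ge> r1 \<Longrightarrow> c < deriv (deriv F) r"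
    by (auto simp: eventually_at_top_linorder)
  define r0 where "r0 = max r1 1"
  have r0: "r0 > 0" "\<And>r. r \<ge> r0 \<Longrightarrow> c < deriv (deriv F) r" using r1 by (auto simp: r0_def)
  have slope: "c * (r - r0) \<le> deriv_nn F r" if "r > r0" for r
  proof -
    have "\<exists>z>r0. z < r \<and> deriv_nn F r - deriv_nn F r0 = (r - r0) * deriv (deriv F) z"
      using that r0(1) by (intro MVT2 nonlinearity_deriv2(1)) auto
    then obtain z where "r0 < z" "deriv_nn F r - deriv_nn F r0 = (r - r0) * deriv (deriv F) z"
      by blast
    moreover from this have "(r - r0) * c \<le> (r - r0) * deriv (deriv F) z"
      using r0(2)[of z] that by (intro mult_left_mono) auto
    ultimately show ?thesis
      using nonlinearity_deriv_nonneg[of r0] r0(1) by (simp add: mult.commute)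
  qed
  have far: "c / 2 * (r - r0)\<^sup>2 \<le> F r" if "r > r0" for r
  proof -
    have "F r0 - c / 2 * (r0 - r0)\<^sup>2 \<le> F r - c / 2 * (r - r0)\<^sup>2"
    proof (rule DERIV_nonneg_imp_nondecreasing[where f="\<lambda>r. F r - c / 2 * (r - r0)\<^sup>2"])
      fix t :: real assume "r0 \<le> t"
      have "((\<lambda>r. F r - c / 2 * (r - r0)\<^sup>2) has_real_derivative deriv_nn F t - c * (t - r0)) (at t)"
        using r0(1) \<open>r0 \<le> t\<close> by (auto intro!: derivative_eq_intros nonlinearity_deriv_pos)
      moreover have "0 \<le> deriv_nn F t - c * (t - r0)"
        using slope[of t] \<open>r0 \<le> t\<close> nonlinearity_deriv_nonneg[of r0] r0(1) by (cases "t = r0") auto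
      ultimately show "\<exists>y. ((\<lambda>r. F r - c / 2 * (r - r0)\<^sup>2) has_real_derivative y) (at t) \<and> 0 \<le> y"
        by blast
    qed (use that in auto)
    then show ?thesis using nonlinearity_nonneg[of r0] r0(1) by simp
  qed
  show thesis
  proof (rule that[of "c / 4" "c / 2 * r0\<^sup>2"])
    show "c / 4 > 0" using c(1) by simp
    fix u :: real assume u: "u \<ge> 0"
    show "c / 4 * u\<^sup>2 - c / 2 * r0\<^sup>2 \<le> F u"
    proof (cases "u > r0")
      case True
      \<comment> \<open>Completing the square moves the vertex of the parabola from
        \<open>r0\<close> to 0, at the price of half the curvature.\<close>
      have "0 \<le> c / 4 * (u - 2 * r0)\<^sup>2" using c(1) by simp
      also have "\<dots> = c / 2 * (u - r0)\<^sup>2 - (c / 4 * u\<^sup>2 - c / 2 * r0\<^sup>2)"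
        by (simp add: power2_eq_square field_simps)
      finally show ?thesis using far[OF True] by linarith
    next
      case False
      then have "u\<^sup>2 \<le> r0\<^sup>2" using u by (intro power_mono) auto
      then have "c * u\<^sup>2 \<le> c * r0\<^sup>2" using c(1) by (intro mult_left_mono) auto
      moreover have "0 \<le> c * r0\<^sup>2" using c(1) by simp
      ultimately have "c / 4 * u\<^sup>2 - c / 2 * r0\<^sup>2 \<le> 0" by linarith
      then show ?thesis using nonlinearity_nonneg[OF u] by linarith
    qed
  qed
qed

end

section \<open>The coupling\<close>

lemma zero_quadrant: "0 \<in> quadrant"
  by (simp add: zero_prod_def)

lemma interior_quadrant: "interior quadrant = open_quadrant"
  by (simp add: interior_Times interior_real_atLeast)

lemma frontier_quadrant: "frontier quadrant = quadrant - open_quadrant"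
  by (simp add: frontier_def interior_quadrant closed_Times)

lemma open_open_quadrant: "open open_quadrant"
  by (intro open_Times open_greaterThan)

text \<open>A common diagonal shift moves both points and their convex combination into the open
  quadrant; continuity then lets the shift tend to 0.\<close>

lemma convex_on_closed_quadrant:
  fixes f :: "real \<times> real \<Rightarrow> real"
  assumes convex: "convex_on open_quadrant f" and cont: "continuous_on quadrant f"
  shows "convex_on quadrant f"
proof (rule convex_onI)
  show "convex quadrant" by (intro convex_Times convex_real_interval)
  fix t :: real and p q :: "real \<times> real"
  assume t: "0 < t" "t < 1" and pq: "p \<in> quadrant" "q \<in> quadrant"
  define e where "e n = (1 / real (Suc n), 1 / real (Suc n))" for n
  have "(\<lambda>n. 1 / real (Suc n)) \<longlonglongrightarrow> 0"
    using LIMSEQ_inverse_real_of_nat by (simp add: inverse_eq_divide)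
  then have "e \<longlonglongrightarrow> (0, 0)"
    unfolding e_def by (intro tendsto_Pair)
  then have e: "(\<lambda>n. r + e n) \<longlonglongrightarrow> r" for r
    using tendsto_add[OF tendsto_const[of r]] by (fastforce simp: zero_prod_def[symmetric])
  have pos: "r + e n \<in> open_quadrant" if "r \<in> quadrant" for r n
    using that by (auto simp: e_def mem_Times_iff add_nonneg_pos)
  have sub: "open_quadrant \<subseteq> quadrant" by auto
  have lim: "(\<lambda>n. f (r + e n)) \<longlonglongrightarrow> f r" if "r \<in> quadrant" for r
    using pos[OF that] sub by (intro continuous_on_tendsto_compose[OF cont e that] always_eventually) blast
  have mid: "(1 - t) *\<^sub>R p + t *\<^sub>R q \<in> quadrant"
    using pq t by (auto simp: mem_Times_iff)
  show "f ((1 - t) *\<^sub>R p + t *\<^sub>R q) \<le> (1 - t) * f p + t * f q"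
  proof (rule LIMSEQ_le)
    show "(\<lambda>n. f (((1 - t) *\<^sub>R p + t *\<^sub>R q) + e n)) \<longlonglongrightarrow> f ((1 - t) *\<^sub>R p + t *\<^sub>R q)"
      by (rule lim[OF mid])
    show "(\<lambda>n. (1 - t) * f (p + e n) + t * f (q + e n)) \<longlonglongrightarrow> (1 - t) * f p + t * f q"
      by (intro tendsto_intros lim pq)
    have "f (((1 - t) *\<^sub>R p + t *\<^sub>R q) + e n) \<le> (1 - t) * f (p + e n) + t * f (q + e n)" for n
    proof -
      have "((1 - t) *\<^sub>R p + t *\<^sub>R q) + e n = (1 - t) *\<^sub>R (p + e n) + t *\<^sub>R (q + e n)"
        by (simp add: algebra_simps)
      then show ?thesis
        using convex_onD[OF convex, of t "p + e n" "q + e n"] t pos pq by simp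
    qed
    then show "\<exists>N. \<forall>n\<ge>N. f (((1 - t) *\<^sub>R p + t *\<^sub>R q) + e n) \<le>
        (1 - t) * f (p + e n) + t * f (q + e n)"
      by blast
  qed
qed

locale coupled =
  fixes F G :: "real \<Rightarrow> real" and h :: "real \<times> real \<Rightarrow> real" and \<epsilon>s :: real
  assumes F: "nonlinearity F" and G: "nonlinearity G" and coupling: "coupling F G h \<epsilon>s"
begin

lemma \<epsilon>s_pos: "\<epsilon>s > 0"
  using coupling by (simp add: coupling_def)

lemma
  assumes "0 \<le> s"
  shows h_zero: "h (0, s) = 0" "h (s, 0) = 0"
    and partial_u_zero: "partial_u h (0, s) = 0" "partial_u h (s, 0) = 0"
    and partial_v_zero: "partial_v h (0, s) = 0" "partial_v h (s, 0) = 0"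
proof -
  have "(0, s) \<in> frontier quadrant" "(s, 0) \<in> frontier quadrant"
    using assms by (auto simp: frontier_quadrant)
  then show "h (0, s) = 0" "h (s, 0) = 0" "partial_u h (0, s) = 0" "partial_u h (s, 0) = 0"
    "partial_v h (0, s) = 0" "partial_v h (s, 0) = 0"
    using coupling unfolding coupling_def by blast+
qed

lemma h_partials:
  obtains D :: "real \<times> real \<Rightarrow> real \<times> real \<Rightarrow> real" where "continuous_on quadrant h" "continuous_on quadrant (D (1, 0))" "continuous_on quadrant (D (0, 1))"
    "\<And>u v. 0 < u \<Longrightarrow> 0 < v \<Longrightarrow> ((\<lambda>s. h (s, v)) has_real_derivative D (1, 0) (u, v)) (at u)"
    "\<And>u v. 0 < u \<Longrightarrow> 0 < v \<Longrightarrow> ((\<lambda>s. h (u, s)) has_real_derivative D (0, 1) (u, v)) (at v)"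
    "\<And>p. p \<in> open_quadrant \<Longrightarrow> (h has_derivative (\<lambda>(s, t). s * D (1, 0) p + t * D (0, 1) p)) (at p)"
proof -
  obtain D where D: "has_partials 1 quadrant h D"
    using coupling by (auto simp: coupling_def Ck_on_def)
  have eq: "D [] p = h p" if "p \<in> quadrant" for p
    using D that unfolding has_partials_def by blast
  have B: "(1, 0) \<in> (Basis :: (real \<times> real) set)" "(0, 1) \<in> (Basis :: (real \<times> real) set)"
    by (auto simp: Basis_prod_def)
  have cD: "continuous_on quadrant (D bs)" if "set bs \<subseteq> Basis" "length bs \<le> 1" for bs
    using D that unfolding has_partials_def by blast
  have c: "continuous_on quadrant h"
    by (rule continuous_on_eq[OF cD[of "[]"] eq]) auto
  have d: "((\<lambda>t. h (p + t *\<^sub>R b)) has_real_derivative D [b] p) (at 0)"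
    if "p \<in> open_quadrant" "b \<in> Basis" for p b
  proof -
    have "((\<lambda>t. D [] (p + t *\<^sub>R b)) has_real_derivative D [b] p) (at 0)"
      using D that unfolding has_partials_def interior_quadrant by force
    moreover have "eventually (\<lambda>t. D [] (p + t *\<^sub>R b) = h (p + t *\<^sub>R b)) (nhds 0)"
    proof -
      have "((\<lambda>t. p + t *\<^sub>R b) \<longlongrightarrow> p + 0 *\<^sub>R b) (nhds 0)"
        by (intro tendsto_intros filterlim_ident)
      then have "eventually (\<lambda>t. p + t *\<^sub>R b \<in> open_quadrant) (nhds 0)"
        by (rule topological_tendstoD) (use open_open_quadrant that in auto)
      then show ?thesis
        by eventually_elim (rule eq, auto)
    qed
    ultimately show ?thesis
      using DERIV_cong_ev[OF refl _ refl, of "\<lambda>t. D [] (p + t *\<^sub>R b)" "\<lambda>t. h (p + t *\<^sub>R b)" 0] by simp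
  qed
  show thesis
  proof (rule that[of "\<lambda>b. D [b]"])
    show "continuous_on quadrant h" by (rule c)
    show "continuous_on quadrant (D [(1, 0)])" "continuous_on quadrant (D [(0, 1)])"
      using B by (auto intro!: cD)
    show "((\<lambda>s. h (s, v)) has_real_derivative D [(1, 0)] (u, v)) (at u)"
      "((\<lambda>s. h (u, s)) has_real_derivative D [(0, 1)] (u, v)) (at v)" if "0 < u" "0 < v" for u v
      using d[of "(u, v)" "(1, 0)"] d[of "(u, v)" "(0, 1)"] that B
        DERIV_shift[of "\<lambda>s. h (s, v)" "D [(1, 0)] (u, v)" 0 u]
        DERIV_shift[of "\<lambda>s. h (u, s)" "D [(0, 1)] (u, v)" 0 v] by (auto simp: add.commute)
    show "(h has_derivative (\<lambda>(s, t). s * D [(1, 0)] p + t * D [(0, 1)] p)) (at p)"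
      if p: "p \<in> open_quadrant" for p
    proof -
      have "(h has_derivative (\<lambda>\<xi>. \<Sum>b\<in>Basis. (\<xi> \<bullet> b) * D [b] p)) (at p)"
      proof (rule has_derivative_continuous_partials[OF open_open_quadrant p d])
        show "continuous_on open_quadrant (D [b])" if "b \<in> Basis" for b
          by (rule continuous_on_subset[OF cD]) (use that in auto)
      qed
      moreover have "(\<lambda>\<xi>. \<Sum>b\<in>Basis. (\<xi> \<bullet> b) * D [b] p) =
          (\<lambda>(s, t). s * D [(1, 0)] p + t * D [(0, 1)] p)"
        by (simp add: Basis_prod_def sum.union_disjoint fun_eq_iff)
      ultimately show ?thesis by simp
    qed
  qed
qed

lemma h_continuous: "continuous_on quadrant h"
  using h_partials by metis

text \<open>On the edge \<open>v = 0\<close> the function vanishes identically. Elsewhere the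
  interior derivative extends continuously to \<open>u = 0\<close>. One-sided calculus thus becomes
  available for minimizers on the boundary.\<close>

lemma h_partial_u:
  assumes "0 \<le> u" "0 \<le> v"
  shows "((\<lambda>s. h (s, v)) has_real_derivative partial_u h (u, v)) (at u within {0..})"
proof (cases "v = 0")
  case True
  have "((\<lambda>s. h (s, v)) has_real_derivative 0) (at u within {0..})"
    by (rule has_field_derivative_transform_within[of "\<lambda>_. 0" _ _ _ 1])
       (use True h_zero assms in auto)
  then show ?thesis using True partial_u_zero assms by simp
next
  case False
  obtain D :: "real \<times> real \<Rightarrow> real \<times> real \<Rightarrow> real" where D: "continuous_on quadrant h" "continuous_on quadrant (D (1, 0))"
    "\<And>u v. 0 < u \<Longrightarrow> 0 < v \<Longrightarrow> ((\<lambda>s. h (s, v)) has_real_derivative D (1, 0) (u, v)) (at u)"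
    by (rule h_partials) blast
  have c: "continuous_on {0..} (\<lambda>s. h (s, v))" "continuous_on {0..} (\<lambda>s. D (1, 0) (s, v))"
    using assms by (auto intro!: continuous_on_compose2[OF D(1)] continuous_on_compose2[OF D(2)] continuous_intros)
  have "((\<lambda>s. h (s, v)) has_real_derivative D (1, 0) (u, v)) (at u within {0..})"
  proof (cases "u = 0")
    case True
    have "((\<lambda>s. h (s, v)) has_real_derivative D (1, 0) (0, v)) (at 0 within {0..})"
      by (rule has_real_derivative_limit[where g="\<lambda>s. D (1, 0) (s, v)"])
         (use c D(3) assms False in \<open>auto simp: continuous_on_eq_continuous_within\<close>)
    then show ?thesis by (simp add: True)
  next
    case False
    then show ?thesis
      using D(3)[of u v] assms \<open>v \<noteq> 0\<close> by (auto intro: has_field_derivative_at_within)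
  qed
  then show ?thesis
    using deriv_nn_eqI[OF _ assms(1)] by (simp add: partial_u_def)
qed

lemma h_partial_v:
  assumes "0 \<le> u" "0 \<le> v"
  shows "((\<lambda>s. h (u, s)) has_real_derivative partial_v h (u, v)) (at v within {0..})"
proof (cases "u = 0")
  case True
  have "((\<lambda>s. h (u, s)) has_real_derivative 0) (at v within {0..})"
    by (rule has_field_derivative_transform_within[of "\<lambda>_. 0" _ _ _ 1])
       (use True h_zero assms in auto)
  then show ?thesis using True partial_v_zero assms by simp
next
  case False
  obtain D :: "real \<times> real \<Rightarrow> real \<times> real \<Rightarrow> real" where D: "continuous_on quadrant h" "continuous_on quadrant (D (0, 1))"
    "\<And>u v. 0 < u \<Longrightarrow> 0 < v \<Longrightarrow> ((\<lambda>s. h (u, s)) has_real_derivative D (0, 1) (u, v)) (at v)"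
    by (rule h_partials) blast
  have c: "continuous_on {0..} (\<lambda>s. h (u, s))" "continuous_on {0..} (\<lambda>s. D (0, 1) (u, s))"
    using assms by (auto intro!: continuous_on_compose2[OF D(1)] continuous_on_compose2[OF D(2)] continuous_intros)
  have "((\<lambda>s. h (u, s)) has_real_derivative D (0, 1) (u, v)) (at v within {0..})"
  proof (cases "v = 0")
    case True
    have "((\<lambda>s. h (u, s)) has_real_derivative D (0, 1) (u, 0)) (at 0 within {0..})"
      by (rule has_real_derivative_limit[where g="\<lambda>s. D (0, 1) (u, s)"])
         (use c D(3) assms False in \<open>auto simp: continuous_on_eq_continuous_within\<close>)
    then show ?thesis by (simp add: True)
  next
    case False
    then show ?thesis
      using D(3)[of u v] assms \<open>u \<noteq> 0\<close> by (auto intro: has_field_derivative_at_within)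
  qed
  then show ?thesis
    using deriv_nn_eqI[OF _ assms(2)] by (simp add: partial_v_def)
qed

lemma h_has_derivative:
  assumes "p \<in> open_quadrant"
  shows "(h has_derivative (\<lambda>(s, t). s * partial_u h p + t * partial_v h p)) (at p)"
proof -
  obtain u v where uv: "p = (u, v)" "0 < u" "0 < v" using assms by (cases p) auto
  obtain D :: "real \<times> real \<Rightarrow> real \<times> real \<Rightarrow> real" where D:
    "\<And>u v. 0 < u \<Longrightarrow> 0 < v \<Longrightarrow> ((\<lambda>s. h (s, v)) has_real_derivative D (1, 0) (u, v)) (at u)"
    "\<And>u v. 0 < u \<Longrightarrow> 0 < v \<Longrightarrow> ((\<lambda>s. h (u, s)) has_real_derivative D (0, 1) (u, v)) (at v)"
    "\<And>p. p \<in> open_quadrant \<Longrightarrow> (h has_derivative (\<lambda>(s, t). s * D (1, 0) p + t * D (0, 1) p)) (at p)"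
    by (rule h_partials) blast
  have "partial_u h p = D (1, 0) p" "partial_v h p = D (0, 1) p"
    using uv deriv_nn_eqI[OF has_field_derivative_at_within[OF D(1)[OF uv(2,3)]]]
      deriv_nn_eqI[OF has_field_derivative_at_within[OF D(2)[OF uv(2,3)]]]
    by (simp_all add: partial_u_def partial_v_def)
  then show ?thesis using D(3)[OF assms] by simp
qed

lemma h_bound:
  assumes "0 \<le> u" "0 \<le> v"
  shows "2 * \<epsilon>s * \<bar>h (u, v)\<bar> \<le> F u + G v"
proof (cases "u = 0 \<or> v = 0")
  case True
  then have "h (u, v) = 0" using h_zero assms by auto
  then show ?thesis
    using nonlinearity_nonneg[OF F assms(1)] nonlinearity_nonneg[OF G assms(2)] by simp
next
  case False
  then have "u > 0" "v > 0" using assms by auto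
  then show ?thesis using coupling unfolding coupling_def by blast
qed

text \<open>The interaction part of the integrand at the coupling strength
  \<open>2 * \<epsilon>s\<close>, twice the largest one considered. It is only convex, not strictly
  convex.\<close>

definition H :: "real \<times> real \<Rightarrow> real" where
  "H = (\<lambda>(u, v). F u + G v + 2 * \<epsilon>s * h (u, v))"

lemma continuous_FG: "continuous_on quadrant (\<lambda>p. F (fst p))" "continuous_on quadrant (\<lambda>p. G (snd p))"
  by (auto intro!: continuous_on_compose2[OF nonlinearity_continuous[OF F]]
      continuous_on_compose2[OF nonlinearity_continuous[OF G]] continuous_intros)

lemma H_convex: "convex_on quadrant H"
proof (rule convex_on_closed_quadrant)
  show "convex_on open_quadrant H"
    using coupling by (simp add: coupling_def H_def)
  show "continuous_on quadrant H"
    unfolding H_def case_prod_beta prod.collapse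
    by (intro continuous_intros continuous_FG h_continuous)
qed

end

section \<open>Minimizers of the tilted integrand\<close>

lemma deriv_at_min_nonneg:
  fixes f :: "real \<Rightarrow> real"
  assumes "(f has_real_derivative d) (at u within {0..})" "u \<ge> 0"
    and min: "\<And>s. s \<ge> 0 \<Longrightarrow> f u \<le> f s"
  shows "u > 0 \<Longrightarrow> d = 0" and "u = 0 \<Longrightarrow> d \<ge> 0"
proof -
  show "d = 0" if "u > 0"
  proof (rule DERIV_local_min[of f d u u])
    show "(f has_real_derivative d) (at u)"
      using assms(1) that at_within_interior[of u "{0..}"] by (simp add: interior_real_atLeast)
  qed (use that min in auto)
  show "d \<ge> 0" if "u = 0"
  proof (rule tendsto_lowerbound)
    show "((\<lambda>y. (f y - f u) / (y - u)) \<longlongrightarrow> d) (at u within {0..})"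
      using assms(1) by (simp add: has_field_derivative_iff)
    show "eventually (\<lambda>y. 0 \<le> (f y - f u) / (y - u)) (at u within {0..})"
      using min that by (auto simp: eventually_at_filter)
    show "at u within {0..} \<noteq> bot" by (rule at_within_nonneg_nontrivial) fact
  qed
qed

text \<open>Chord slopes from 0 increase with the right endpoint and tend to the derivative 0 at 0,
  so none is negative.\<close>

lemma convex_on_nonneg_min_at_zero:
  fixes f :: "real \<Rightarrow> real"
  assumes "convex_on {0..} f" "(f has_real_derivative 0) (at 0 within {0..})" "u \<ge> 0"
  shows "f 0 \<le> f u"
proof (cases "u = 0")
  case False
  then have u: "u > 0" using assms(3) by simp
  have "0 \<le> (f u - f 0) / u"
  proof (rule tendsto_upperbound)
    show "((\<lambda>y. (f y - f 0) / (y - 0)) \<longlongrightarrow> 0) (at 0 within {0..})"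
      using assms(2) by (simp add: has_field_derivative_iff)
    have "(f y - f 0) / (y - 0) \<le> (f u - f 0) / u" if "0 < y" "y < u" for y
    proof -
      have "f ((1 - y / u) *\<^sub>R 0 + (y / u) *\<^sub>R u) \<le> (1 - y / u) * f 0 + y / u * f u"
        using that u by (intro convex_onD[OF assms(1)]) auto
      then show ?thesis
        using that u by (simp add: field_simps)
    qed
    then show "eventually (\<lambda>y. (f y - f 0) / (y - 0) \<le> (f u - f 0) / u) (at 0 within {0..})"
      using u by (auto simp: eventually_at dist_real_def intro!: exI[of _ u])
    show "at (0::real) within {0..} \<noteq> bot" by (rule at_within_nonneg_nontrivial) simp
  qed
  then show ?thesis using u by (simp add: zero_le_divide_iff)
qed simp

section \<open>Existence, uniqueness and continuity of the tilted minimizer\<close>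

context coupled
begin

definition W :: "real \<Rightarrow> real \<times> real \<Rightarrow> real" where
  "W \<epsilon> p = F (fst p) + G (snd p) + \<epsilon> * h p"

lemma W_continuous: "continuous_on quadrant (W \<epsilon>)"
  unfolding W_def by (intro continuous_intros continuous_FG h_continuous)

lemma W_zero: "W \<epsilon> 0 = 0"
  by (simp add: W_def nonlinearity_zero[OF F] nonlinearity_zero[OF G] h_zero zero_prod_def)

lemma W_eq_H:
  "W \<epsilon> p = (1 - \<epsilon> / (2 * \<epsilon>s)) * (F (fst p) + G (snd p)) + \<epsilon> / (2 * \<epsilon>s) * H p"
  using \<epsilon>s_pos by (cases p) (simp add: W_def H_def field_simps)

text \<open>For every admissible \<open>\<epsilon>\<close> the coupling term is at most half of
  \<open>F + G\<close> in absolute value. Growth and test energies can therefore be estimated by the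
  uncoupled terms, uniformly in \<open>\<epsilon>\<close>.\<close>

lemma W_bounds:
  assumes "\<epsilon> \<in> {0..\<epsilon>s}" "p \<in> quadrant"
  shows "F (fst p) + G (snd p) \<le> 2 * W \<epsilon> p" "2 * W \<epsilon> p \<le> 3 * F (fst p) + 3 * G (snd p)"
proof -
  have "2 * (\<epsilon>s * \<bar>h p\<bar>) \<le> F (fst p) + G (snd p)"
    using h_bound assms(2) by (cases p) (auto simp: mult.assoc)
  moreover have "\<epsilon> * \<bar>h p\<bar> \<le> \<epsilon>s * \<bar>h p\<bar>"
    using assms(1) by (intro mult_right_mono) auto
  moreover have "\<bar>\<epsilon> * h p\<bar> = \<epsilon> * \<bar>h p\<bar>"
    using assms(1) by (simp add: abs_mult)
  moreover have "W \<epsilon> p = F (fst p) + G (snd p) + \<epsilon> * h p" by (rule W_def)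
  ultimately show "F (fst p) + G (snd p) \<le> 2 * W \<epsilon> p" "2 * W \<epsilon> p \<le> 3 * F (fst p) + 3 * G (snd p)"
    by linarith+
qed

lemma W_nonneg:
  assumes "\<epsilon> \<in> {0..\<epsilon>s}" "p \<in> quadrant"
  shows "0 \<le> W \<epsilon> p"
  using W_bounds(1)[OF assms] nonlinearity_nonneg[OF F, of "fst p"] nonlinearity_nonneg[OF G, of "snd p"] assms(2)
  by (auto simp: mem_Times_iff)

text \<open>\<open>H\<close> contributes a weak inequality and the uncoupled terms a strict one,
  whose weight \<open>1 - \<sigma>\<close> is positive. Midpoints suffice for the uniqueness of
  minimizers.\<close>

lemma W_midpoint:
  assumes "\<epsilon> \<in> {0..\<epsilon>s}" and pq: "p \<in> quadrant" "q \<in> quadrant" "p \<noteq> q"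
  shows "2 * W \<epsilon> ((1/2) *\<^sub>R (p + q)) < W \<epsilon> p + W \<epsilon> q"
proof -
  define \<sigma> where "\<sigma> = \<epsilon> / (2 * \<epsilon>s)"
  have \<sigma>: "0 \<le> \<sigma>" "\<sigma> \<le> 1/2" using assms(1) \<epsilon>s_pos by (auto simp: \<sigma>_def field_simps)
  let ?m = "(1/2) *\<^sub>R (p + q)"
  have mid: "fst ?m = (fst p + fst q) / 2" "snd ?m = (snd p + snd q) / 2" by auto
  have nn: "0 \<le> fst p" "0 \<le> snd p" "0 \<le> fst q" "0 \<le> snd q" using pq by (auto simp: mem_Times_iff)
  have "H ((1 - 1/2) *\<^sub>R p + (1/2) *\<^sub>R q) \<le> (1 - 1/2) * H p + (1/2) * H q"
    by (rule convex_onD[OF H_convex]) (use pq in auto)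
  moreover have "(1 - 1/2) *\<^sub>R p + (1/2) *\<^sub>R q = ?m" by (simp add: scaleR_right_distrib)
  ultimately have "H ?m \<le> (H p + H q) / 2" by (simp add: field_simps)
  then have 1: "\<sigma> * H ?m \<le> \<sigma> * ((H p + H q) / 2)" using \<sigma>(1) by (rule mult_left_mono)
  have "fst p \<noteq> fst q \<or> snd p \<noteq> snd q" using pq(3) by (auto simp: prod_eq_iff)
  then have "F (fst ?m) + G (snd ?m) < (F (fst p) + F (fst q)) / 2 + (G (snd p) + G (snd q)) / 2"
    unfolding mid
    using nonlinearity_midpoint_le[OF F nn(1,3)] nonlinearity_midpoint_le[OF G nn(2,4)] by (smt (verit))
  then have "(1 - \<sigma>) * (F (fst ?m) + G (snd ?m)) <
      (1 - \<sigma>) * ((F (fst p) + F (fst q)) / 2 + (G (snd p) + G (snd q)) / 2)"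
    using \<sigma>(2) by (intro mult_strict_left_mono) auto
  with 1 show ?thesis
    unfolding W_eq_H \<sigma>_def[symmetric] by (simp add: field_simps)
qed

text \<open>The premise \<open>W \<epsilon> p \<le> c \<bullet> p\<close> says that the tilted
  integrand does not exceed its value 0 at the origin. Quadratic growth against a linear term
  confines such points, with constants independent of \<open>\<epsilon>\<close>.\<close>

lemma W_coercive:
  obtains A B where "A \<ge> 0" "B \<ge> 0"
    "\<And>\<epsilon> c p. \<epsilon> \<in> {0..\<epsilon>s} \<Longrightarrow> p \<in> quadrant \<Longrightarrow> W \<epsilon> p \<le> c \<bullet> p \<Longrightarrow> norm p \<le> A + B * norm c"
proof -
  obtain \<kappa>1 K1 where F1: "\<kappa>1 > 0" "\<And>u. u \<ge> 0 \<Longrightarrow> \<kappa>1 * u\<^sup>2 - K1 \<le> F u"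
    by (rule nonlinearity_quadratic_growth[OF F]) blast
  obtain \<kappa>2 K2 where G1: "\<kappa>2 > 0" "\<And>u. u \<ge> 0 \<Longrightarrow> \<kappa>2 * u\<^sup>2 - K2 \<le> G u"
    by (rule nonlinearity_quadratic_growth[OF G]) blast
  define \<kappa> K where "\<kappa> = min \<kappa>1 \<kappa>2 / 2" and "K = (\<bar>K1\<bar> + \<bar>K2\<bar>) / 2"
  have \<kappa>: "\<kappa> > 0" "K \<ge> 0" using F1 G1 by (auto simp: \<kappa>_def K_def)
  have low: "\<kappa> * (norm p)\<^sup>2 - K \<le> W \<epsilon> p" if "\<epsilon> \<in> {0..\<epsilon>s}" "p \<in> quadrant" for \<epsilon> p
  proof -
    have "2 * \<kappa> * (fst p)\<^sup>2 \<le> \<kappa>1 * (fst p)\<^sup>2" "2 * \<kappa> * (snd p)\<^sup>2 \<le> \<kappa>2 * (snd p)\<^sup>2"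
      by (auto simp: \<kappa>_def intro!: mult_right_mono)
    then have "2 * (\<kappa> * (fst p)\<^sup>2) \<le> \<kappa>1 * (fst p)\<^sup>2" "2 * (\<kappa> * (snd p)\<^sup>2) \<le> \<kappa>2 * (snd p)\<^sup>2"
      by (simp_all only: mult.assoc)
    moreover have "\<kappa>1 * (fst p)\<^sup>2 - K1 \<le> F (fst p)" "\<kappa>2 * (snd p)\<^sup>2 - K2 \<le> G (snd p)"
      using that(2) F1 G1 by (auto simp: mem_Times_iff)
    moreover have "\<kappa> * (norm p)\<^sup>2 = \<kappa> * (fst p)\<^sup>2 + \<kappa> * (snd p)\<^sup>2"
      by (simp add: norm_prod_def distrib_left)
    moreover have "2 * K = \<bar>K1\<bar> + \<bar>K2\<bar>" by (simp add: K_def)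
    ultimately show ?thesis
      using W_bounds(1)[OF that] abs_ge_self[of K1] abs_ge_self[of K2] by linarith
  qed
  show thesis
  proof (rule that[of "1 + K / \<kappa>" "1 / \<kappa>"])
    fix \<epsilon> c and p :: "real \<times> real"
    assume e: "\<epsilon> \<in> {0..\<epsilon>s}" and p: "p \<in> quadrant" and le: "W \<epsilon> p \<le> c \<bullet> p"
    show "norm p \<le> 1 + K / \<kappa> + 1 / \<kappa> * norm c"
    proof (cases "norm p \<le> 1")
      case True
      have "0 \<le> K / \<kappa>" "0 \<le> 1 / \<kappa> * norm c" using \<kappa> by auto
      then show ?thesis using True by linarith
    next
      case False
      have "\<kappa> * (norm p)\<^sup>2 \<le> K + norm c * norm p"
        using low[OF e p] le norm_cauchy_schwarz[of c p] by linarith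
      \<comment> \<open>As \<open>norm p > 1\<close>, the constant is absorbed and one factor
        \<open>norm p\<close> cancels.\<close>
      also have "\<dots> \<le> K * norm p + norm c * norm p"
        using False \<kappa>(2) mult_left_mono[of 1 "norm p" K] by simp
      finally have "(\<kappa> * norm p) * norm p \<le> (K + norm c) * norm p"
        by (simp add: power2_eq_square algebra_simps)
      then have "\<kappa> * norm p \<le> K + norm c"
        using False by (auto simp: mult_le_cancel_right)
      then have "norm p \<le> (K + norm c) / \<kappa>"
        using \<kappa>(1) by (simp add: field_simps)
      then show ?thesis by (simp add: add_divide_distrib)
    qed
  qed (use \<kappa> in auto)
qed

definition tilted_min :: "real \<Rightarrow> real \<times> real \<Rightarrow> real \<times> real \<Rightarrow> bool" where
  "tilted_min \<epsilon> c p \<longleftrightarrow> p \<in> quadrant \<and> (\<forall>q\<in>quadrant. W \<epsilon> p - c \<bullet> p \<le> W \<epsilon> q - c \<bullet> q)"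

lemma tilted_min_unique:
  assumes "\<epsilon> \<in> {0..\<epsilon>s}" "tilted_min \<epsilon> c p" "tilted_min \<epsilon> c q"
  shows "p = q"
proof (rule ccontr)
  assume "p \<noteq> q"
  have pq: "p \<in> quadrant" "q \<in> quadrant" using assms(2,3) by (auto simp: tilted_min_def)
  let ?m = "(1/2) *\<^sub>R (p + q)"
  have "?m \<in> quadrant" using pq by (auto simp: mem_Times_iff)
  then have "W \<epsilon> p - c \<bullet> p \<le> W \<epsilon> ?m - c \<bullet> ?m \<and> W \<epsilon> q - c \<bullet> q \<le> W \<epsilon> ?m - c \<bullet> ?m"
    using assms(2,3) unfolding tilted_min_def by metis
  moreover have "2 * (c \<bullet> ?m) = c \<bullet> p + c \<bullet> q" by (simp add: inner_add_right)
  ultimately show False using W_midpoint[OF assms(1) pq \<open>p \<noteq> q\<close>] by linarith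
qed

text \<open>Outside the ball of \<open>W_coercive\<close> the tilted integrand is positive, hence
  above its value at the origin, so a minimum over the compact part is global.\<close>

lemma tilted_min_exists:
  assumes "\<epsilon> \<in> {0..\<epsilon>s}"
  shows "\<exists>p. tilted_min \<epsilon> c p"
proof -
  obtain A B where AB: "A \<ge> 0" "B \<ge> 0"
    "\<And>p. p \<in> quadrant \<Longrightarrow> W \<epsilon> p \<le> c \<bullet> p \<Longrightarrow> norm p \<le> A + B * norm c"
    using W_coercive assms by metis
  define S where "S = quadrant \<inter> cball 0 (A + B * norm c)"
  have "compact S" unfolding S_def by (intro closed_Int_compact closed_Times) auto
  have "0 \<in> S" using AB zero_quadrant by (simp add: S_def)
  have "continuous_on S (\<lambda>p. W \<epsilon> p - c \<bullet> p)"
    by (intro continuous_intros continuous_on_subset[OF W_continuous]) (auto simp: S_def)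
  then obtain p where p: "p \<in> S" "\<And>q. q \<in> S \<Longrightarrow> W \<epsilon> p - c \<bullet> p \<le> W \<epsilon> q - c \<bullet> q"
    using continuous_attains_inf[OF \<open>compact S\<close>, of "\<lambda>p. W \<epsilon> p - c \<bullet> p"] \<open>0 \<in> S\<close>
    by (metis empty_iff)
  have "W \<epsilon> p - c \<bullet> p \<le> 0"
    using p(2)[OF \<open>0 \<in> S\<close>] by (simp add: W_zero)
  have "W \<epsilon> p - c \<bullet> p \<le> W \<epsilon> q - c \<bullet> q" if q: "q \<in> quadrant" for q
  proof (cases "q \<in> S")
    case False
    then have "c \<bullet> q < W \<epsilon> q" using AB(3)[OF q] q by (auto simp: S_def) (metis not_le)
    then show ?thesis using \<open>W \<epsilon> p - c \<bullet> p \<le> 0\<close> by linarith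
  qed (rule p(2))
  then show ?thesis using p(1) by (auto simp: tilted_min_def S_def)
qed

definition amin :: "real \<Rightarrow> real \<times> real \<Rightarrow> real \<times> real" where
  "amin \<epsilon> c = (THE p. tilted_min \<epsilon> c p)"

lemma tilted_min_amin: "\<epsilon> \<in> {0..\<epsilon>s} \<Longrightarrow> tilted_min \<epsilon> c (amin \<epsilon> c)"
  unfolding amin_def using tilted_min_exists tilted_min_unique by (metis theI')

lemma amin_quadrant: "\<epsilon> \<in> {0..\<epsilon>s} \<Longrightarrow> amin \<epsilon> c \<in> quadrant"
  using tilted_min_amin by (auto simp: tilted_min_def)

lemma amin_nonneg:
  assumes "\<epsilon> \<in> {0..\<epsilon>s}"
  shows "0 \<le> fst (amin \<epsilon> c)" "0 \<le> snd (amin \<epsilon> c)"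
  using amin_quadrant[OF assms, of c] by (auto simp: mem_Times_iff)

lemma amin_le:
  "\<epsilon> \<in> {0..\<epsilon>s} \<Longrightarrow> q \<in> quadrant \<Longrightarrow> W \<epsilon> (amin \<epsilon> c) - c \<bullet> amin \<epsilon> c \<le> W \<epsilon> q - c \<bullet> q"
  using tilted_min_amin[of \<epsilon> c] unfolding tilted_min_def by blast

lemma amin_eqI:
  assumes "\<epsilon> \<in> {0..\<epsilon>s}" "q \<in> quadrant" "W \<epsilon> q - c \<bullet> q \<le> W \<epsilon> (amin \<epsilon> c) - c \<bullet> amin \<epsilon> c"
  shows "q = amin \<epsilon> c"
proof (rule tilted_min_unique[OF assms(1) _ tilted_min_amin[OF assms(1)]])
  show "tilted_min \<epsilon> c q"
    using amin_le[OF assms(1)] assms(2,3) order_trans unfolding tilted_min_def by blast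
qed

lemma amin_value_le: "\<epsilon> \<in> {0..\<epsilon>s} \<Longrightarrow> W \<epsilon> (amin \<epsilon> c) \<le> c \<bullet> amin \<epsilon> c"
  using amin_le[of \<epsilon> 0 c] zero_quadrant by (simp add: W_zero del: mem_Times_iff)

lemma amin_bound:
  obtains A B where "A \<ge> 0" "B \<ge> 0"
    "\<And>\<epsilon> c. \<epsilon> \<in> {0..\<epsilon>s} \<Longrightarrow> norm (amin \<epsilon> c) \<le> A + B * norm c"
  using W_coercive amin_quadrant amin_value_le by metis

text \<open>Uniqueness and local boundedness imply continuity: over a ball of tilts the values lie
  in a compact ball, and the graph is an intersection of closed sets, one for each competitor
  \<open>q\<close>.\<close>

lemma amin_continuous:
  assumes "\<epsilon> \<in> {0..\<epsilon>s}"
  shows "continuous_on UNIV (amin \<epsilon>)"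
proof -
  obtain A B where AB: "A \<ge> 0" "B \<ge> 0" "\<And>c. norm (amin \<epsilon> c) \<le> A + B * norm c"
    using amin_bound assms by metis
  have "continuous_on (cball 0 r) (amin \<epsilon>)" for r
  proof (rule continuous_from_closed_graph)
    show "compact (cball (0 :: real \<times> real) (A + B * r))" by simp
    show "amin \<epsilon> \<in> cball 0 r \<rightarrow> cball 0 (A + B * r)"
    proof
      fix c :: "real \<times> real" assume "c \<in> cball 0 r"
      then have "B * norm c \<le> B * r" using AB(2) by (intro mult_left_mono) auto
      then show "amin \<epsilon> c \<in> cball 0 (A + B * r)" using AB(3)[of c] by simp
    qed
    have "(\<lambda>c. (c, amin \<epsilon> c)) ` cball 0 r = (\<Inter>q\<in>quadrant. {x \<in> cball 0 r \<times> quadrant.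
        W \<epsilon> (snd x) - fst x \<bullet> snd x \<le> W \<epsilon> q - fst x \<bullet> q})" (is "?L = ?R")
    proof
      show "?L \<subseteq> ?R"
      proof (intro subsetI INT_I CollectI conjI)
        fix x q assume "x \<in> ?L" and q: "q \<in> quadrant"
        then obtain c where c: "c \<in> cball 0 r" "x = (c, amin \<epsilon> c)" by blast
        show "x \<in> cball 0 r \<times> quadrant"
          using c(1) amin_quadrant[OF assms, of c] unfolding c(2) by (rule SigmaI)
        show "W \<epsilon> (snd x) - fst x \<bullet> snd x \<le> W \<epsilon> q - fst x \<bullet> q"
          unfolding c(2) fst_conv snd_conv by (rule amin_le[OF assms q])
      qed
      show "?R \<subseteq> ?L"
      proof
        fix x assume x: "x \<in> ?R"
        \<comment> \<open>Membership is extracted from the set that belongs to the competitor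
          0.\<close>
        have "x \<in> cball 0 r \<times> quadrant" using x zero_quadrant by blast
        moreover have "W \<epsilon> (snd x) - fst x \<bullet> snd x \<le> W \<epsilon> q - fst x \<bullet> q" if "q \<in> quadrant" for q
          using x INT_D[OF x that] by simp
        ultimately have "fst x \<in> cball 0 r" "tilted_min \<epsilon> (fst x) (snd x)"
          unfolding tilted_min_def by (metis mem_Times_iff)+
        then show "x \<in> ?L"
          using tilted_min_unique[OF assms _ tilted_min_amin[OF assms]]
          by (metis (no_types, lifting) imageI prod.collapse)
      qed
    qed
    moreover have "closed {x \<in> cball 0 r \<times> quadrant.
        W \<epsilon> (snd x) - fst x \<bullet> snd x \<le> W \<epsilon> q - fst x \<bullet> q}" for q
      by (intro continuous_on_closed_Collect_le continuous_intros closed_Times closed_cball closed_atLeast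
          continuous_on_compose2[OF W_continuous]) auto
    ultimately show "closed ((\<lambda>c. (c, amin \<epsilon> c)) ` cball 0 r)"
      by auto
  qed
  then have "continuous_on (ball 0 r) (amin \<epsilon>)" for r
    by (meson ball_subset_cball continuous_on_subset)
  then have "isCont (amin \<epsilon>) c" for c
    by (rule continuous_on_interior[of "ball 0 (norm c + 1)"]) (simp add: interior_open)
  then show ?thesis by (simp add: continuous_on_eq_continuous_at)
qed

text \<open>\<open>H\<close> is convex in each variable separately, and its one-sided derivative at
  0 vanishes because the derivatives of \<open>F\<close>, \<open>G\<close> and \<open>h\<close> all
  do there.\<close>

lemma H_min_at_zero:
  assumes "0 \<le> u" "0 \<le> v"
  shows "H (0, v) \<le> H (u, v)" "H (u, 0) \<le> H (u, v)"
proof -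
  show "H (0, v) \<le> H (u, v)"
  proof (rule convex_on_nonneg_min_at_zero[of "\<lambda>s. H (s, v)"])
    show "convex_on {0..} (\<lambda>s. H (s, v))"
    proof (rule convex_onI)
      fix t x y :: real assume "0 < t" "t < 1" "x \<in> {0..}" "y \<in> {0..}"
      then have "H ((1 - t) *\<^sub>R (x, v) + t *\<^sub>R (y, v)) \<le> (1 - t) * H (x, v) + t * H (y, v)"
        using assms by (intro convex_onD[OF H_convex]) auto
      moreover have "(1 - t) *\<^sub>R (x, v) + t *\<^sub>R (y, v) = ((1 - t) *\<^sub>R x + t *\<^sub>R y, v)"
        by (simp add: algebra_simps)
      ultimately show "H ((1 - t) *\<^sub>R x + t *\<^sub>R y, v) \<le> (1 - t) * H (x, v) + t * H (y, v)"
        by simp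
    qed simp
    have "((\<lambda>s. F s + G v + 2 * \<epsilon>s * h (s, v)) has_real_derivative
        deriv_nn F 0 + 0 + 2 * \<epsilon>s * partial_u h (0, v)) (at 0 within {0..})"
      using assms by (intro DERIV_add DERIV_cmult DERIV_const nonlinearity_deriv(1)[OF F] h_partial_u) auto
    then show "((\<lambda>s. H (s, v)) has_real_derivative 0) (at 0 within {0..})"
      using assms by (simp add: H_def nonlinearity_zero[OF F] partial_u_zero)
  qed (rule assms)
  show "H (u, 0) \<le> H (u, v)"
  proof (rule convex_on_nonneg_min_at_zero[of "\<lambda>s. H (u, s)"])
    show "convex_on {0..} (\<lambda>s. H (u, s))"
    proof (rule convex_onI)
      fix t x y :: real assume "0 < t" "t < 1" "x \<in> {0..}" "y \<in> {0..}"
      then have "H ((1 - t) *\<^sub>R (u, x) + t *\<^sub>R (u, y)) \<le> (1 - t) * H (u, x) + t * H (u, y)"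
        using assms by (intro convex_onD[OF H_convex]) auto
      moreover have "(1 - t) *\<^sub>R (u, x) + t *\<^sub>R (u, y) = (u, (1 - t) *\<^sub>R x + t *\<^sub>R y)"
        by (simp add: algebra_simps)
      ultimately show "H (u, (1 - t) *\<^sub>R x + t *\<^sub>R y) \<le> (1 - t) * H (u, x) + t * H (u, y)"
        by simp
    qed simp
    have "((\<lambda>s. F u + G s + 2 * \<epsilon>s * h (u, s)) has_real_derivative
        0 + deriv_nn G 0 + 2 * \<epsilon>s * partial_v h (u, 0)) (at 0 within {0..})"
      using assms by (intro DERIV_add DERIV_cmult DERIV_const nonlinearity_deriv(1)[OF G] h_partial_v) auto
    then show "((\<lambda>s. H (u, s)) has_real_derivative 0) (at 0 within {0..})"
      using assms by (simp add: H_def nonlinearity_zero[OF G] partial_v_zero)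
  qed (rule assms)
qed

text \<open>Here the vanishing of \<open>h\<close> and its gradient on the boundary enters: a density is
  positive exactly where its own multiplier exceeds the potential, whatever the other density does.\<close>

lemma W_min_at_zero:
  assumes "\<epsilon> \<in> {0..\<epsilon>s}" "0 \<le> u" "0 \<le> v"
  shows "W \<epsilon> (0, v) \<le> W \<epsilon> (u, v)" "W \<epsilon> (u, 0) \<le> W \<epsilon> (u, v)"
proof -
  have \<sigma>: "0 \<le> \<epsilon> / (2 * \<epsilon>s)" "0 \<le> 1 - \<epsilon> / (2 * \<epsilon>s)" using assms(1) \<epsilon>s_pos by (auto simp: field_simps)
  have FG: "F 0 \<le> F u" "G 0 \<le> G v"
    using assms(2,3) by (auto simp: nonlinearity_zero[OF F] nonlinearity_zero[OF G]
        nonlinearity_nonneg[OF F] nonlinearity_nonneg[OF G])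
  show "W \<epsilon> (0, v) \<le> W \<epsilon> (u, v)" "W \<epsilon> (u, 0) \<le> W \<epsilon> (u, v)"
    unfolding W_eq_H using assms(2,3) \<sigma> FG
    by (intro add_mono mult_left_mono H_min_at_zero; simp)+
qed

text \<open>Replacing a component by 0 does not increase \<open>W\<close>, nor the linear term when
  its tilt is nonpositive. By uniqueness the component was already 0.\<close>

lemma amin_zero:
  assumes "\<epsilon> \<in> {0..\<epsilon>s}"
  shows "a \<le> 0 \<Longrightarrow> fst (amin \<epsilon> (a, b)) = 0" "b \<le> 0 \<Longrightarrow> snd (amin \<epsilon> (a, b)) = 0"
proof -
  obtain u v where uv: "amin \<epsilon> (a, b) = (u, v)" by (cases "amin \<epsilon> (a, b)")
  have nn: "0 \<le> u" "0 \<le> v" using amin_nonneg[OF assms, of "(a, b)"] by (auto simp: uv)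
  show "fst (amin \<epsilon> (a, b)) = 0" if "a \<le> 0"
  proof -
    have "a * u \<le> 0" using that nn by (simp add: mult_nonpos_nonneg)
    then have "(0, v) = amin \<epsilon> (a, b)"
      using W_min_at_zero(1)[OF assms nn] nn by (intro amin_eqI[OF assms]) (auto simp: uv)
    then show ?thesis by (metis fst_conv)
  qed
  show "snd (amin \<epsilon> (a, b)) = 0" if "b \<le> 0"
  proof -
    have "b * v \<le> 0" using that nn by (simp add: mult_nonpos_nonneg)
    then have "(u, 0) = amin \<epsilon> (a, b)"
      using W_min_at_zero(2)[OF assms nn] nn by (intro amin_eqI[OF assms]) (auto simp: uv)
    then show ?thesis by (metis snd_conv)
  qed
qed

text \<open>A vanishing component is impossible under a positive tilt \<open>a\<close>, because the
  one-sided derivative of the tilted integrand would be \<open>- a\<close> there. In the interior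
  the derivative is zero.\<close>

lemma amin_stationary:
  assumes "\<epsilon> \<in> {0..\<epsilon>s}" and uv: "amin \<epsilon> (a, b) = (u, v)"
  shows "a > 0 \<Longrightarrow> u > 0 \<and> deriv_nn F u + \<epsilon> * partial_u h (u, v) = a"
    and "b > 0 \<Longrightarrow> v > 0 \<and> deriv_nn G v + \<epsilon> * partial_v h (u, v) = b"
proof -
  have nn: "0 \<le> u" "0 \<le> v" using amin_nonneg[OF assms(1), of "(a, b)"] by (auto simp: uv)
  show "u > 0 \<and> deriv_nn F u + \<epsilon> * partial_u h (u, v) = a" if "a > 0"
  proof -
    let ?f = "\<lambda>s. F s + G v + \<epsilon> * h (s, v) - (a * s + b * v)"
    let ?d = "deriv_nn F u + 0 + \<epsilon> * partial_u h (u, v) - (a * 1 + 0)"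
    have d: "(?f has_real_derivative ?d) (at u within {0..})"
      using nn by (intro DERIV_diff DERIV_add DERIV_cmult DERIV_const DERIV_ident nonlinearity_deriv(1)[OF F] h_partial_u) auto
    have "?f u \<le> ?f s" if "s \<ge> 0" for s
      using amin_le[OF assms(1), of "(s, v)" "(a, b)"] nn that by (simp add: uv W_def)
    note m = deriv_at_min_nonneg[OF d nn(1) this]
    have "u \<noteq> 0"
      using m(2) that nn by (auto simp: nonlinearity_zero[OF F] partial_u_zero)
    then show ?thesis using m(1) nn by simp
  qed
  show "v > 0 \<and> deriv_nn G v + \<epsilon> * partial_v h (u, v) = b" if "b > 0"
  proof -
    let ?f = "\<lambda>s. F u + G s + \<epsilon> * h (u, s) - (a * u + b * s)"
    let ?d = "0 + deriv_nn G v + \<epsilon> * partial_v h (u, v) - (0 + b * 1)"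
    have d: "(?f has_real_derivative ?d) (at v within {0..})"
      using nn by (intro DERIV_diff DERIV_add DERIV_cmult DERIV_const DERIV_ident nonlinearity_deriv(1)[OF G] h_partial_v) auto
    have "?f v \<le> ?f s" if "s \<ge> 0" for s
      using amin_le[OF assms(1), of "(u, s)" "(a, b)"] nn that by (simp add: uv W_def)
    note m = deriv_at_min_nonneg[OF d nn(2) this]
    have "v \<noteq> 0"
      using m(2) that nn by (auto simp: nonlinearity_zero[OF G] partial_v_zero)
    then show ?thesis using m(1) nn by simp
  qed
qed

text \<open>The Legendre transform of \<open>W \<epsilon>\<close> over the quadrant: a supremum of
  functions affine in \<open>c\<close>, hence convex, with \<open>amin \<epsilon> c\<close> as a
  subgradient.\<close>

definition conj_W :: "real \<Rightarrow> real \<times> real \<Rightarrow> real" where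
  "conj_W \<epsilon> c = c \<bullet> amin \<epsilon> c - W \<epsilon> (amin \<epsilon> c)"

lemma conj_W_ge:
  "\<epsilon> \<in> {0..\<epsilon>s} \<Longrightarrow> q \<in> quadrant \<Longrightarrow> c \<bullet> q - W \<epsilon> q \<le> conj_W \<epsilon> c"
  using amin_le[of \<epsilon> q c] by (simp add: conj_W_def)

lemma conj_W_nonneg: "\<epsilon> \<in> {0..\<epsilon>s} \<Longrightarrow> 0 \<le> conj_W \<epsilon> c"
  using amin_value_le by (simp add: conj_W_def)

lemma conj_W_zero:
  assumes "\<epsilon> \<in> {0..\<epsilon>s}" "a \<le> 0" "b \<le> 0"
  shows "conj_W \<epsilon> (a, b) = 0"
proof -
  have "amin \<epsilon> (a, b) = (0, 0)"
    using amin_zero[OF assms(1)] assms(2,3) by (simp add: prod_eq_iff)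
  then show ?thesis by (simp add: conj_W_def W_zero flip: zero_prod_def)
qed

lemma conj_W_subgradient:
  assumes "\<epsilon> \<in> {0..\<epsilon>s}"
  shows "conj_W \<epsilon> c + (c' - c) \<bullet> amin \<epsilon> c \<le> conj_W \<epsilon> c'"
  using conj_W_ge[OF assms amin_quadrant[OF assms, of c], of c']
  by (simp add: conj_W_def inner_diff_left)

lemma conj_W_continuous:
  assumes "\<epsilon> \<in> {0..\<epsilon>s}"
  shows "continuous_on UNIV (conj_W \<epsilon>)"
proof -
  have "range (amin \<epsilon>) \<subseteq> quadrant" using amin_quadrant[OF assms] by blast
  then show ?thesis
    unfolding conj_W_def
    by (intro continuous_intros continuous_on_compose2[OF W_continuous] amin_continuous[OF assms])
qed

lemma conj_W_convex:
  assumes "\<epsilon> \<in> {0..\<epsilon>s}"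
  shows "convex_on UNIV (conj_W \<epsilon>)"
proof (rule convex_onI)
  fix t :: real and c c' :: "real \<times> real"
  assume t: "0 < t" "t < 1"
  let ?m = "(1 - t) *\<^sub>R c + t *\<^sub>R c'"
  let ?p = "amin \<epsilon> ?m"
  have "conj_W \<epsilon> ?m = (1 - t) * (c \<bullet> ?p - W \<epsilon> ?p) + t * (c' \<bullet> ?p - W \<epsilon> ?p)"
    by (simp add: conj_W_def inner_add_left algebra_simps)
  also have "\<dots> \<le> (1 - t) * conj_W \<epsilon> c + t * conj_W \<epsilon> c'"
    using t by (intro add_mono mult_left_mono conj_W_ge assms amin_quadrant) auto
  finally show "conj_W \<epsilon> ?m \<le> (1 - t) * conj_W \<epsilon> c + t * conj_W \<epsilon> c'" .
qed simp

end

section \<open>Multipliers and minimizers of the energy\<close>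

lemma potential_sublevel_compact:
  fixes \<Phi> :: "real^'n \<Rightarrow> real"
  assumes "potential \<Lambda> M \<Phi>" "\<Lambda> > 0"
  shows "compact {x. \<Phi> x \<le> c}"
proof -
  obtain x0 where \<Phi>: "continuous_on UNIV \<Phi>" "\<And>x. \<Lambda> / 2 * (norm (x - x0))\<^sup>2 \<le> \<Phi> x"
    using potential_radial[OF assms] by metis
  have "closed {x. \<Phi> x \<le> c}"
    using \<Phi>(1) by (intro closed_Collect_le continuous_on_const)
  moreover have "{x. \<Phi> x \<le> c} \<subseteq> cball x0 (sqrt (2 * c / \<Lambda>))"
  proof
    fix x assume "x \<in> {x. \<Phi> x \<le> c}"
    then have "\<Lambda> / 2 * (norm (x - x0))\<^sup>2 \<le> c" using \<Phi>(2)[of x] by simp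
    then have "(norm (x - x0))\<^sup>2 \<le> 2 * c / \<Lambda>" using assms(2) by (simp add: field_simps)
    then have "norm (x - x0) \<le> sqrt (2 * c / \<Lambda>)" by (rule real_le_rsqrt)
    then show "x \<in> cball x0 (sqrt (2 * c / \<Lambda>))" by (simp add: dist_norm norm_minus_commute)
  qed
  ultimately show ?thesis
    by (meson bounded_cball bounded_subset compact_eq_bounded_closed)
qed

text \<open>Pulling \<open>x\<close> towards the minimum point lowers the potential strictly, so the
  open sublevel set is dense in the closed one. At the minimum point itself \<open>c > 0\<close> is
  used. This density makes the support the whole closed sublevel set.\<close>

lemma potential_sublevel_closure:
  fixes \<Phi> :: "real^'n \<Rightarrow> real"
  assumes "potential \<Lambda> M \<Phi>" "\<Lambda> > 0" "\<Phi> x \<le> c" "c > 0" "open U" "x \<in> U"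
  shows "\<exists>y\<in>U. \<Phi> y < c"
proof -
  obtain x0 where \<Phi>: "\<Phi> x0 = 0"
    "\<And>x s. x \<noteq> x0 \<Longrightarrow> 0 \<le> s \<Longrightarrow> s < 1 \<Longrightarrow> \<Phi> (x0 + s *\<^sub>R (x - x0)) < \<Phi> x"
    using potential_radial[OF assms(1,2)] by metis
  show ?thesis
  proof (cases "x = x0")
    case True
    then show ?thesis using \<Phi>(1) assms by (intro bexI[of _ x0]) auto
  next
    case False
    have "((\<lambda>s. x0 + s *\<^sub>R (x - x0)) \<longlongrightarrow> x0 + 1 *\<^sub>R (x - x0)) (at_left 1)"
      by (intro tendsto_intros)
    then have "eventually (\<lambda>s. x0 + s *\<^sub>R (x - x0) \<in> U) (at_left 1)"
      by (rule topological_tendstoD) (use assms in auto)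
    moreover have "eventually (\<lambda>s::real. 0 < s \<and> s < 1) (at_left 1)"
      using eventually_at_left_real[of 0 1] by simp
    ultimately have "eventually (\<lambda>s. x0 + s *\<^sub>R (x - x0) \<in> U \<and> 0 < s \<and> s < 1) (at_left 1)"
      by eventually_elim auto
    then obtain s where "x0 + s *\<^sub>R (x - x0) \<in> U" "0 < s" "s < 1"
      using eventually_happens'[of "at_left (1::real)"] by auto
    then show ?thesis
      using \<Phi>(2)[OF False, of s] assms(3) by force
  qed
qed

lemma integrable_continuous_compact_support:
  fixes f :: "'a::euclidean_space \<Rightarrow> real"
  assumes "continuous_on UNIV f" "compact K" "\<And>x. x \<notin> K \<Longrightarrow> f x = 0"
  shows "integrable lborel f"
proof -
  have "integrable lborel (\<lambda>x. indicator K x *\<^sub>R f x)"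
    by (rule borel_integrable_compact[OF assms(2)]) (use assms(1) continuous_on_subset in blast)
  moreover have "(\<lambda>x. indicator K x *\<^sub>R f x) = f"
    using assms(3) by (auto simp: indicator_def fun_eq_iff)
  ultimately show ?thesis by simp
qed

lemma ess_support_cong:
  assumes "AE x in lborel. u x = v x"
  shows "ess_support u = ess_support v"
proof -
  have "(AE y in lborel. y \<in> U \<longrightarrow> u y = 0) \<longleftrightarrow> (AE y in lborel. y \<in> U \<longrightarrow> v y = 0)" for U
    using assms by (intro iffI; elim AE_mp) (auto elim!: AE_mp)
  then show ?thesis by (simp add: ess_support_def)
qed

lemma not_AE_notin_open:
  fixes U :: "'a::euclidean_space set"
  assumes "open U" "U \<noteq> {}"
  shows "\<not> (AE y in lborel. y \<notin> U)"
proof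
  assume ae: "AE y in lborel. y \<notin> U"
  have "U \<in> sets lborel" using assms(1) by simp
  then have "{y \<in> space lborel. \<not> y \<notin> U} = U" by auto
  then have "emeasure lborel U = 0"
    using ae AE_iff_measurable[of U lborel "\<lambda>y. y \<notin> U"] assms(1) by auto
  moreover have "U \<notin> null_sets lebesgue"
    using open_not_negligible[OF assms] by (simp add: negligible_iff_null_sets)
  ultimately show False
    using assms(1) by (metis null_setsI null_sets_completionI sets_lborel borel_open)
qed

lemma ess_support_eq_sublevel:
  fixes P f :: "real^'n \<Rightarrow> real"
  assumes pot: "potential \<Lambda> M P" and \<Lambda>: "\<Lambda> > 0" and "c > 0"
    and pos: "\<And>x. P x < c \<Longrightarrow> f x \<noteq> 0" and zero: "\<And>x. c \<le> P x \<Longrightarrow> f x = 0"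
  shows "ess_support f = {x. P x \<le> c}"
proof
  have cont: "continuous_on UNIV P" using potential_radial[OF pot \<Lambda>] by metis
  show "{x. P x \<le> c} \<subseteq> ess_support f"
    unfolding ess_support_def
  proof (safe)
    fix x U assume "P x \<le> c" and U: "open U" "x \<in> U" and ae: "AE y in lborel. y \<in> U \<longrightarrow> f y = 0"
    let ?V = "U \<inter> {y. P y < c}"
    have "open ?V" using U(1) cont by (intro open_Int open_Collect_less continuous_on_const)
    moreover have "?V \<noteq> {}"
      using potential_sublevel_closure[OF pot \<Lambda> \<open>P x \<le> c\<close> \<open>c > 0\<close> U] by blast
    moreover have "AE y in lborel. y \<notin> ?V"
      using ae by (elim AE_mp) (use pos in \<open>auto intro!: AE_I2\<close>)
    ultimately show False using not_AE_notin_open by blast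
  qed
  show "ess_support f \<subseteq> {x. P x \<le> c}"
  proof
    fix x assume x: "x \<in> ess_support f"
    show "x \<in> {x. P x \<le> c}"
    proof (rule ccontr)
      assume "x \<notin> {x. P x \<le> c}"
      then have "x \<in> {y. c < P y}" by simp
      moreover have "open {y. c < P y}" using cont by (intro open_Collect_less continuous_on_const)
      moreover have "AE y in lborel. y \<in> {y. c < P y} \<longrightarrow> f y = 0"
        using zero by (intro AE_I2) simp
      ultimately show False using x unfolding ess_support_def by blast
    qed
  qed
qed

section \<open>The dual problem for the multipliers\<close>

locale energy_problem = coupled F G h \<epsilon>s
  for F G h \<epsilon>s +
  fixes \<Phi> \<Psi> :: "real^'n \<Rightarrow> real" and \<Lambda> M :: real
  assumes \<Lambda>: "\<Lambda> > 0" and \<Phi>: "potential \<Lambda> M \<Phi>" and \<Psi>: "potential \<Lambda> M \<Psi>"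
begin

lemma \<Phi>_continuous: "continuous_on UNIV \<Phi>" and \<Psi>_continuous: "continuous_on UNIV \<Psi>"
  using potential_radial[OF \<Phi> \<Lambda>] potential_radial[OF \<Psi> \<Lambda>] by metis+

lemma \<Phi>_nonneg: "0 \<le> \<Phi> x" and \<Psi>_nonneg: "0 \<le> \<Psi> x"
  using potential_radial[OF \<Phi> \<Lambda>] potential_radial[OF \<Psi> \<Lambda>] by metis+

definition slack :: "real \<times> real \<Rightarrow> real^'n \<Rightarrow> real \<times> real" where
  "slack C x = (fst C - \<Phi> x, snd C - \<Psi> x)"

definition dens :: "real \<Rightarrow> real \<times> real \<Rightarrow> real^'n \<Rightarrow> real \<times> real" where
  "dens \<epsilon> C x = amin \<epsilon> (slack C x)"

text \<open>One compact set outside which both densities vanish, for all multipliers with components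
  at most \<open>r\<close>. It serves integrability, domination and the final bounds alike.\<close>

definition sublevels :: "real \<Rightarrow> (real^'n) set" where
  "sublevels r = {x. \<Phi> x \<le> r} \<union> {x. \<Psi> x \<le> r}"

lemma compact_sublevels: "compact (sublevels r)"
  unfolding sublevels_def
  by (intro compact_Un potential_sublevel_compact[OF \<Phi> \<Lambda>] potential_sublevel_compact[OF \<Psi> \<Lambda>])

lemma slack_continuous: "continuous_on UNIV (slack C)"
  unfolding slack_def by (intro continuous_intros \<Phi>_continuous \<Psi>_continuous)

lemma dens_continuous: "\<epsilon> \<in> {0..\<epsilon>s} \<Longrightarrow> continuous_on UNIV (dens \<epsilon> C)"
  unfolding dens_def by (intro continuous_on_compose2[OF amin_continuous slack_continuous]) auto

lemma
  assumes "\<epsilon> \<in> {0..\<epsilon>s}" "fst C \<le> r" "snd C \<le> r" "x \<notin> sublevels r"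
  shows dens_outside: "dens \<epsilon> C x = 0" and conj_W_outside: "conj_W \<epsilon> (slack C x) = 0"
proof -
  have neg: "fst C - \<Phi> x \<le> 0" "snd C - \<Psi> x \<le> 0"
    using assms by (auto simp: sublevels_def)
  then show "dens \<epsilon> C x = 0" "conj_W \<epsilon> (slack C x) = 0"
    using amin_zero[OF assms(1)] conj_W_zero[OF assms(1)]
    by (auto simp: dens_def slack_def prod_eq_iff)
qed

lemma
  assumes "\<epsilon> \<in> {0..\<epsilon>s}"
  shows dens_integrable: "integrable lborel (\<lambda>x. fst (dens \<epsilon> C x))" "integrable lborel (\<lambda>x. snd (dens \<epsilon> C x))"
    and dens_moment_integrable: "integrable lborel (\<lambda>x. (norm x)\<^sup>2 * fst (dens \<epsilon> C x))"
      "integrable lborel (\<lambda>x. (norm x)\<^sup>2 * snd (dens \<epsilon> C x))"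
    and conj_W_integrable: "integrable lborel (\<lambda>x. conj_W \<epsilon> (slack C x))"
    and dens_energy_integrable: "integrable lborel (\<lambda>x. W \<epsilon> (dens \<epsilon> C x) +
      (\<Phi> x, \<Psi> x) \<bullet> dens \<epsilon> C x)"
proof -
  define r where "r = max (fst C) (snd C)"
  have r: "fst C \<le> r" "snd C \<le> r" by (auto simp: r_def)
  note I = integrable_continuous_compact_support[OF _ compact_sublevels[of r]]
  note c = dens_continuous[OF assms, of C]
  have range: "range (dens \<epsilon> C) \<subseteq> quadrant"
    unfolding dens_def using amin_quadrant[OF assms] by blast
  have W: "continuous_on UNIV (\<lambda>x. W \<epsilon> (dens \<epsilon> C x))"
    by (rule continuous_on_compose2[OF W_continuous c range])
  show "integrable lborel (\<lambda>x. fst (dens \<epsilon> C x))" "integrable lborel (\<lambda>x. snd (dens \<epsilon> C x))"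
    "integrable lborel (\<lambda>x. (norm x)\<^sup>2 * fst (dens \<epsilon> C x))"
    "integrable lborel (\<lambda>x. (norm x)\<^sup>2 * snd (dens \<epsilon> C x))"
    by (rule I; (intro continuous_intros c)?; simp add: dens_outside[OF assms r])+
  show "integrable lborel (\<lambda>x. conj_W \<epsilon> (slack C x))"
    by (rule I) (auto intro!: continuous_on_compose2[OF conj_W_continuous[OF assms] slack_continuous]
        conj_W_outside[OF assms r])
  show "integrable lborel (\<lambda>x. W \<epsilon> (dens \<epsilon> C x) + (\<Phi> x, \<Psi> x) \<bullet> dens \<epsilon> C x)"
    by (rule I) (auto intro!: continuous_intros W c \<Phi>_continuous \<Psi>_continuous
        simp: dens_outside[OF assms r] W_zero simp del: inner_Pair)
qed

definition mass :: "real \<Rightarrow> real \<times> real \<Rightarrow> real \<times> real" where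
  "mass \<epsilon> C = (\<integral>x. fst (dens \<epsilon> C x) \<partial>lborel, \<integral>x. snd (dens \<epsilon> C x) \<partial>lborel)"

text \<open>The gradient of this concave function at \<open>C\<close> is \<open>(1, 1) - mass \<epsilon> C\<close>; the proofs only use
  the supergradient inequality.\<close>

definition dual :: "real \<Rightarrow> real \<times> real \<Rightarrow> real" where
  "dual \<epsilon> C = fst C + snd C - (\<integral>x. conj_W \<epsilon> (slack C x) \<partial>lborel)"

text \<open>The integral of \<open>conj_W\<close> is a finite convex function on the plane, and such
  functions are continuous.\<close>

lemma dual_continuous:
  assumes "\<epsilon> \<in> {0..\<epsilon>s}"
  shows "continuous_on UNIV (dual \<epsilon>)"
proof -
  have "convex_on UNIV (\<lambda>C. \<integral>x. conj_W \<epsilon> (slack C x) \<partial>lborel)"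
  proof (rule convex_onI)
    fix t :: real and C C' :: "real \<times> real"
    assume t: "0 < t" "t < 1"
    have s: "slack ((1 - t) *\<^sub>R C + t *\<^sub>R C') x = (1 - t) *\<^sub>R slack C x + t *\<^sub>R slack C' x" for x
      by (simp add: slack_def algebra_simps)
    have "(\<integral>x. conj_W \<epsilon> (slack ((1 - t) *\<^sub>R C + t *\<^sub>R C') x) \<partial>lborel) \<le>
        (\<integral>x. (1 - t) * conj_W \<epsilon> (slack C x) + t * conj_W \<epsilon> (slack C' x) \<partial>lborel)"
    proof (rule integral_mono)
      show "conj_W \<epsilon> (slack ((1 - t) *\<^sub>R C + t *\<^sub>R C') x) \<le>
          (1 - t) * conj_W \<epsilon> (slack C x) + t * conj_W \<epsilon> (slack C' x)" for x
        unfolding s using t by (intro convex_onD[OF conj_W_convex[OF assms]]) auto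
    qed (intro conj_W_integrable[OF assms] Bochner_Integration.integrable_add integrable_mult_right)+
    then show "(\<integral>x. conj_W \<epsilon> (slack ((1 - t) *\<^sub>R C + t *\<^sub>R C') x) \<partial>lborel) \<le>
        (1 - t) * (\<integral>x. conj_W \<epsilon> (slack C x) \<partial>lborel) + t * (\<integral>x. conj_W \<epsilon> (slack C' x) \<partial>lborel)"
      using conj_W_integrable[OF assms] by simp
  qed simp
  then have "continuous_on UNIV (\<lambda>C. \<integral>x. conj_W \<epsilon> (slack C x) \<partial>lborel)"
    by (rule convex_on_continuous[OF open_UNIV])
  then show ?thesis
    unfolding dual_def by (intro continuous_intros)
qed

text \<open>The subgradient inequality of \<open>conj_W\<close> is integrated over \<open>x\<close>.
  The mass is taken at the endpoint \<open>C'\<close>, so that a maximum at \<open>C\<close>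
  controls the masses at nearby points.\<close>

lemma dual_increment:
  assumes "\<epsilon> \<in> {0..\<epsilon>s}"
  shows "(C' - C) \<bullet> ((1, 1) - mass \<epsilon> C') \<le> dual \<epsilon> C' - dual \<epsilon> C"
proof -
  note int = dens_integrable[OF assms] conj_W_integrable[OF assms]
  have "(\<integral>x. conj_W \<epsilon> (slack C' x) + ((fst C - fst C') * fst (dens \<epsilon> C' x) + (snd C - snd C') * snd (dens \<epsilon> C' x)) \<partial>lborel)
      \<le> (\<integral>x. conj_W \<epsilon> (slack C x) \<partial>lborel)"
  proof (rule integral_mono)
    fix x
    have "slack C x - slack C' x = C - C'" by (simp add: slack_def prod_eq_iff)
    then have "conj_W \<epsilon> (slack C' x) + (C - C') \<bullet> dens \<epsilon> C' x \<le> conj_W \<epsilon> (slack C x)"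
      using conj_W_subgradient[OF assms, of "slack C' x" "slack C x"] by (simp add: dens_def)
    then show "conj_W \<epsilon> (slack C' x) + ((fst C - fst C') * fst (dens \<epsilon> C' x) + (snd C - snd C') * snd (dens \<epsilon> C' x))
        \<le> conj_W \<epsilon> (slack C x)"
      by (simp add: inner_prod_def)
  qed (intro int Bochner_Integration.integrable_add integrable_mult_right)+
  then have "(\<integral>x. conj_W \<epsilon> (slack C' x) \<partial>lborel) +
      ((fst C - fst C') * fst (mass \<epsilon> C') + (snd C - snd C') * snd (mass \<epsilon> C'))
      \<le> (\<integral>x. conj_W \<epsilon> (slack C x) \<partial>lborel)"
    using int by (simp add: mass_def)
  then show ?thesis
    by (simp add: dual_def inner_prod_def algebra_simps)
qed

lemma dual_zero:
  assumes "\<epsilon> \<in> {0..\<epsilon>s}"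
  shows "dual \<epsilon> 0 = 0"
proof -
  have "conj_W \<epsilon> (slack 0 x) = 0" for x
    using conj_W_zero[OF assms] \<Phi>_nonneg[of x] \<Psi>_nonneg[of x] by (simp add: slack_def)
  then show ?thesis by (simp add: dual_def)
qed

text \<open>Testing \<open>conj_W\<close> with pairs that are constant on a unit ball bounds the
  dual by affine functions of \<open>C\<close>. Four tests, each component being 0 or
  \<open>L\<close>, realize all sign patterns, and the least of these affine functions is the
  bound.\<close>

lemma dual_coercive:
  obtains K where "\<And>\<epsilon> C. \<epsilon> \<in> {0..\<epsilon>s} \<Longrightarrow> dual \<epsilon> C \<le> K - \<bar>fst C\<bar> - \<bar>snd C\<bar>"
proof -
  define B where "B = cball (0 :: real^'n) 1"
  define \<beta> where "\<beta> = measure lborel B"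
  \<comment> \<open>The height \<open>L\<close> on the ball gives mass
    \<open>\<beta> * L = 2\<close>. Since the prescribed mass is 1, test masses 0 and 2 produce the
    slopes 1 and -1.\<close>
  define L where "L = 2 / \<beta>"
  have \<beta>: "\<beta> > 0" unfolding \<beta>_def B_def by (rule content_cball_pos) simp
  then have L: "L > 0" by (simp add: L_def)
  have B: "compact B" "B \<in> sets lborel" "emeasure lborel B < \<infinity>"
    using emeasure_bounded_finite[OF bounded_cball] by (auto simp: B_def)
  obtain S where S: "\<And>x. x \<in> B \<Longrightarrow> \<Phi> x + \<Psi> x \<le> S"
  proof -
    have "continuous_on B (\<lambda>x. \<Phi> x + \<Psi> x)"
      by (intro continuous_intros continuous_on_subset[OF \<Phi>_continuous] continuous_on_subset[OF \<Psi>_continuous]) auto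
    then have "bounded ((\<lambda>x. \<Phi> x + \<Psi> x) ` B)"
      using B(1) by (intro compact_imp_bounded compact_continuous_image)
    then show thesis using that unfolding bounded_iff by (force simp: abs_le_iff)
  qed
  \<comment> \<open>Covers the cost of each of the four tests per unit volume: potential energy at
    most \<open>S * L\<close>, and \<open>W\<close> with the constant 3/2 of
    \<open>W_bounds\<close>.\<close>
  define \<kappa> where "\<kappa> = S * L + 3 / 2 * F L + 3 / 2 * G L"
  have key: "dual \<epsilon> C \<le> fst C * (1 - \<beta> * u) + snd C * (1 - \<beta> * v) + \<beta> * \<kappa>"
    if e: "\<epsilon> \<in> {0..\<epsilon>s}" and uv: "u \<in> {0, L}" "v \<in> {0, L}" for \<epsilon> C u v
  proof -
    have q: "(u, v) \<in> quadrant" "0 \<le> u" "u \<le> L" "0 \<le> v" "v \<le> L" using uv L by auto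
    have FG: "F u \<le> F L" "G v \<le> G L"
      using uv L nonlinearity_zero[OF F] nonlinearity_zero[OF G] nonlinearity_nonneg[OF F, of L] nonlinearity_nonneg[OF G, of L]
      by auto
    have "(\<integral>x. (fst C * u + snd C * v - \<kappa>) * indicator B x \<partial>lborel) \<le> (\<integral>x. conj_W \<epsilon> (slack C x) \<partial>lborel)"
    proof (rule integral_mono)
      show "integrable lborel (\<lambda>x. (fst C * u + snd C * v - \<kappa>) * indicator B x)"
        using B by (intro integrable_mult_right integrable_real_indicator) auto
      show "integrable lborel (\<lambda>x. conj_W \<epsilon> (slack C x))" by (rule conj_W_integrable[OF e])
      show "(fst C * u + snd C * v - \<kappa>) * indicator B x \<le> conj_W \<epsilon> (slack C x)" for x
      proof (cases "x \<in> B")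
        case True
        have "\<Phi> x * u + \<Psi> x * v \<le> \<Phi> x * L + \<Psi> x * L"
          using q \<Phi>_nonneg \<Psi>_nonneg by (intro add_mono mult_left_mono) auto
        also have "\<dots> \<le> S * L"
          using S[OF True] L by (metis distrib_right less_imp_le mult_right_mono)
        finally have "\<Phi> x * u + \<Psi> x * v \<le> S * L" .
        moreover have "slack C x \<bullet> (u, v) - W \<epsilon> (u, v) \<le> conj_W \<epsilon> (slack C x)"
          by (rule conj_W_ge[OF e q(1)])
        moreover have "slack C x \<bullet> (u, v) = fst C * u + snd C * v - (\<Phi> x * u + \<Psi> x * v)"
          by (simp add: slack_def algebra_simps)
        moreover have "2 * W \<epsilon> (u, v) \<le> 3 * F L + 3 * G L"
          using W_bounds(2)[OF e q(1)] FG by simp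
        ultimately have "fst C * u + snd C * v - \<kappa> \<le> conj_W \<epsilon> (slack C x)"
          unfolding \<kappa>_def by linarith
        then show ?thesis using True by simp
      qed (simp add: conj_W_nonneg[OF e])
    qed
    moreover have "(\<integral>x. (fst C * u + snd C * v - \<kappa>) * indicator B x \<partial>lborel) = (fst C * u + snd C * v - \<kappa>) * \<beta>"
      by (simp add: \<beta>_def)
    ultimately show ?thesis
      by (simp add: dual_def algebra_simps)
  qed
  have bL: "\<beta> * L = 2" using \<beta> by (simp add: L_def)
  show thesis
  proof (rule that[of "\<beta> * \<kappa>"])
    fix \<epsilon> and C :: "real \<times> real" assume e: "\<epsilon> \<in> {0..\<epsilon>s}"
    have "dual \<epsilon> C \<le> \<beta> * \<kappa> + fst C + snd C" "dual \<epsilon> C \<le> \<beta> * \<kappa> + fst C - snd C"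
      "dual \<epsilon> C \<le> \<beta> * \<kappa> - fst C + snd C" "dual \<epsilon> C \<le> \<beta> * \<kappa> - fst C - snd C"
      using key[OF e, of 0 0 C] key[OF e, of 0 L C] key[OF e, of L 0 C] key[OF e, of L L C]
      by (simp_all add: bL)
    then show "dual \<epsilon> C \<le> \<beta> * \<kappa> - \<bar>fst C\<bar> - \<bar>snd C\<bar>"
      by (simp add: abs_if)
  qed
qed

text \<open>Bounded multipliers confine the supports to one compact set, and there the linear growth
  of \<open>amin\<close> supplies an integrable majorant.\<close>

lemma mass_sequentially:
  assumes "\<epsilon> \<in> {0..\<epsilon>s}" and lim: "X \<longlonglongrightarrow> C"
  shows "(\<lambda>n. mass \<epsilon> (X n)) \<longlonglongrightarrow> mass \<epsilon> C"
proof -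
  obtain R where R: "\<And>n. norm (X n) \<le> R"
    using convergent_imp_Bseq[of X] lim unfolding Bseq_def convergent_def by blast
  have le_R: "fst (X n) \<le> R" "snd (X n) \<le> R" for n
    using R[of n] norm_fst_le[of "fst (X n)" "snd (X n)"] norm_snd_le[of "snd (X n)" "fst (X n)"] by auto
  obtain A B where AB: "A \<ge> 0" "B \<ge> 0" "\<And>c. norm (amin \<epsilon> c) \<le> A + B * norm c"
    using amin_bound assms(1) by metis
  define w where "w x = indicator (sublevels R) x *\<^sub>R (A + B * (R + norm (\<Phi> x, \<Psi> x)))" for x
  have w: "integrable lborel w"
    unfolding w_def
    by (intro borel_integrable_compact compact_sublevels continuous_intros
        continuous_on_subset[OF \<Phi>_continuous] continuous_on_subset[OF \<Psi>_continuous]) auto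
  have dom: "norm (dens \<epsilon> (X n) x) \<le> w x" for n x
  proof (cases "x \<in> sublevels R")
    case True
    have "slack (X n) x = X n - (\<Phi> x, \<Psi> x)" by (simp add: slack_def prod_eq_iff)
    then have "norm (slack (X n) x) \<le> R + norm (\<Phi> x, \<Psi> x)"
      using R[of n] norm_triangle_ineq4[of "X n" "(\<Phi> x, \<Psi> x)"] by simp
    then have "B * norm (slack (X n) x) \<le> B * (R + norm (\<Phi> x, \<Psi> x))"
      using AB(2) by (rule mult_left_mono)
    then show ?thesis
      using AB(3)[of "slack (X n) x"] True by (simp add: w_def dens_def)
  next
    case False
    then show ?thesis using dens_outside[OF assms(1) le_R] by (simp add: w_def)
  qed
  have pt: "(\<lambda>n. dens \<epsilon> (X n) x) \<longlonglongrightarrow> dens \<epsilon> C x" for x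
  proof -
    have "(\<lambda>n. slack (X n) x) \<longlonglongrightarrow> slack C x"
      unfolding slack_def using lim by (intro tendsto_intros)
    then show ?thesis
      unfolding dens_def by (rule continuous_on_tendsto_compose[OF amin_continuous[OF assms(1)]]) auto
  qed
  have meas: "(\<lambda>x. fst (dens \<epsilon> C x)) \<in> borel_measurable lborel" "(\<lambda>x. snd (dens \<epsilon> C x)) \<in> borel_measurable lborel" for C
    using dens_integrable[OF assms(1)] by auto
  have nf: "norm (fst p) \<le> norm p" "norm (snd p) \<le> norm p" for p :: "real \<times> real"
    using norm_fst_le[of "fst p" "snd p"] norm_snd_le[of "snd p" "fst p"] by auto
  have "(\<lambda>n. \<integral>x. fst (dens \<epsilon> (X n) x) \<partial>lborel) \<longlonglongrightarrow> (\<integral>x. fst (dens \<epsilon> C x) \<partial>lborel)"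
    by (rule integral_dominated_convergence[where w=w])
       (use meas w tendsto_fst[OF pt] order_trans[OF nf(1) dom] in auto)
  moreover have "(\<lambda>n. \<integral>x. snd (dens \<epsilon> (X n) x) \<partial>lborel) \<longlonglongrightarrow> (\<integral>x. snd (dens \<epsilon> C x) \<partial>lborel)"
    by (rule integral_dominated_convergence[where w=w])
       (use meas w tendsto_snd[OF pt] order_trans[OF nf(2) dom] in auto)
  ultimately show ?thesis
    unfolding mass_def by (rule tendsto_Pair)
qed

text \<open>Differentiability of \<open>dual\<close> is bypassed. Applied between \<open>C\<close>
  and \<open>C + s *\<^sub>R d\<close>, the supergradient inequality gives the mass defect at the
  shifted point a sign in direction \<open>d\<close>, and continuity of the mass lets
  \<open>s\<close> tend to 0.\<close>

lemma mass_at_dual_max: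
  assumes e: "\<epsilon> \<in> {0..\<epsilon>s}" and max: "\<And>C'. dual \<epsilon> C' \<le> dual \<epsilon> C"
  shows "mass \<epsilon> C = (1, 1)"
proof -
  have dir: "0 \<le> s * (d \<bullet> (mass \<epsilon> (C + s *\<^sub>R d) - (1, 1)))" for s d
  proof -
    have "(s *\<^sub>R d) \<bullet> ((1, 1) - mass \<epsilon> (C + s *\<^sub>R d)) \<le> 0"
      using dual_increment[OF e, of "C + s *\<^sub>R d" C] max[of "C + s *\<^sub>R d"] by simp
    then show ?thesis by (simp add: inner_diff_right algebra_simps)
  qed
  have zero: "d \<bullet> (mass \<epsilon> C - (1, 1)) \<ge> 0" for d
  proof (rule LIMSEQ_le_const)
    let ?s = "\<lambda>n. 1 / real (Suc n)"
    have "?s \<longlonglongrightarrow> 0" using LIMSEQ_inverse_real_of_nat by (simp add: inverse_eq_divide)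
    then have "(\<lambda>n. C + ?s n *\<^sub>R d) \<longlonglongrightarrow> C + 0 *\<^sub>R d" by (intro tendsto_intros)
    then have "(\<lambda>n. mass \<epsilon> (C + ?s n *\<^sub>R d)) \<longlonglongrightarrow> mass \<epsilon> C"
      using mass_sequentially[OF e] by simp
    then show "(\<lambda>n. d \<bullet> (mass \<epsilon> (C + ?s n *\<^sub>R d) - (1, 1))) \<longlonglongrightarrow> d \<bullet> (mass \<epsilon> C - (1, 1))"
      by (intro tendsto_intros)
    have "0 \<le> d \<bullet> (mass \<epsilon> (C + ?s n *\<^sub>R d) - (1, 1))" for n
      using dir[of "?s n" d] by (simp add: zero_le_mult_iff zero_le_divide_iff)
    then show "\<exists>N. \<forall>n\<ge>N. 0 \<le> d \<bullet> (mass \<epsilon> (C + ?s n *\<^sub>R d) - (1, 1))" by blast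
  qed
  \<comment> \<open>The direction opposite to the defect bounds its squared norm by 0.\<close>
  have "(mass \<epsilon> C - (1, 1)) \<bullet> (mass \<epsilon> C - (1, 1)) = 0"
    using zero[of "- (mass \<epsilon> C - (1, 1))"] inner_ge_zero[of "mass \<epsilon> C - (1, 1)"]
    by (simp only: inner_minus_left)
  then show ?thesis by simp
qed

text \<open>As the dual is 0 at the origin, coercivity confines the points where it is nonnegative
  to a ball of radius \<open>K\<close> independent of \<open>\<epsilon>\<close>, and the maximum
  over this ball is global.\<close>

lemma multipliers_exist:
  obtains K where "\<And>\<epsilon>. \<epsilon> \<in> {0..\<epsilon>s} \<Longrightarrow> \<exists>C. norm C \<le> K \<and> mass \<epsilon> C = (1, 1)"
proof -
  obtain K where K: "\<And>\<epsilon> C. \<epsilon> \<in> {0..\<epsilon>s} \<Longrightarrow> dual \<epsilon> C \<le> K - \<bar>fst C\<bar> - \<bar>snd C\<bar>"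
    by (rule dual_coercive) blast
  have "\<exists>C. norm C \<le> K \<and> mass \<epsilon> C = (1, 1)" if e: "\<epsilon> \<in> {0..\<epsilon>s}" for \<epsilon>
  proof -
    have K0: "0 \<le> K" using K[OF e, of 0] dual_zero[OF e] by simp
    have "continuous_on (cball 0 K) (dual \<epsilon>)"
      using dual_continuous[OF e] continuous_on_subset by blast
    then obtain C where C: "C \<in> cball 0 K" "\<And>C'. C' \<in> cball 0 K \<Longrightarrow> dual \<epsilon> C' \<le> dual \<epsilon> C"
      using continuous_attains_sup[of "cball 0 K" "dual \<epsilon>"] K0 by auto
    have "dual \<epsilon> C' \<le> dual \<epsilon> C" for C'
    proof (cases "C' \<in> cball 0 K")
      case False
      then have "K < \<bar>fst C'\<bar> + \<bar>snd C'\<bar>"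
        using norm_Pair_le[of "fst C'" "snd C'"] by simp
      then have "dual \<epsilon> C' \<le> 0" using K[OF e, of C'] by simp
      also have "0 \<le> dual \<epsilon> C" using C(2)[of 0] dual_zero[OF e] K0 by simp
      finally show ?thesis .
    qed (rule C(2))
    then have "mass \<epsilon> C = (1, 1)" by (rule mass_at_dual_max[OF e])
    then show ?thesis
      using C(1) by (intro exI[of _ C]) simp
  qed
  then show thesis using that by blast
qed

section \<open>Optimality and uniqueness of the constructed densities\<close>

lemma energy_eq:
  "energy F G \<Phi> \<Psi> h \<epsilon> u v = (\<integral>\<^sup>+ x. ennreal (W \<epsilon> (u x, v x) + (\<Phi> x, \<Psi> x) \<bullet> (u x, v x)) \<partial>lborel)"
  unfolding energy_def W_def by (intro nn_integral_cong) (simp add: algebra_simps)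

context
  fixes \<epsilon> :: real and C :: "real \<times> real"
  assumes e: "\<epsilon> \<in> {0..\<epsilon>s}" and mass: "mass \<epsilon> C = (1, 1)"
begin

abbreviation "ubar x \<equiv> fst (dens \<epsilon> C x)"
abbreviation "vbar x \<equiv> snd (dens \<epsilon> C x)"

lemma dens_P2r: "ubar \<in> P2r" "vbar \<in> P2r"
proof -
  have "has_bochner_integral lborel ubar 1" "has_bochner_integral lborel vbar 1"
    using mass dens_integrable[OF e] by (auto simp: has_bochner_integral_iff mass_def)
  moreover have "0 \<le> ubar x" "0 \<le> vbar x" for x
    using amin_nonneg[OF e] by (auto simp: dens_def)
  ultimately show "ubar \<in> P2r" "vbar \<in> P2r"
    using dens_moment_integrable[OF e] dens_integrable[OF e] unfolding P2r_def by auto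
qed

lemma dens_minimizes:
  assumes u: "u \<in> P2r" and v: "v \<in> P2r"
  shows "energy F G \<Phi> \<Psi> h \<epsilon> ubar vbar \<le> energy F G \<Phi> \<Psi> h \<epsilon> u v"
    and "energy F G \<Phi> \<Psi> h \<epsilon> u v \<le> energy F G \<Phi> \<Psi> h \<epsilon> ubar vbar \<Longrightarrow>
      (AE x in lborel. u x = ubar x \<and> v x = vbar x)"
proof -
  define I where "I p x = W \<epsilon> p + (\<Phi> x, \<Psi> x) \<bullet> p" for p x
  let ?E = "energy F G \<Phi> \<Psi> h \<epsilon>"
  let ?p = "\<lambda>x. (u x, v x)"
  have uv: "?p x \<in> quadrant" for x using u v by (simp add: P2r_def)
  have I_nonneg: "0 \<le> I p x" if "p \<in> quadrant" for p x
    using W_nonneg[OF e that] that \<Phi>_nonneg[of x] \<Psi>_nonneg[of x]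
    by (auto simp: I_def inner_prod_def mem_Times_iff)
  have quad: "dens \<epsilon> C x \<in> quadrant" for x
    unfolding dens_def by (rule amin_quadrant[OF e])
  have I0_int: "integrable lborel (\<lambda>x. I (dens \<epsilon> C x) x)"
    unfolding I_def by (rule dens_energy_integrable[OF e])
  have E0: "?E ubar vbar = ennreal (\<integral>x. I (dens \<epsilon> C x) x \<partial>lborel)"
    unfolding energy_eq prod.collapse I_def[symmetric]
    by (rule nn_integral_eq_integral[OF I0_int]) (simp add: I_nonneg quad)
  have umeas[measurable]: "u \<in> borel_measurable lborel" "v \<in> borel_measurable lborel"
    using u v by (auto simp: P2r_def)
  have uint: "integrable lborel u" "integrable lborel v"
    "(\<integral>x. u x \<partial>lborel) = 1" "(\<integral>x. v x \<partial>lborel) = 1"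
    using u v by (auto simp: P2r_def has_bochner_integral_iff)
  have mass1: "(\<integral>x. ubar x \<partial>lborel) = 1" "(\<integral>x. vbar x \<partial>lborel) = 1"
    using mass by (auto simp: mass_def)
  have Wmeas: "(\<lambda>x. W \<epsilon> (?p x)) \<in> borel_measurable lborel"
  proof -
    \<comment> \<open>Continuity of \<open>W\<close> is known on the quadrant only, so it is cut off
      before composing with the densities.\<close>
    have "(\<lambda>p. indicator quadrant p *\<^sub>R W \<epsilon> p) \<in> borel_measurable borel"
      by (intro borel_measurable_continuous_on_indicator W_continuous) (simp add: borel_closed closed_Times)
    then have "(\<lambda>x. indicator quadrant (?p x) *\<^sub>R W \<epsilon> (?p x)) \<in> borel_measurable lborel"
      by (rule measurable_compose[rotated]) simp
    then show ?thesis using uv by (simp add: indicator_def del: mem_Times_iff)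
  qed
  have [measurable]: "\<Phi> \<in> borel_measurable lborel" "\<Psi> \<in> borel_measurable lborel"
    using borel_measurable_continuous_onI[OF \<Phi>_continuous] borel_measurable_continuous_onI[OF \<Psi>_continuous] by auto
  have Imeas: "(\<lambda>x. I (?p x) x) \<in> borel_measurable lborel"
    unfolding I_def inner_Pair using Wmeas by simp
  \<comment> \<open>The excess of the tilted integrand over its pointwise minimum. The subtracted
    linear term integrates to 0, because all four densities have mass 1, so the integral of
    \<open>gap\<close> is the difference of the energies whenever \<open>?E u v\<close> is
    finite.\<close>
  define gap where "gap x = I (?p x) x - I (dens \<epsilon> C x) x
      - (fst C * (u x - ubar x) + snd C * (v x - vbar x))" for x
  have gap_eq: "gap x = (W \<epsilon> (?p x) - slack C x \<bullet> ?p x) - (W \<epsilon> (dens \<epsilon> C x) - slack C x \<bullet> dens \<epsilon> C x)" for x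
    by (simp add: gap_def I_def slack_def inner_prod_def algebra_simps)
  have gap_nonneg: "0 \<le> gap x" for x
    unfolding gap_eq using amin_le[OF e uv[of x], of "slack C x"] by (simp add: dens_def)
  have fin: "integrable lborel (\<lambda>x. I (?p x) x)" "?E u v = ennreal (\<integral>x. I (?p x) x \<partial>lborel)"
    "integrable lborel gap"
    "(\<integral>x. gap x \<partial>lborel) = (\<integral>x. I (?p x) x \<partial>lborel) - (\<integral>x. I (dens \<epsilon> C x) x \<partial>lborel)"
    if "?E u v < \<infinity>"
  proof -
    show int: "integrable lborel (\<lambda>x. I (?p x) x)"
      using that unfolding energy_eq I_def[symmetric]
      by (intro integrableI_nonneg Imeas) (auto simp: I_nonneg[OF uv])
    show "?E u v = ennreal (\<integral>x. I (?p x) x \<partial>lborel)"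
      unfolding energy_eq I_def[symmetric]
      by (rule nn_integral_eq_integral[OF int]) (simp add: I_nonneg[OF uv])
    show "integrable lborel gap"
      unfolding gap_def
      by (intro Bochner_Integration.integrable_diff Bochner_Integration.integrable_add
          integrable_mult_right int I0_int uint dens_integrable[OF e])
    show "(\<integral>x. gap x \<partial>lborel) = (\<integral>x. I (?p x) x \<partial>lborel) - (\<integral>x. I (dens \<epsilon> C x) x \<partial>lborel)"
      unfolding gap_def using int I0_int uint dens_integrable[OF e] mass1 by simp
  qed
  have int0: "0 \<le> (\<integral>x. I (dens \<epsilon> C x) x \<partial>lborel)"
    by (intro integral_nonneg_AE) (simp add: I_nonneg quad)
  show "?E ubar vbar \<le> ?E u v"
  proof (cases "?E u v < \<infinity>")
    case True
    have "0 \<le> (\<integral>x. gap x \<partial>lborel)" by (intro integral_nonneg_AE) (simp add: gap_nonneg)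
    then show ?thesis
      unfolding E0 fin(2)[OF True] fin(4)[OF True] by (simp add: ennreal_leI)
  next
    case False
    then have "?E u v = \<infinity>" by (simp add: not_less top_unique)
    then show ?thesis by simp
  qed
  show "AE x in lborel. u x = ubar x \<and> v x = vbar x" if le: "?E u v \<le> ?E ubar vbar"
  proof -
    have lt: "?E u v < \<infinity>" using le E0 by (simp add: order_le_less_trans)
    have "(\<integral>x. I (?p x) x \<partial>lborel) \<le> (\<integral>x. I (dens \<epsilon> C x) x \<partial>lborel)"
      using le int0 unfolding E0 fin(2)[OF lt] by simp
    then have "(\<integral>x. gap x \<partial>lborel) = 0"
      using fin(4)[OF lt] integral_nonneg_AE[of gap lborel] gap_nonneg by auto
    then have "AE x in lborel. gap x = 0"
      using integral_nonneg_eq_0_iff_AE[OF fin(3)[OF lt]] gap_nonneg by simp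
    moreover have "?p x = dens \<epsilon> C x" if "gap x = 0" for x
      unfolding dens_def using that unfolding gap_eq dens_def
      by (intro amin_eqI[OF e uv]) simp
    ultimately show ?thesis
      by (elim AE_mp) (auto intro!: AE_I2 simp: prod_eq_iff)
  qed
qed

lemma dens_is_minimizer: "is_minimizer (energy F G \<Phi> \<Psi> h \<epsilon>) ubar vbar"
  using dens_P2r dens_minimizes(1) by (simp add: is_minimizer_def)

lemma minimizer_eq_dens:
  assumes "is_minimizer (energy F G \<Phi> \<Psi> h \<epsilon>) u v"
  shows "AE x in lborel. u x = ubar x" "AE x in lborel. v x = vbar x"
proof -
  have "AE x in lborel. u x = ubar x \<and> v x = vbar x"
    using assms dens_P2r by (intro dens_minimizes(2)) (auto simp: is_minimizer_def)
  then show "AE x in lborel. u x = ubar x" "AE x in lborel. v x = vbar x"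
    by (auto elim: AE_mp)
qed

text \<open>Potentials are nonnegative, so a nonpositive multiplier would leave no positive slack
  anywhere and give mass 0.\<close>

lemma multiplier_pos: "fst C > 0" "snd C > 0"
proof -
  show "fst C > 0"
  proof (rule ccontr)
    assume "\<not> fst C > 0"
    then have "ubar x = 0" for x
      unfolding dens_def slack_def using \<Phi>_nonneg[of x] by (intro amin_zero(1)[OF e]) auto
    then show False using mass by (simp add: mass_def)
  qed
  show "snd C > 0"
  proof (rule ccontr)
    assume "\<not> snd C > 0"
    then have "vbar x = 0" for x
      unfolding dens_def slack_def using \<Psi>_nonneg[of x] by (intro amin_zero(2)[OF e]) auto
    then show False using mass by (simp add: mass_def)
  qed
qed

lemma ess_support_dens: "ess_support ubar = {x. \<Phi> x \<le> fst C}" "ess_support vbar = {x. \<Psi> x \<le> snd C}"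
proof -
  show "ess_support ubar = {x. \<Phi> x \<le> fst C}"
  proof (rule ess_support_eq_sublevel[OF \<Phi> \<Lambda> multiplier_pos(1)])
    show "ubar x \<noteq> 0" if "\<Phi> x < fst C" for x
      using amin_stationary(1)[OF e, of "fst C - \<Phi> x" "snd C - \<Psi> x" "ubar x" "vbar x"] that
      by (simp add: dens_def slack_def)
    show "ubar x = 0" if "fst C \<le> \<Phi> x" for x
      unfolding dens_def slack_def using that by (intro amin_zero(1)[OF e]) simp
  qed
  show "ess_support vbar = {x. \<Psi> x \<le> snd C}"
  proof (rule ess_support_eq_sublevel[OF \<Psi> \<Lambda> multiplier_pos(2)])
    show "vbar x \<noteq> 0" if "\<Psi> x < snd C" for x
      using amin_stationary(2)[OF e, of "fst C - \<Phi> x" "snd C - \<Psi> x" "ubar x" "vbar x"] that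
      by (simp add: dens_def slack_def)
    show "vbar x = 0" if "snd C \<le> \<Psi> x" for x
      unfolding dens_def slack_def using that by (intro amin_zero(2)[OF e]) simp
  qed
qed

end

end

section \<open>Regularity on the support\<close>

text \<open>Vanishing of the derivatives on the frontier makes the extended ones continuous. It
  remains to see that they are derivatives of each other at frontier points, where
  \<open>has_partials\<close> on the quadrant asserts nothing.\<close>

lemma zero_extension_quadrant:
  assumes "Ck_vanishing_on_frontier k quadrant \<theta>"
  obtains E where "has_partials k UNIV (E []) E" "\<And>p. p \<in> quadrant \<Longrightarrow> E [] p = \<theta> p"
    "\<And>bs p. set bs \<subseteq> Basis \<Longrightarrow> length bs \<le> k \<Longrightarrow> p \<notin> open_quadrant \<Longrightarrow> E bs p = 0"
proof -
  obtain D where D: "has_partials k quadrant \<theta> D"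
    and van: "\<And>bs p. set bs \<subseteq> Basis \<Longrightarrow> length bs \<le> k \<Longrightarrow> p \<in> frontier quadrant \<Longrightarrow> D bs p = 0"
    using assms by (auto simp: Ck_vanishing_on_frontier_def)
  define E where "E bs p = (if p \<in> quadrant then D bs p else 0)" for bs p
  have zero: "E bs p = 0" if "set bs \<subseteq> Basis" "length bs \<le> k" "p \<notin> open_quadrant" for bs p
    using that van[OF that(1,2), of p] by (auto simp: E_def frontier_quadrant)
  have cont: "continuous_on UNIV (E bs)" if bs: "set bs \<subseteq> Basis" "length bs \<le> k" for bs
  proof -
    have "continuous_on (quadrant \<union> - open_quadrant) (\<lambda>p. if p \<in> quadrant then D bs p else 0)"
    proof (rule continuous_on_If)
      show "closed quadrant" "closed (- open_quadrant)"
        using open_open_quadrant by (auto intro: closed_Times)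
      show "continuous_on quadrant (D bs)"
        using D bs unfolding has_partials_def by blast
      show "D bs p = 0" if "p \<in> - open_quadrant" "p \<in> quadrant" for p
        using van[OF bs] that by (simp add: frontier_quadrant)
    qed auto
    moreover have "quadrant \<union> - open_quadrant = UNIV" by auto
    ultimately show ?thesis unfolding E_def by simp
  qed
  have off: "((\<lambda>t. E bs (p + t *\<^sub>R b)) has_real_derivative E (b # bs) p) (at 0)"
    if bs: "set bs \<subseteq> Basis" "length bs < k" "b \<in> Basis" and p: "p \<notin> frontier quadrant" for bs b p
  proof -
    have line: "((\<lambda>t. p + t *\<^sub>R b) \<longlongrightarrow> p + 0 *\<^sub>R b) (nhds 0)"
      by (intro tendsto_intros filterlim_ident)
    show ?thesis
    proof (cases "p \<in> quadrant")
      case True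
      then have po: "p \<in> open_quadrant" using p by (simp add: frontier_quadrant)
      have "eventually (\<lambda>t. p + t *\<^sub>R b \<in> open_quadrant) (nhds 0)"
        using line by (rule topological_tendstoD) (use open_open_quadrant po in auto)
      then have ev: "eventually (\<lambda>t. D bs (p + t *\<^sub>R b) = E bs (p + t *\<^sub>R b)) (nhds 0)"
        by eventually_elim (auto simp: E_def)
      have "((\<lambda>t. D bs (p + t *\<^sub>R b)) has_real_derivative D (b # bs) p) (at 0)"
        using D bs po unfolding has_partials_def interior_quadrant by blast
      then show ?thesis
        using DERIV_cong_ev[OF refl ev refl] True by (simp add: E_def)
    next
      case False
      have "open (- quadrant)" by (intro open_Compl closed_Times closed_atLeast)
      with line have "eventually (\<lambda>t. p + t *\<^sub>R b \<in> - quadrant) (nhds 0)"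
        by (rule topological_tendstoD) (use False in auto)
      then have ev: "eventually (\<lambda>t. 0 = E bs (p + t *\<^sub>R b)) (nhds 0)"
        by eventually_elim (auto simp: E_def)
      show ?thesis
        using DERIV_cong_ev[OF refl ev refl, of 0] False by (simp add: E_def)
    qed
  qed
  have deriv: "((\<lambda>t. E bs (p + t *\<^sub>R b)) has_real_derivative E (b # bs) p) (at 0)"
    if bs: "set bs \<subseteq> Basis" "length bs < k" "b \<in> Basis" for bs b p
  proof -
    have bbs: "set (b # bs) \<subseteq> Basis" "length (b # bs) \<le> k" using bs by auto
    have b: "b = (1, 0) \<or> b = (0, 1)" using bs(3) by (auto simp: Basis_prod_def)
    \<comment> \<open>A coordinate line through a frontier point either misses the open quadrant, so
      that the extension vanishes along it, or meets the frontier at that point only, so that the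
      derivative is a limit from both sides.\<close>
    consider "\<And>t. p + t *\<^sub>R b \<notin> open_quadrant" | "\<And>t. t \<noteq> 0 \<Longrightarrow> p + t *\<^sub>R b \<notin> frontier quadrant"
      | "p \<notin> frontier quadrant"
    proof -
      obtain x y where p: "p = (x, y)" by (cases p)
      show thesis
      proof (cases "p \<in> frontier quadrant")
        case False
        then show thesis by (rule that(3))
      next
        case True
        show thesis
        proof (cases "\<exists>t. p + t *\<^sub>R b \<in> open_quadrant")
          case False
          show thesis by (rule that(1)) (use False in metis)
        next
          case ex: True
          have "p + t *\<^sub>R b \<notin> frontier quadrant" if "t \<noteq> 0" for t
            using True ex b that by (auto simp: p frontier_quadrant)
          then show thesis by (rule that(2))
        qed
      qed
    qed
    then show ?thesis
    proof cases
      case 1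
      have "E bs (p + t *\<^sub>R b) = 0" for t using zero[of bs] bs 1[of t] by simp
      moreover have "E (b # bs) p = 0" using zero[OF bbs] 1[of 0] by simp
      ultimately show ?thesis by simp
    next
      case 2
      have line: "continuous_on UNIV (\<lambda>t. p + t *\<^sub>R b)" by (intro continuous_intros)
      have "((\<lambda>t. E bs (p + t *\<^sub>R b)) has_real_derivative E (b # bs) (p + 0 *\<^sub>R b)) (at 0 within UNIV)"
      proof (rule has_real_derivative_limit[where g="\<lambda>t. E (b # bs) (p + t *\<^sub>R b)"])
        show "continuous_on UNIV (\<lambda>t. E bs (p + t *\<^sub>R b))"
          using bs by (intro continuous_on_compose2[OF cont line]) auto
        have "continuous_on UNIV (\<lambda>t. E (b # bs) (p + t *\<^sub>R b))"
          by (intro continuous_on_compose2[OF cont[OF bbs] line]) auto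
        then show "continuous (at 0 within UNIV) (\<lambda>t. E (b # bs) (p + t *\<^sub>R b))"
          by (simp add: continuous_on_eq_continuous_within)
        show "((\<lambda>t. E bs (p + t *\<^sub>R b)) has_real_derivative E (b # bs) (p + t *\<^sub>R b)) (at t)"
          if "t \<in> UNIV - {0}" for t
          by (rule has_real_derivative_line, rule off[OF bs 2]) (use that in auto)
      qed auto
      then show ?thesis by simp
    next
      case 3
      then show ?thesis using off[OF bs] by simp
    qed
  qed
  show thesis
  proof (rule that[of E])
    show "has_partials k UNIV (E []) E"
      using cont deriv by (auto simp: has_partials_def)
    show "E [] p = \<theta> p" if "p \<in> quadrant" for p
    proof -
      have "D [] p = \<theta> p" using D that unfolding has_partials_def by metis
      then show ?thesis using that unfolding E_def by argo
    qed
  qed (rule zero)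
qed

text \<open>Adding the tangent inequalities at 0 and \<open>y\<close> shows that \<open>f'\<close>
  is monotone relative to 0, so its difference quotients at 0 are nonnegative.\<close>

lemma convex_second_derivative_nonneg:
  fixes f f' :: "real \<Rightarrow> real"
  assumes "convex_on {-r<..<r} f" "r > 0"
    and f': "\<And>x. x \<in> {-r<..<r} \<Longrightarrow> (f has_real_derivative f' x) (at x)"
    and f'': "(f' has_real_derivative d) (at 0)"
  shows "0 \<le> d"
proof (rule tendsto_lowerbound)
  show "((\<lambda>y. (f' y - f' 0) / (y - 0)) \<longlongrightarrow> d) (at 0)"
    using f'' by (simp add: has_field_derivative_iff)
  have "0 \<le> (f' y - f' 0) / (y - 0)" if y: "y \<in> {-r<..<r}" for y
  proof -
    have tangent: "f' x * (z - x) \<le> f z - f x" if "x \<in> {-r<..<r}" "z \<in> {-r<..<r}" for x z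
      using that assms(1) by (intro convex_on_imp_above_tangent[where A="{-r<..<r}"])
        (auto intro!: has_field_derivative_at_within f')
    have "f' 0 * y \<le> f y - f 0" "f' y * (- y) \<le> f 0 - f y"
      using tangent[of 0 y] tangent[of y 0] y assms(2) by auto
    then have "0 \<le> (f' y - f' 0) * y" by (simp add: algebra_simps)
    then show ?thesis by (auto simp: zero_le_mult_iff zero_le_divide_iff)
  qed
  then show "eventually (\<lambda>y. 0 \<le> (f' y - f' 0) / (y - 0)) (at 0)"
    using assms(2) by (auto simp: eventually_at dist_real_def intro!: exI[of _ r] simp: abs_less_iff)
qed simp

lemma nonneg_quadratic_form:
  fixes A B D :: real
  assumes "\<And>s t. 0 \<le> A * s\<^sup>2 + B * s * t + D * t\<^sup>2"
  shows "0 \<le> A" "0 \<le> D" "B\<^sup>2 \<le> 4 * A * D"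
proof -
  show A: "0 \<le> A" and D: "0 \<le> D" using assms[of 1 0] assms[of 0 1] by auto
  show "B\<^sup>2 \<le> 4 * A * D"
  proof (cases "A = 0")
    case True
    \<comment> \<open>This test vector makes the form equal to \<open>- B\<^sup>2\<close> when
      \<open>A = 0\<close>.\<close>
    have "0 \<le> B * (- (D + 1)) * B + D * B\<^sup>2" using assms[of "- (D + 1)" B] True by simp
    also have "\<dots> = - B\<^sup>2" by (simp add: algebra_simps power2_eq_square)
    finally have "B\<^sup>2 \<le> 0" by simp
    then show ?thesis using True by simp
  next
    case False
    \<comment> \<open>The minimizing direction of the form in \<open>s\<close>, scaled to avoid a
      division by \<open>A\<close>.\<close>
    have "0 \<le> A * B\<^sup>2 + B * B * (- 2 * A) + D * (- 2 * A)\<^sup>2" by (rule assms)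
    also have "\<dots> = A * (4 * A * D - B\<^sup>2)" by (simp add: power2_eq_square algebra_simps)
    finally show ?thesis using False A by (simp add: zero_le_mult_iff)
  qed
qed

text \<open>The off-diagonal entries need not be equal: passing to the symmetric part of a
  \<open>2 \<times> 2\<close> matrix can only decrease its determinant.\<close>

lemma jacobian_lower_bound:
  fixes a b c d :: real
  assumes form: "\<And>s t. 0 \<le> \<alpha> * (1 + p * a) * s\<^sup>2 + p * (\<beta> * b + \<alpha> * c) * s * t + \<beta> * (1 + p * d) * t\<^sup>2"
    and pos: "\<alpha> > 0" "\<beta> > 0" and \<sigma>: "0 \<le> \<sigma>" "\<sigma> \<le> 1/2" and e: "\<epsilon> = \<sigma> * p"
  shows "1/4 \<le> (1 + \<epsilon> * a) * (1 + \<epsilon> * d) - \<epsilon> * b * (\<epsilon> * c)"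
proof -
  define m11 m12 m21 m22 where "m11 = \<alpha> * (1 + p * a)" and "m12 = p * (\<beta> * b)"
    and "m21 = p * (\<alpha> * c)" and "m22 = \<beta> * (1 + p * d)"
  have form': "0 \<le> m11 * s\<^sup>2 + (m12 + m21) * s * t + m22 * t\<^sup>2" for s t
    using form[of s t] by (simp add: m11_def m12_def m21_def m22_def distrib_left)
  note q = nonneg_quadratic_form[OF form']
  have "4 * (m12 * m21) \<le> (m12 + m21)\<^sup>2"
    using zero_le_power2[of "m12 - m21"] by (simp add: power2_eq_square algebra_simps)
  then have det: "0 \<le> m11 * m22 - m12 * m21" using q(3) by simp
  \<comment> \<open>The right-hand side expands the determinant of
    \<open>(1 - \<sigma>) * diag(\<alpha>, \<beta>) + \<sigma> * m\<close>, which is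
    \<open>\<alpha> * \<beta>\<close> times the Jacobian in question; the terms beyond the first are
    nonnegative.\<close>
  have "(1 - \<sigma>)\<^sup>2 * (\<alpha> * \<beta>) \<le> (1 - \<sigma>)\<^sup>2 * (\<alpha> * \<beta>) + (1 - \<sigma>) * \<sigma> * (\<alpha> * m22 + \<beta> * m11)
      + \<sigma>\<^sup>2 * (m11 * m22 - m12 * m21)"
    using det q(1,2) pos \<sigma> by (simp add: mult_nonneg_nonneg add_nonneg_nonneg)
  also have "\<dots> = \<alpha> * \<beta> * ((1 + \<epsilon> * a) * (1 + \<epsilon> * d) - \<epsilon> * b * (\<epsilon> * c))"
    by (simp add: e m11_def m12_def m21_def m22_def power2_eq_square algebra_simps)
  finally have "(1 - \<sigma>)\<^sup>2 \<le> (1 + \<epsilon> * a) * (1 + \<epsilon> * d) - \<epsilon> * b * (\<epsilon> * c)"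
    using pos by (simp add: mult.commute[of "(1 - \<sigma>)\<^sup>2"])
  moreover have "(1/2)\<^sup>2 \<le> (1 - \<sigma>)\<^sup>2" using \<sigma> by (intro power_mono) auto
  ultimately show ?thesis by (simp add: power2_eq_square)
qed

section \<open>The pressure map\<close>

context coupled
begin

lemma theta_deriv_nn:
  assumes "0 \<le> u" "0 \<le> v"
  shows "theta_u F G h (deriv_nn F u, deriv_nn G v) = partial_u h (u, v)"
    and "theta_v F G h (deriv_nn F u, deriv_nn G v) = partial_v h (u, v)"
proof -
  have inj: "inj_on (deriv_nn f) {0..}" if "nonlinearity f" for f
    using nonlinearity_deriv_strict_mono[OF that]
    by (intro inj_onI) (metis atLeast_iff less_irrefl linorder_neqE_linordered_idom)
  have "the_inv_into {0..} (deriv_nn F) (deriv_nn F u) = u"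
    "the_inv_into {0..} (deriv_nn G) (deriv_nn G v) = v"
    using assms by (auto intro: the_inv_into_f_f inj F G)
  then show "theta_u F G h (deriv_nn F u, deriv_nn G v) = partial_u h (u, v)"
    "theta_v F G h (deriv_nn F u, deriv_nn G v) = partial_v h (u, v)"
    by (simp_all add: theta_u_def theta_v_def)
qed

text \<open>The terms with \<open>min\<close> vanish where the density is positive. They make \<open>pressure \<epsilon>\<close> the
  inverse of a map of the whole plane, namely the identity plus \<open>\<epsilon>\<close> times the extension of
  \<open>(\<theta>\<^sub>u, \<theta>\<^sub>v)\<close> by zero, so that no boundary has to be considered.\<close>

definition pressure :: "real \<Rightarrow> real \<times> real \<Rightarrow> real \<times> real" where
  "pressure \<epsilon> c = (deriv_nn F (fst (amin \<epsilon> c)) + min (fst c) 0, deriv_nn G (snd (amin \<epsilon> c)) + min (snd c) 0)"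

lemma pressure_continuous:
  assumes "\<epsilon> \<in> {0..\<epsilon>s}"
  shows "continuous_on UNIV (pressure \<epsilon>)"
proof -
  have "continuous_on UNIV (\<lambda>c. deriv_nn F (fst (amin \<epsilon> c)))" "continuous_on UNIV (\<lambda>c. deriv_nn G (snd (amin \<epsilon> c)))"
    using amin_nonneg[OF assms]
    by (intro continuous_on_compose2[OF nonlinearity_deriv(2)[OF F]] continuous_on_compose2[OF nonlinearity_deriv(2)[OF G]]
        continuous_intros amin_continuous[OF assms]; auto)+
  then show ?thesis unfolding pressure_def by (intro continuous_intros)
qed

text \<open>If one slack is nonpositive, its density is 0 and the coupling term drops out of the
  other equation. Each component of the pressure then equals its slack, the negative part being
  restored by \<open>min\<close>.\<close>

lemma pressure_cases:
  assumes "\<epsilon> \<in> {0..\<epsilon>s}"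
  shows "c \<in> open_quadrant \<Longrightarrow> \<exists>u>0. \<exists>v>0. amin \<epsilon> c = (u, v) \<and> pressure \<epsilon> c = (deriv_nn F u, deriv_nn G v)"
    and "c \<notin> open_quadrant \<Longrightarrow> pressure \<epsilon> c = c"
proof -
  obtain a b u v where c: "c = (a, b)" and uv: "amin \<epsilon> (a, b) = (u, v)"
    by (metis surj_pair)
  have nn: "0 \<le> u" "0 \<le> v" using amin_nonneg[OF assms, of "(a, b)"] by (auto simp: uv)
  note stat = amin_stationary[OF assms uv]
  have u0: "a \<le> 0 \<Longrightarrow> u = 0" and v0: "b \<le> 0 \<Longrightarrow> v = 0"
    using amin_zero[OF assms, where a=a and b=b] by (auto simp: uv)
  show "\<exists>u>0. \<exists>v>0. amin \<epsilon> c = (u, v) \<and> pressure \<epsilon> c = (deriv_nn F u, deriv_nn G v)" if "c \<in> open_quadrant"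
    using that stat uv by (auto simp: c pressure_def)
  show "pressure \<epsilon> c = c" if "c \<notin> open_quadrant"
  proof (cases "a \<le> 0")
    case True
    then have "u = 0" by (rule u0)
    then have "deriv_nn G v + min b 0 = b"
      using v0 stat(2) partial_v_zero(1)[OF nn(2)] nonlinearity_zero[OF G] by (cases "b \<le> 0") auto
    then show ?thesis using \<open>u = 0\<close> True nonlinearity_zero[OF F] by (simp add: pressure_def c uv)
  next
    case False
    then have "b \<le> 0" using that by (auto simp: c)
    then have "v = 0" by (rule v0)
    then have "deriv_nn F u + min a 0 = a"
      using False stat(1) partial_u_zero(2)[OF nn(1)] by auto
    then show ?thesis using \<open>v = 0\<close> \<open>b \<le> 0\<close> nonlinearity_zero[OF G] by (simp add: pressure_def c uv)
  qed
qed

lemma pressure_bound: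
  obtains B where "\<And>\<epsilon> c. \<epsilon> \<in> {0..\<epsilon>s} \<Longrightarrow> norm c \<le> r \<Longrightarrow> \<bar>fst (pressure \<epsilon> c)\<bar> \<le> B \<and> \<bar>snd (pressure \<epsilon> c)\<bar> \<le> B"
proof -
  obtain A B where AB: "A \<ge> 0" "B \<ge> 0" "\<And>\<epsilon> c. \<epsilon> \<in> {0..\<epsilon>s} \<Longrightarrow> norm (amin \<epsilon> c) \<le> A + B * norm c"
    by (rule amin_bound) blast
  define m where "m = A + B * r"
  show thesis
  proof (rule that[of "max (deriv_nn F m) (deriv_nn G m) + r"])
    fix \<epsilon> and c :: "real \<times> real" assume e: "\<epsilon> \<in> {0..\<epsilon>s}" and c: "norm c \<le> r"
    have nf: "\<bar>fst p\<bar> \<le> norm p" "\<bar>snd p\<bar> \<le> norm p" for p :: "real \<times> real"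
      using norm_fst_le[of "fst p" "snd p"] norm_snd_le[of "snd p" "fst p"] by auto
    have "B * norm c \<le> B * r" using c AB(2) by (rule mult_left_mono)
    then have "norm (amin \<epsilon> c) \<le> m" using AB(3)[OF e, of c] by (simp add: m_def)
    then have le: "fst (amin \<epsilon> c) \<le> m" "snd (amin \<epsilon> c) \<le> m"
      using nf[of "amin \<epsilon> c"] by auto
    note nn = amin_nonneg[OF e, of c]
    have mono: "deriv_nn f s \<le> deriv_nn f t" if "nonlinearity f" "0 \<le> s" "s \<le> t" for f s t
      using nonlinearity_deriv_strict_mono[OF that(1,2), of t] that(3) by (cases "s = t") auto
    have "0 \<le> deriv_nn F (fst (amin \<epsilon> c))" "deriv_nn F (fst (amin \<epsilon> c)) \<le> deriv_nn F m"
      "0 \<le> deriv_nn G (snd (amin \<epsilon> c))" "deriv_nn G (snd (amin \<epsilon> c)) \<le> deriv_nn G m"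
      using nn le by (auto intro!: mono F G nonlinearity_deriv_nonneg)
    moreover have "\<bar>min (fst c) 0\<bar> \<le> r" "\<bar>min (snd c) 0\<bar> \<le> r"
      using nf[of c] c by auto
    ultimately show "\<bar>fst (pressure \<epsilon> c)\<bar> \<le> max (deriv_nn F m) (deriv_nn G m) + r \<and>
        \<bar>snd (pressure \<epsilon> c)\<bar> \<le> max (deriv_nn F m) (deriv_nn G m) + r"
      by (simp add: pressure_def abs_le_iff) linarith
  qed
qed

end

text \<open>\<open>Eu\<close> and \<open>Ev\<close> stand for the zero extensions of the two
  \<open>theta\<close> functions together with a fixed choice of their derivatives.\<close>

locale degenerate_coupling = coupled +
  fixes k :: nat and Eu Ev :: "(real \<times> real) list \<Rightarrow> real \<times> real \<Rightarrow> real"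
  assumes Eu: "has_partials k UNIV (Eu []) Eu" "\<And>p. p \<in> quadrant \<Longrightarrow> Eu [] p = theta_u F G h p"
      "\<And>bs p. set bs \<subseteq> Basis \<Longrightarrow> length bs \<le> k \<Longrightarrow> p \<notin> open_quadrant \<Longrightarrow> Eu bs p = 0"
    and Ev: "has_partials k UNIV (Ev []) Ev" "\<And>p. p \<in> quadrant \<Longrightarrow> Ev [] p = theta_v F G h p"
      "\<And>bs p. set bs \<subseteq> Basis \<Longrightarrow> length bs \<le> k \<Longrightarrow> p \<notin> open_quadrant \<Longrightarrow> Ev bs p = 0"
begin

text \<open>The Jacobian determinant of the plane map
  \<open>id + \<epsilon> * (Eu [], Ev [])\<close> at \<open>p\<close>, for
  \<open>k \<ge> 1\<close>.\<close>

definition J :: "real \<Rightarrow> real \<times> real \<Rightarrow> real" where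
  "J \<epsilon> p = (1 + \<epsilon> * Eu [(1, 0)] p) * (1 + \<epsilon> * Ev [(0, 1)] p) - \<epsilon> * Eu [(0, 1)] p * (\<epsilon> * Ev [(1, 0)] p)"

text \<open>In the open quadrant these are the stationarity equations, written in the variables
  \<open>F' u\<close> and \<open>G' v\<close>. Elsewhere the pressure is the identity and the
  extensions vanish.\<close>

lemma pressure_inverse:
  assumes "\<epsilon> \<in> {0..\<epsilon>s}" and p: "p = pressure \<epsilon> c"
  shows "(fst p + \<epsilon> * Eu [] p, snd p + \<epsilon> * Ev [] p) = c"
proof (cases "c \<in> open_quadrant")
  case True
  then obtain u v where uv: "u > 0" "v > 0" "amin \<epsilon> c = (u, v)" "p = (deriv_nn F u, deriv_nn G v)"
    using pressure_cases(1)[OF assms(1)] p by blast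
  obtain a b where c: "c = (a, b)" "a > 0" "b > 0" using True by (cases c) auto
  have "p \<in> quadrant"
    using uv nonlinearity_deriv_nonneg[OF F] nonlinearity_deriv_nonneg[OF G] by auto
  then have "Eu [] p = partial_u h (u, v)" "Ev [] p = partial_v h (u, v)"
    using Eu(2) Ev(2) theta_deriv_nn[of u v] uv by auto
  then show ?thesis
    using amin_stationary[OF assms(1) uv(3)[unfolded c(1)]] c uv(4) by simp
next
  case False
  then have "p = c" using pressure_cases(2)[OF assms(1)] p by blast
  then show ?thesis using Eu(3)[of "[]" c] Ev(3)[of "[]" c] False by simp
qed

text \<open>The form is the second derivative of the convex function \<open>H\<close> along the line
  through \<open>(u, v)\<close> with direction \<open>(s, t)\<close>. The factors
  \<open>\<alpha>\<close> and \<open>\<beta>\<close> come from the chain rule for \<open>p\<close>.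
  A second derivative along a line sees only the sum of the mixed terms.\<close>

lemma Hessian_form_nonneg:
  assumes k: "k \<ge> 1" and uv: "u > 0" "v > 0" and p: "p = (deriv_nn F u, deriv_nn G v)"
  defines "\<alpha> \<equiv> deriv (deriv F) u" and "\<beta> \<equiv> deriv (deriv G) v"
  shows "0 \<le> \<alpha> * (1 + 2 * \<epsilon>s * Eu [(1, 0)] p) * s\<^sup>2
    + 2 * \<epsilon>s * (\<beta> * Eu [(0, 1)] p + \<alpha> * Ev [(1, 0)] p) * s * t
    + \<beta> * (1 + 2 * \<epsilon>s * Ev [(0, 1)] p) * t\<^sup>2"
proof -
  define x y where "x \<tau> = u + \<tau> * s" and "y \<tau> = v + \<tau> * t" for \<tau> :: real
  \<comment> \<open>Keeps the line inside the open quadrant; the added 1 avoids division by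
    0.\<close>
  define r where "r = min (u / (\<bar>s\<bar> + 1)) (v / (\<bar>t\<bar> + 1))"
  have r: "r > 0" using uv by (auto simp: r_def)
  have xy: "x \<tau> > 0" "y \<tau> > 0" if "\<tau> \<in> {-r<..<r}" for \<tau>
  proof -
    have "\<bar>\<tau>\<bar> < u / (\<bar>s\<bar> + 1)" "\<bar>\<tau>\<bar> < v / (\<bar>t\<bar> + 1)" using that by (auto simp: r_def)
    then have "\<bar>\<tau>\<bar> * (\<bar>s\<bar> + 1) < u" "\<bar>\<tau>\<bar> * (\<bar>t\<bar> + 1) < v"
      by (auto simp: field_simps)
    moreover have "\<bar>\<tau> * s\<bar> \<le> \<bar>\<tau>\<bar> * (\<bar>s\<bar> + 1)" "\<bar>\<tau> * t\<bar> \<le> \<bar>\<tau>\<bar> * (\<bar>t\<bar> + 1)"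
      by (auto simp: abs_mult distrib_left)
    ultimately show "x \<tau> > 0" "y \<tau> > 0" unfolding x_def y_def by linarith+
  qed
  have dx: "(x has_real_derivative s) (at \<tau>)" and dy: "(y has_real_derivative t) (at \<tau>)" for \<tau>
    unfolding x_def y_def by (auto intro!: derivative_eq_intros)
  let ?q = "\<lambda>\<tau>. (deriv_nn F (x \<tau>), deriv_nn G (y \<tau>))"
  let ?f = "\<lambda>\<tau>. H (x \<tau>, y \<tau>)"
  \<comment> \<open>The gradient of \<open>h\<close> is expressed through \<open>Eu\<close> and
    \<open>Ev\<close>, so the second differentiation uses their first derivatives at
    \<open>p\<close> and not second derivatives of \<open>h\<close>.\<close>
  let ?f' = "\<lambda>\<tau>. s * (deriv_nn F (x \<tau>) + 2 * \<epsilon>s * Eu [] (?q \<tau>)) + t * (deriv_nn G (y \<tau>) + 2 * \<epsilon>s * Ev [] (?q \<tau>))"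
  let ?d = "s * (\<alpha> * s + 2 * \<epsilon>s * (\<alpha> * s * Eu [(1, 0)] p + \<beta> * t * Eu [(0, 1)] p))
      + t * (\<beta> * t + 2 * \<epsilon>s * (\<alpha> * s * Ev [(1, 0)] p + \<beta> * t * Ev [(0, 1)] p))"
  have "0 \<le> ?d"
  proof (rule convex_second_derivative_nonneg[OF _ r])
    show "convex_on {-r<..<r} ?f"
    proof (rule convex_onI)
      fix z \<tau> \<tau>' :: real assume z: "0 < z" "z < 1" and \<tau>: "\<tau> \<in> {-r<..<r}" "\<tau>' \<in> {-r<..<r}"
      have "H ((1 - z) *\<^sub>R (x \<tau>, y \<tau>) + z *\<^sub>R (x \<tau>', y \<tau>')) \<le> (1 - z) * ?f \<tau> + z * ?f \<tau>'"
        using z xy[OF \<tau>(1)] xy[OF \<tau>(2)] by (intro convex_onD[OF H_convex]) auto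
      moreover have "(1 - z) *\<^sub>R (x \<tau>, y \<tau>) + z *\<^sub>R (x \<tau>', y \<tau>') =
          (x ((1 - z) *\<^sub>R \<tau> + z *\<^sub>R \<tau>'), y ((1 - z) *\<^sub>R \<tau> + z *\<^sub>R \<tau>'))"
        by (simp add: x_def y_def algebra_simps)
      ultimately show "?f ((1 - z) *\<^sub>R \<tau> + z *\<^sub>R \<tau>') \<le> (1 - z) * ?f \<tau> + z * ?f \<tau>'"
        by simp
    qed simp
    show "(?f has_real_derivative ?f' \<tau>) (at \<tau>)" if "\<tau> \<in> {-r<..<r}" for \<tau>
    proof -
      note pos = xy[OF that]
      have "?q \<tau> \<in> quadrant"
        using pos nonlinearity_deriv_nonneg[OF F] nonlinearity_deriv_nonneg[OF G] by auto
      then have Euv: "Eu [] (?q \<tau>) = partial_u h (x \<tau>, y \<tau>)" "Ev [] (?q \<tau>) = partial_v h (x \<tau>, y \<tau>)"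
        using Eu(2) Ev(2) theta_deriv_nn pos by auto
      have "((\<lambda>\<tau>. F (x \<tau>) + G (y \<tau>) + 2 * \<epsilon>s * h (x \<tau>, y \<tau>)) has_real_derivative
          deriv_nn F (x \<tau>) * s + deriv_nn G (y \<tau>) * t +
          2 * \<epsilon>s * (s * partial_u h (x \<tau>, y \<tau>) + t * partial_v h (x \<tau>, y \<tau>))) (at \<tau>)"
        using pos
        by (intro DERIV_add DERIV_cmult DERIV_chain2[OF nonlinearity_deriv_pos[OF F] dx]
            DERIV_chain2[OF nonlinearity_deriv_pos[OF G] dy]
            has_real_derivative_compose_pair[OF h_has_derivative dx dy]) auto
      then show ?thesis by (simp add: H_def Euv algebra_simps)
    qed
    have xy0: "x 0 = u" "y 0 = v" by (auto simp: x_def y_def)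
    have dF: "((\<lambda>\<tau>. deriv_nn F (x \<tau>)) has_real_derivative \<alpha> * s) (at 0)"
      unfolding \<alpha>_def by (rule DERIV_chain2[OF _ dx]) (use nonlinearity_deriv2(1)[OF F uv(1)] xy0 in simp)
    have dG: "((\<lambda>\<tau>. deriv_nn G (y \<tau>)) has_real_derivative \<beta> * t) (at 0)"
      unfolding \<beta>_def by (rule DERIV_chain2[OF _ dy]) (use nonlinearity_deriv2(1)[OF G uv(2)] xy0 in simp)
    have q0: "?q 0 = p" by (simp add: p xy0)
    have dE: "((\<lambda>\<tau>. E [] (?q \<tau>)) has_real_derivative \<alpha> * s * E [(1, 0)] p + \<beta> * t * E [(0, 1)] p) (at 0)"
      if "has_partials k UNIV (E []) E" for E
      using has_derivative_partials_prod[OF that, of "[]" "?q 0"] k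
      by (intro has_real_derivative_compose_pair dF dG) (simp add: q0)
    show "(?f' has_real_derivative ?d) (at 0)"
      by (intro DERIV_add DERIV_cmult dF dG dE Eu(1) Ev(1))
  qed
  also have "?d = \<alpha> * (1 + 2 * \<epsilon>s * Eu [(1, 0)] p) * s\<^sup>2
    + 2 * \<epsilon>s * (\<beta> * Eu [(0, 1)] p + \<alpha> * Ev [(1, 0)] p) * s * t
    + \<beta> * (1 + 2 * \<epsilon>s * Ev [(0, 1)] p) * t\<^sup>2"
    by (simp add: power2_eq_square algebra_simps)
  finally show ?thesis .
qed

lemma J_lower_bound:
  assumes k: "k \<ge> 1" and e: "\<epsilon> \<in> {0..\<epsilon>s}"
  shows "1/4 \<le> J \<epsilon> (pressure \<epsilon> c)"
proof (cases "c \<in> open_quadrant")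
  case True
  then obtain u v where uv: "u > 0" "v > 0" "pressure \<epsilon> c = (deriv_nn F u, deriv_nn G v)"
    using pressure_cases(1)[OF e] by blast
  show ?thesis
    unfolding J_def
  proof (rule jacobian_lower_bound[OF Hessian_form_nonneg[OF k uv]])
    show "deriv (deriv F) u > 0" "deriv (deriv G) v > 0"
      using nonlinearity_deriv2(2)[OF F uv(1)] nonlinearity_deriv2(2)[OF G uv(2)] by auto
    show "0 \<le> \<epsilon> / (2 * \<epsilon>s)" "\<epsilon> / (2 * \<epsilon>s) \<le> 1/2" "\<epsilon> = \<epsilon> / (2 * \<epsilon>s) * (2 * \<epsilon>s)"
      using e \<epsilon>s_pos by (auto simp: field_simps)
  qed
next
  case False
  \<comment> \<open>Here the pressure is the identity and the first derivatives of the extensions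
    vanish, so \<open>J\<close> equals 1.\<close>
  then have "pressure \<epsilon> c \<notin> open_quadrant" using pressure_cases(2)[OF e] by metis
  then have "Eu [b] (pressure \<epsilon> c) = 0" "Ev [b] (pressure \<epsilon> c) = 0" if "b \<in> Basis" for b
    using that k Eu(3)[of "[b]"] Ev(3)[of "[b]"] by auto
  then show ?thesis by (simp add: J_def Basis_prod_def)
qed

text \<open>The pressure is a continuous right inverse of a differentiable map whose derivative is
  invertible, and the inverse derivative rule applies to such a map. The formula is the adjugate
  matrix divided by the determinant.\<close>

lemma pressure_has_derivative:
  assumes k: "k \<ge> 1" and e: "\<epsilon> \<in> {0..\<epsilon>s}" and p: "p = pressure \<epsilon> c"
  shows "(pressure \<epsilon> has_derivative (\<lambda>(s, t).
    (((1 + \<epsilon> * Ev [(0, 1)] p) * s - \<epsilon> * Eu [(0, 1)] p * t) * inverse (J \<epsilon> p),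
     ((1 + \<epsilon> * Eu [(1, 0)] p) * t - \<epsilon> * Ev [(1, 0)] p * s) * inverse (J \<epsilon> p)))) (at c)"
    (is "(_ has_derivative ?g') _")
proof -
  define a b where "a = Eu [(1, 0)] p" and "b = Eu [(0, 1)] p"
  define a' b' where "a' = Ev [(1, 0)] p" and "b' = Ev [(0, 1)] p"
  let ?T = "\<lambda>q. (fst q + \<epsilon> * Eu [] q, snd q + \<epsilon> * Ev [] q)"
  let ?T' = "\<lambda>\<xi>::real \<times> real. (fst \<xi> + \<epsilon> * (case \<xi> of (s, t) \<Rightarrow> s * a + t * b), snd \<xi> + \<epsilon> * (case \<xi> of (s, t) \<Rightarrow> s * a' + t * b'))"
  have "(Eu [] has_derivative (\<lambda>(s, t). s * a + t * b)) (at p)" "(Ev [] has_derivative (\<lambda>(s, t). s * a' + t * b')) (at p)"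
    using has_derivative_partials_prod[OF Eu(1), of "[]" p] has_derivative_partials_prod[OF Ev(1), of "[]" p] k
    by (auto simp: a_def b_def a'_def b'_def)
  then have T: "(?T has_derivative ?T') (at (pressure \<epsilon> c))"
    unfolding p[symmetric]
    by (intro has_derivative_Pair has_derivative_add has_derivative_mult_right has_derivative_fst has_derivative_snd has_derivative_ident)
  have J: "J \<epsilon> p \<noteq> 0" using J_lower_bound[OF k e, of c] p by auto
  have J_eq: "J \<epsilon> p = (1 + \<epsilon> * a) * (1 + \<epsilon> * b') - \<epsilon> * b * (\<epsilon> * a')"
    by (simp add: J_def a_def b_def a'_def b'_def)
  show ?thesis
  proof (rule has_derivative_inverse_basic[where f="?T" and f'="?T'" and T=UNIV])
    show "(?T has_derivative ?T') (at (pressure \<epsilon> c))" by (rule T)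
    show "bounded_linear ?g'"
    proof -
      have "?g' = (\<lambda>\<xi>. (((1 + \<epsilon> * Ev [(0, 1)] p) * fst \<xi> - \<epsilon> * Eu [(0, 1)] p * snd \<xi>) * inverse (J \<epsilon> p),
          ((1 + \<epsilon> * Eu [(1, 0)] p) * snd \<xi> - \<epsilon> * Ev [(1, 0)] p * fst \<xi>) * inverse (J \<epsilon> p)))"
        by (simp add: case_prod_beta')
      then show ?thesis
        by (simp only:) (intro bounded_linear_Pair bounded_linear_sub
            bounded_linear_compose[OF bounded_linear_mult_left] bounded_linear_compose[OF bounded_linear_mult_right]
            bounded_linear_fst bounded_linear_snd)
    qed
    show "?g' \<circ> ?T' = id"
    proof
      fix \<xi> :: "real \<times> real"
      obtain s t where \<xi>: "\<xi> = (s, t)" by (cases \<xi>)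
      have "(1 + \<epsilon> * b') * (s + \<epsilon> * (s * a + t * b)) - \<epsilon> * b * (t + \<epsilon> * (s * a' + t * b')) = s * J \<epsilon> p"
        "(1 + \<epsilon> * a) * (t + \<epsilon> * (s * a' + t * b')) - \<epsilon> * a' * (s + \<epsilon> * (s * a + t * b)) = t * J \<epsilon> p"
        by (simp_all add: J_eq algebra_simps)
      then show "(?g' \<circ> ?T') \<xi> = id \<xi>"
        using J by (simp add: \<xi> a_def[symmetric] b_def[symmetric] a'_def[symmetric] b'_def[symmetric])
    qed
    show "continuous (at c) (pressure \<epsilon>)"
      using pressure_continuous[OF e] continuous_on_eq_continuous_at[OF open_UNIV] by blast
    show "?T (pressure \<epsilon> z) = z" for z
      by (rule pressure_inverse[OF e refl])
  qed auto
qed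

end

section \<open>Uniform bounds for the minimizers\<close>

locale regular_problem =
  energy_problem F G h \<epsilon>s \<Phi> \<Psi> \<Lambda> M + degenerate_coupling F G h \<epsilon>s k Eu Ev
  for F G h \<epsilon>s and \<Phi> \<Psi> :: "real^'n \<Rightarrow> real" and \<Lambda> M k Eu Ev
begin

lemma pressure_family_0:
  fixes S :: "(real^'n) set" and K :: real
  assumes "compact S"
  defines "I \<equiv> {0..\<epsilon>s} \<times> {C. norm C \<le> K}"
  shows "Ck_family 0 S I (\<lambda>i x. fst (pressure (fst i) (slack (snd i) x)))"
    and "Ck_family 0 S I (\<lambda>i x. snd (pressure (fst i) (slack (snd i) x)))"
proof -
  have "continuous_on S (\<lambda>x. (\<Phi> x, \<Psi> x))"
    by (intro continuous_intros continuous_on_subset[OF \<Phi>_continuous] continuous_on_subset[OF \<Psi>_continuous]) auto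
  then have "bounded ((\<lambda>x. (\<Phi> x, \<Psi> x)) ` S)"
    using assms(1) by (intro compact_imp_bounded compact_continuous_image)
  then obtain m where m: "\<And>x. x \<in> S \<Longrightarrow> norm (\<Phi> x, \<Psi> x) \<le> m"
    unfolding bounded_iff by auto
  have slack: "norm (slack C x) \<le> K + m" if "x \<in> S" "norm C \<le> K" for C x
  proof -
    have "slack C x = C - (\<Phi> x, \<Psi> x)" by (simp add: slack_def prod_eq_iff)
    then show ?thesis
      using norm_triangle_ineq4[of C "(\<Phi> x, \<Psi> x)"] m[OF that(1)] that(2) by simp
  qed
  obtain B where B: "\<And>\<epsilon> c. \<epsilon> \<in> {0..\<epsilon>s} \<Longrightarrow> norm c \<le> K + m \<Longrightarrow>
      \<bar>fst (pressure \<epsilon> c)\<bar> \<le> B \<and> \<bar>snd (pressure \<epsilon> c)\<bar> \<le> B"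
    by (rule pressure_bound) blast
  have c: "continuous_on UNIV (\<lambda>x. pressure (fst i) (slack (snd i) x))" if "i \<in> I" for i
    using that by (intro continuous_on_compose2[OF pressure_continuous slack_continuous]) (auto simp: I_def)
  have "\<forall>i\<in>I. \<forall>x\<in>S. \<bar>fst (pressure (fst i) (slack (snd i) x))\<bar> \<le> B \<and>
      \<bar>snd (pressure (fst i) (slack (snd i) x))\<bar> \<le> B"
    using B slack by (auto simp: I_def)
  then show "Ck_family 0 S I (\<lambda>i x. fst (pressure (fst i) (slack (snd i) x)))"
    "Ck_family 0 S I (\<lambda>i x. snd (pressure (fst i) (slack (snd i) x)))"
    using c by (auto intro!: continuous_intros exI[of _ B])
qed

text \<open>A bootstrap: the first derivatives of the pressure along \<open>x\<close> are algebraic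
  in the derivatives of the potentials, in first derivatives of \<open>Eu\<close> and
  \<open>Ev\<close> at the pressure itself, and in \<open>inverse (J ...)\<close>. Order
  \<open>j\<close> of the pressure thus gives order \<open>j\<close> of its derivatives. The index
  is the pair of \<open>\<epsilon>\<close> and the multipliers.\<close>

lemma pressure_family:
  fixes S :: "(real^'n) set" and K :: real
  assumes S: "compact S" and "j \<le> k"
  defines "I \<equiv> {0..\<epsilon>s} \<times> {C. norm C \<le> K}"
  shows "Ck_family j S I (\<lambda>i x. fst (pressure (fst i) (slack (snd i) x))) \<and>
    Ck_family j S I (\<lambda>i x. snd (pressure (fst i) (slack (snd i) x)))"
  using \<open>j \<le> k\<close>
proof (induction j)
  case 0
  then show ?case using pressure_family_0[OF S, of K] by (simp only: I_def simp_thms)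
next
  case (Suc j)
  \<comment> \<open>From here on \<open>k\<close> is positive, so the first derivatives in
    \<open>J\<close> are genuine; \<open>k = 0\<close> involves only the base case.\<close>
  then have k: "k \<ge> 1" and jk: "1 + j \<le> k" by auto
  obtain P where P: "has_partials k UNIV \<Phi> P"
    using \<Phi> unfolding potential_def smooth_on_def Ck_on_def by blast
  obtain Q where Q: "has_partials k UNIV \<Psi> Q"
    using \<Psi> unfolding potential_def smooth_on_def Ck_on_def by blast
  have nil: "P [] = \<Phi>" "Q [] = \<Psi>" using P Q by (auto simp: has_partials_def)
  define p where "p i x = pressure (fst i) (slack (snd i) x)" for i :: "real \<times> real \<times> real" and x
  \<comment> \<open>The inverse Jacobian applied to the derivative of the slack; the minus sign is
    that of the potentials in \<open>slack\<close>.\<close>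
  define X where "X b i x = - (((1 + fst i * Ev [(0, 1)] (p i x)) * P [b] x - fst i * Eu [(0, 1)] (p i x) * Q [b] x)
      * inverse (J (fst i) (p i x)))" for b i x
  define Y where "Y b i x = - (((1 + fst i * Eu [(1, 0)] (p i x)) * Q [b] x - fst i * Ev [(1, 0)] (p i x) * P [b] x)
      * inverse (J (fst i) (p i x)))" for b i x
  have IH: "Ck_family j S I (\<lambda>i x. fst (p i x))" "Ck_family j S I (\<lambda>i x. snd (p i x))"
    using Suc by (auto simp: p_def)
  have const: "Ck_family j S I (\<lambda>i x. fst i)" "Ck_family j S I (\<lambda>i x. 1)"
    by (rule Ck_family_const[where C=\<epsilon>s], auto simp: I_def) (rule Ck_family_const[where C=1], simp)
  have PQ: "Ck_family j S I (\<lambda>i. P [b])" "Ck_family j S I (\<lambda>i. Q [b])" if "b \<in> Basis" for b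
    using that jk by (auto intro!: has_partials_Ck_family[OF P S] has_partials_Ck_family[OF Q S])
  have E: "Ck_family j S I (\<lambda>i x. Eu [b] (p i x))" "Ck_family j S I (\<lambda>i x. Ev [b] (p i x))" if "b \<in> Basis" for b
    using that jk Ck_family_compose_pair[OF Eu(1) _ _ IH, of "[b]"] Ck_family_compose_pair[OF Ev(1) _ _ IH, of "[b]"]
    by auto
  have B: "(1, 0) \<in> (Basis :: (real \<times> real) set)" "(0, 1) \<in> (Basis :: (real \<times> real) set)"
    by (auto simp: Basis_prod_def)
  note E = E[OF B(1)] E[OF B(2)]
  have invJ: "Ck_family j S I (\<lambda>i x. inverse (J (fst i) (p i x)))"
  proof (rule Ck_family_inverse)
    show "1/4 \<le> J (fst i) (p i x)" if "i \<in> I" for i x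
      unfolding p_def using that by (intro J_lower_bound k) (auto simp: I_def)
    show "Ck_family j S I (\<lambda>i x. J (fst i) (p i x))"
      unfolding J_def by (intro Ck_family_diff Ck_family_mult Ck_family_add const E)
  qed simp
  have XY: "Ck_family j S I (X b)" "Ck_family j S I (Y b)" if "b \<in> Basis" for b
    unfolding X_def Y_def
    by (intro Ck_family_minus Ck_family_diff Ck_family_mult Ck_family_add const E PQ that invJ)+
  have der: "((\<lambda>t. fst (p i (x + t *\<^sub>R b))) has_real_derivative X b i x) (at 0)"
    "((\<lambda>t. snd (p i (x + t *\<^sub>R b))) has_real_derivative Y b i x) (at 0)" if b: "b \<in> Basis" and i: "i \<in> I" for b i x
  proof -
    have e: "fst i \<in> {0..\<epsilon>s}" using i by (auto simp: I_def)
    have dP: "((\<lambda>t. \<Phi> (x + t *\<^sub>R b)) has_derivative (*) (P [b] x)) (at 0)"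
      using has_partials_UNIV_deriv[OF P, of "[]" b x] k b by (simp add: nil has_field_derivative_def)
    have dQ: "((\<lambda>t. \<Psi> (x + t *\<^sub>R b)) has_derivative (*) (Q [b] x)) (at 0)"
      using has_partials_UNIV_deriv[OF Q, of "[]" b x] k b by (simp add: nil has_field_derivative_def)
    have s: "((\<lambda>t. slack (snd i) (x + t *\<^sub>R b)) has_derivative (\<lambda>t. (0 - P [b] x * t, 0 - Q [b] x * t))) (at 0)"
      unfolding slack_def by (intro has_derivative_Pair has_derivative_diff has_derivative_const dP dQ)
    have pr: "p i (x + 0 *\<^sub>R b) = pressure (fst i) (slack (snd i) (x + 0 *\<^sub>R b))" by (simp add: p_def)
    note d = has_derivative_compose[OF s pressure_has_derivative[OF k e pr]]
    have "((\<lambda>t. fst (p i (x + t *\<^sub>R b))) has_derivative (*) (X b i x)) (at 0)"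
    proof (rule has_derivative_eq_rhs)
      show "((\<lambda>t. fst (p i (x + t *\<^sub>R b))) has_derivative (\<lambda>t. fst (case (0 - P [b] x * t, 0 - Q [b] x * t) of (s, t) \<Rightarrow>
          (((1 + fst i * Ev [(0, 1)] (p i (x + 0 *\<^sub>R b))) * s - fst i * Eu [(0, 1)] (p i (x + 0 *\<^sub>R b)) * t) * inverse (J (fst i) (p i (x + 0 *\<^sub>R b))),
           ((1 + fst i * Eu [(1, 0)] (p i (x + 0 *\<^sub>R b))) * t - fst i * Ev [(1, 0)] (p i (x + 0 *\<^sub>R b)) * s) * inverse (J (fst i) (p i (x + 0 *\<^sub>R b))))))) (at 0)"
        unfolding p_def by (rule has_derivative_fst[OF d[unfolded p_def]])
    qed (simp add: X_def fun_eq_iff algebra_simps)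
    moreover have "((\<lambda>t. snd (p i (x + t *\<^sub>R b))) has_derivative (*) (Y b i x)) (at 0)"
    proof (rule has_derivative_eq_rhs)
      show "((\<lambda>t. snd (p i (x + t *\<^sub>R b))) has_derivative (\<lambda>t. snd (case (0 - P [b] x * t, 0 - Q [b] x * t) of (s, t) \<Rightarrow>
          (((1 + fst i * Ev [(0, 1)] (p i (x + 0 *\<^sub>R b))) * s - fst i * Eu [(0, 1)] (p i (x + 0 *\<^sub>R b)) * t) * inverse (J (fst i) (p i (x + 0 *\<^sub>R b))),
           ((1 + fst i * Eu [(1, 0)] (p i (x + 0 *\<^sub>R b))) * t - fst i * Ev [(1, 0)] (p i (x + 0 *\<^sub>R b)) * s) * inverse (J (fst i) (p i (x + 0 *\<^sub>R b))))))) (at 0)"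
        unfolding p_def by (rule has_derivative_snd[OF d[unfolded p_def]])
    qed (simp add: Y_def fun_eq_iff algebra_simps)
    ultimately show "((\<lambda>t. fst (p i (x + t *\<^sub>R b))) has_real_derivative X b i x) (at 0)"
      "((\<lambda>t. snd (p i (x + t *\<^sub>R b))) has_real_derivative Y b i x) (at 0)"
      by (simp_all add: has_field_derivative_def)
  qed
  have zero: "Ck_family 0 S I (\<lambda>i x. fst (p i x))" "Ck_family 0 S I (\<lambda>i x. snd (p i x))"
    using pressure_family_0[OF S, of K] by (simp_all only: p_def I_def)
  show ?case
    unfolding p_def[symmetric]
    using Ck_family_SucI[OF zero(1) XY(1) der(1)] Ck_family_SucI[OF zero(2) XY(2) der(2)] by blast
qed

text \<open>The multipliers may depend on \<open>\<epsilon>\<close>, but their norms are at most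
  \<open>K\<close>. They belong to a single family, and both supports lie in
  \<open>sublevels K\<close>.\<close>

lemma minimizer_Ck_bounds:
  "\<exists>C. \<forall>\<epsilon>\<in>{0..\<epsilon>s}. \<forall>u v. is_minimizer (energy F G \<Phi> \<Psi> h \<epsilon>) u v \<longrightarrow>
     AE_Ck_bounded_on k (ess_support u) (\<lambda>x. deriv_nn F (u x)) C \<and>
     AE_Ck_bounded_on k (ess_support v) (\<lambda>x. deriv_nn G (v x)) C"
proof -
  obtain K where K: "\<And>\<epsilon>. \<epsilon> \<in> {0..\<epsilon>s} \<Longrightarrow> \<exists>C. norm C \<le> K \<and> mass \<epsilon> C = (1, 1)"
    by (rule multipliers_exist) blast
  define I where "I = {0..\<epsilon>s} \<times> {C :: real \<times> real. norm C \<le> K}"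
  let ?S = "sublevels K"
  have fam: "Ck_family k ?S I (\<lambda>i x. fst (pressure (fst i) (slack (snd i) x)))"
    "Ck_family k ?S I (\<lambda>i x. snd (pressure (fst i) (slack (snd i) x)))"
    using pressure_family[OF compact_sublevels order_refl, of K K] by (auto simp: I_def)
  obtain Bu where Bu: "\<And>i. i \<in> I \<Longrightarrow> \<exists>D. has_partials k UNIV (\<lambda>x. fst (pressure (fst i) (slack (snd i) x))) D \<and>
      (\<forall>bs. set bs \<subseteq> Basis \<and> length bs \<le> k \<longrightarrow> (\<forall>x\<in>?S. \<bar>D bs x\<bar> \<le> Bu))"
    using Ck_family_has_partials[OF fam(1)] by blast
  obtain Bv where Bv: "\<And>i. i \<in> I \<Longrightarrow> \<exists>D. has_partials k UNIV (\<lambda>x. snd (pressure (fst i) (slack (snd i) x))) D \<and>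
      (\<forall>bs. set bs \<subseteq> Basis \<and> length bs \<le> k \<longrightarrow> (\<forall>x\<in>?S. \<bar>D bs x\<bar> \<le> Bv))"
    using Ck_family_has_partials[OF fam(2)] by blast
  have restrict: "Ck_bounded_on k T f (max Bu Bv)"
    if ex: "\<exists>D. has_partials k UNIV f D \<and> (\<forall>bs. set bs \<subseteq> Basis \<and> length bs \<le> k \<longrightarrow> (\<forall>x\<in>?S. \<bar>D bs x\<bar> \<le> B))"
      "T \<subseteq> ?S" "B \<le> max Bu Bv" for T f B
  proof -
    obtain D where D: "has_partials k UNIV f D"
      and bound: "\<And>bs x. set bs \<subseteq> Basis \<Longrightarrow> length bs \<le> k \<Longrightarrow> x \<in> ?S \<Longrightarrow> \<bar>D bs x\<bar> \<le> B"
      using ex by blast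
    \<comment> \<open>A witness on the whole space also serves on a subset: continuity restricts,
      and the derivatives hold at every point.\<close>
    have "has_partials k T f D"
      using D continuous_on_subset unfolding has_partials_def by (metis UNIV_I interior_UNIV subset_UNIV)
    moreover have "\<bar>D bs x\<bar> \<le> max Bu Bv" if "set bs \<subseteq> Basis" "length bs \<le> k" "x \<in> T" for bs x
      using bound[OF that(1,2), of x] that(3) \<open>T \<subseteq> ?S\<close> \<open>B \<le> max Bu Bv\<close> by auto
    ultimately show ?thesis unfolding Ck_bounded_on_def by blast
  qed
  show ?thesis
  proof (intro exI[of _ "max Bu Bv"] ballI allI impI)
    fix \<epsilon> u v assume e: "\<epsilon> \<in> {0..\<epsilon>s}" and min: "is_minimizer (energy F G \<Phi> \<Psi> h \<epsilon>) u v"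
    obtain C where C: "norm C \<le> K" "mass \<epsilon> C = (1, 1)" using K[OF e] by blast
    have i: "(\<epsilon>, C) \<in> I" using e C by (simp add: I_def)
    note ae = minimizer_eq_dens[OF e C(2) min]
    have supp: "ess_support u = {x. \<Phi> x \<le> fst C}" "ess_support v = {x. \<Psi> x \<le> snd C}"
      using ess_support_cong[OF ae(1)] ess_support_cong[OF ae(2)] ess_support_dens[OF e C(2)] by auto
    have "fst C \<le> K" "snd C \<le> K"
      using C(1) norm_fst_le[of "fst C" "snd C"] norm_snd_le[of "snd C" "fst C"] by auto
    then have sub: "ess_support u \<subseteq> ?S" "ess_support v \<subseteq> ?S"
      unfolding supp sublevels_def by auto
    have "AE_Ck_bounded_on k (ess_support u) (\<lambda>x. deriv_nn F (u x)) (max Bu Bv)"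
      unfolding AE_Ck_bounded_on_def
    proof (intro exI conjI)
      \<comment> \<open>On the support the slack of \<open>u\<close> is nonnegative, so the
        \<open>min\<close> term of the pressure is 0.\<close>
      show "AE x in lborel. x \<in> ess_support u \<longrightarrow> fst (pressure \<epsilon> (slack C x)) = deriv_nn F (u x)"
        using ae(1) by (elim AE_mp) (auto intro!: AE_I2 simp: supp pressure_def dens_def slack_def)
      show "Ck_bounded_on k (ess_support u) (\<lambda>x. fst (pressure \<epsilon> (slack C x))) (max Bu Bv)"
        using restrict[OF Bu[OF i] sub(1)] by simp
    qed
    moreover have "AE_Ck_bounded_on k (ess_support v) (\<lambda>x. deriv_nn G (v x)) (max Bu Bv)"
      unfolding AE_Ck_bounded_on_def
    proof (intro exI conjI)
      show "AE x in lborel. x \<in> ess_support v \<longrightarrow> snd (pressure \<epsilon> (slack C x)) = deriv_nn G (v x)"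
        using ae(2) by (elim AE_mp) (auto intro!: AE_I2 simp: supp pressure_def dens_def slack_def)
      show "Ck_bounded_on k (ess_support v) (\<lambda>x. snd (pressure \<epsilon> (slack C x))) (max Bu Bv)"
        using restrict[OF Bv[OF i] sub(2)] by simp
    qed
    ultimately show "AE_Ck_bounded_on k (ess_support u) (\<lambda>x. deriv_nn F (u x)) (max Bu Bv) \<and>
        AE_Ck_bounded_on k (ess_support v) (\<lambda>x. deriv_nn G (v x)) (max Bu Bv)" ..
  qed
qed

end

theorem theorem1p3:
  fixes \<Phi> \<Psi> :: "real^'n \<Rightarrow> real"
    and F G :: "real \<Rightarrow> real"
    and h :: "real \<times> real \<Rightarrow> real"
    and \<Lambda> M \<epsilon>s :: real
  assumes "\<Lambda> > 0" and "M > 0"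
    and "potential \<Lambda> M \<Phi>" and "potential \<Lambda> M \<Psi>"
    and "nonlinearity F" and "nonlinearity G"
    and "coupling F G h \<epsilon>s"
  shows "(\<forall>\<epsilon>\<in>{0..\<epsilon>s}. \<exists>u v.
            is_minimizer (energy F G \<Phi> \<Psi> h \<epsilon>) u v \<and>
            (\<forall>u' v'. is_minimizer (energy F G \<Phi> \<Psi> h \<epsilon>) u' v' \<longrightarrow>
               (AE x in lborel. u' x = u x) \<and> (AE x in lborel. v' x = v x)))
       \<and> (\<forall>\<epsilon>\<in>{0..\<epsilon>s}. \<forall>u v. is_minimizer (energy F G \<Phi> \<Psi> h \<epsilon>) u v \<longrightarrow>
            compact (ess_support u) \<and> (\<exists>c. ess_support u = {x. \<Phi> x \<le> c}) \<and>
            compact (ess_support v) \<and> (\<exists>c. ess_support v = {x. \<Psi> x \<le> c}))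
       \<and> (\<forall>k. degenerate k F G h \<longrightarrow>
            (\<exists>C. \<forall>\<epsilon>\<in>{0..\<epsilon>s}. \<forall>u v. is_minimizer (energy F G \<Phi> \<Psi> h \<epsilon>) u v \<longrightarrow>
               AE_Ck_bounded_on k (ess_support u) (\<lambda>x. deriv_nn F (u x)) C \<and>
               AE_Ck_bounded_on k (ess_support v) (\<lambda>x. deriv_nn G (v x)) C))"
proof -
  interpret energy_problem F G h \<epsilon>s \<Phi> \<Psi> \<Lambda> M
    using assms by unfold_locales auto
  show ?thesis
  proof (intro conjI)
    show "\<forall>\<epsilon>\<in>{0..\<epsilon>s}. \<exists>u v. is_minimizer (energy F G \<Phi> \<Psi> h \<epsilon>) u v \<and>
        (\<forall>u' v'. is_minimizer (energy F G \<Phi> \<Psi> h \<epsilon>) u' v' \<longrightarrow>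
           (AE x in lborel. u' x = u x) \<and> (AE x in lborel. v' x = v x))"
    proof
      fix \<epsilon> assume e: "\<epsilon> \<in> {0..\<epsilon>s}"
      \<comment> \<open>Any multipliers with unit masses will do here; the bound on their norm
        enters only in the C^k estimate.\<close>
      obtain C where C: "mass \<epsilon> C = (1, 1)" using multipliers_exist e by metis
      show "\<exists>u v. is_minimizer (energy F G \<Phi> \<Psi> h \<epsilon>) u v \<and>
          (\<forall>u' v'. is_minimizer (energy F G \<Phi> \<Psi> h \<epsilon>) u' v' \<longrightarrow>
             (AE x in lborel. u' x = u x) \<and> (AE x in lborel. v' x = v x))"
        using dens_is_minimizer[OF e C] minimizer_eq_dens[OF e C] by blast
    qed
    show "\<forall>\<epsilon>\<in>{0..\<epsilon>s}. \<forall>u v. is_minimizer (energy F G \<Phi> \<Psi> h \<epsilon>) u v \<longrightarrow>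
        compact (ess_support u) \<and> (\<exists>c. ess_support u = {x. \<Phi> x \<le> c}) \<and>
        compact (ess_support v) \<and> (\<exists>c. ess_support v = {x. \<Psi> x \<le> c})"
    proof (intro ballI allI impI)
      fix \<epsilon> u v assume e: "\<epsilon> \<in> {0..\<epsilon>s}" and min: "is_minimizer (energy F G \<Phi> \<Psi> h \<epsilon>) u v"
      obtain C where C: "mass \<epsilon> C = (1, 1)" using multipliers_exist e by metis
      note ae = minimizer_eq_dens[OF e C min]
      have "ess_support u = {x. \<Phi> x \<le> fst C}" "ess_support v = {x. \<Psi> x \<le> snd C}"
        using ess_support_cong[OF ae(1)] ess_support_cong[OF ae(2)] ess_support_dens[OF e C] by auto
      then show "compact (ess_support u) \<and> (\<exists>c. ess_support u = {x. \<Phi> x \<le> c}) \<and>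
          compact (ess_support v) \<and> (\<exists>c. ess_support v = {x. \<Psi> x \<le> c})"
        using potential_sublevel_compact[OF \<Phi> \<Lambda>] potential_sublevel_compact[OF \<Psi> \<Lambda>] by auto
    qed
    show "\<forall>k. degenerate k F G h \<longrightarrow>
        (\<exists>C. \<forall>\<epsilon>\<in>{0..\<epsilon>s}. \<forall>u v. is_minimizer (energy F G \<Phi> \<Psi> h \<epsilon>) u v \<longrightarrow>
           AE_Ck_bounded_on k (ess_support u) (\<lambda>x. deriv_nn F (u x)) C \<and>
           AE_Ck_bounded_on k (ess_support v) (\<lambda>x. deriv_nn G (v x)) C)"
    proof (intro allI impI)
      fix k assume "degenerate k F G h"
      then have deg: "Ck_vanishing_on_frontier k quadrant (theta_u F G h)"
        "Ck_vanishing_on_frontier k quadrant (theta_v F G h)"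
        by (auto simp: degenerate_def)
      obtain Eu where Eu: "has_partials k UNIV (Eu []) Eu" "\<And>p. p \<in> quadrant \<Longrightarrow> Eu [] p = theta_u F G h p"
        "\<And>bs p. set bs \<subseteq> Basis \<Longrightarrow> length bs \<le> k \<Longrightarrow> p \<notin> open_quadrant \<Longrightarrow> Eu bs p = 0"
        by (rule zero_extension_quadrant[OF deg(1)]) blast
      obtain Ev where Ev: "has_partials k UNIV (Ev []) Ev" "\<And>p. p \<in> quadrant \<Longrightarrow> Ev [] p = theta_v F G h p"
        "\<And>bs p. set bs \<subseteq> Basis \<Longrightarrow> length bs \<le> k \<Longrightarrow> p \<notin> open_quadrant \<Longrightarrow> Ev bs p = 0"
        by (rule zero_extension_quadrant[OF deg(2)]) blast
      interpret regular_problem F G h \<epsilon>s \<Phi> \<Psi> \<Lambda> M k Eu Ev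
        by unfold_locales (fact Eu Ev)+
      show "\<exists>C. \<forall>\<epsilon>\<in>{0..\<epsilon>s}. \<forall>u v. is_minimizer (energy F G \<Phi> \<Psi> h \<epsilon>) u v \<longrightarrow>
          AE_Ck_bounded_on k (ess_support u) (\<lambda>x. deriv_nn F (u x)) C \<and>
          AE_Ck_bounded_on k (ess_support v) (\<lambda>x. deriv_nn G (v x)) C"
        by (rule minimizer_Ck_bounds)
    qed
  qed
qed

end
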